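(* Let $\mathcal{X}$ be a complex Banach space and let $\mathcal{T}:\mathbb{R}\to B(\mathcal{X})$ be a strongly continuous isometric representation of the group $\mathbb{R}$ by operators on $\mathcal{X}$ such that its Beurling spectrum satisfies $\Lambda(\mathcal{X},\mathcal{T})\subseteq[0,\gamma]$, where $\gamma>0$. Then for every $t\in\left[0,\frac{\pi}{2\gamma}\right]$ one has $$\|\mathcal{T}(t)-I\|\le 1-\cos\gamma t+\sin\gamma t=2\sqrt2\,\sin\frac{\gamma t}{2}\,\sin\left(\frac{\gamma t}{2}+\frac\pi4\right).$$
   Context: $B(\mathcal{X})$ denotes the Banach algebra of bounded linear operators on $\mathcal{X}$ with the operator norm, and $I$ is the identity operator. A representation $\mathcal{T}:\mathbb{R}\to B(\mathcal{X})$ satisfies $\mathcal{T}(0)=I$ and $\mathcal{T}(s+t)=\mathcal{T}(s)\mathcal{T}(t)$; it is isometric if every $\mathcal{T}(t)$ is an isometry, and strongly continuous if $t\mapsto\mathcal{T}(t)y$ is continuous for every $y\in\mathcal{X}$. For $f\in L^1(\mathbb{R})$ and $y\in\mathcal{X}$ put $fy=\int_{\mathbb{R}}f(t)\mathcal{T}(-t)y\,dt$ (Bochner integral), and let $\widehat f(\xi)=\int_{\mathbb{R}}f(t)e^{-it\xi}\,dt$. The Beurling spectrum is $$\Lambda(\mathcal{X},\mathcal{T})=\{\lambda\in\mathbb{R}:\ \text{if } f\in L^1(\mathbb{R}) \text{ and } fy=0 \text{ for all } y\in\mathcal{X},\text{ then } \widehat f(\lambda)=0\}.$$ *)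

theory Defs
  imports "HOL-Analysis.Analysis"
begin

class complex_banach = banach +
  fixes scaleC :: "complex \<Rightarrow> 'a \<Rightarrow> 'a"  (infixr \<open>*\<^sub>C\<close> 75)
  assumes scaleC_add_right: "a *\<^sub>C (x + y) = a *\<^sub>C x + a *\<^sub>C y"
    and scaleC_add_left: "(a + b) *\<^sub>C x = a *\<^sub>C x + b *\<^sub>C x"
    and scaleC_scaleC: "a *\<^sub>C b *\<^sub>C x = (a * b) *\<^sub>C x"
    and scaleR_scaleC: "r *\<^sub>R x = complex_of_real r *\<^sub>C x"
    and norm_scaleC: "norm (a *\<^sub>C x) = cmod a * norm x"

instantiation complex :: complex_banach
begin

definition scaleC_complex :: "complex \<Rightarrow> complex \<Rightarrow> complex" where
  "scaleC_complex a x = a * x"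

instance
  by standard (simp_all add: scaleC_complex_def algebra_simps scaleR_conv_of_real norm_mult)

end

(* B(X) consists of the elements of 'a \<Rightarrow>\<^sub>L 'a (the bounded real-linear operators) satisfying
   this predicate; the operator norm does not depend on the scalar field. *)
definition complex_linear :: "('a::complex_banach \<Rightarrow>\<^sub>L 'a) \<Rightarrow> bool" where
  "complex_linear A \<longleftrightarrow> (\<forall>c x. blinfun_apply A (c *\<^sub>C x) = c *\<^sub>C blinfun_apply A x)"

definition representation :: "(real \<Rightarrow> 'a::complex_banach \<Rightarrow>\<^sub>L 'a) \<Rightarrow> bool" where
  "representation T \<longleftrightarrow>
     (\<forall>t. complex_linear (T t)) \<and> T 0 = id_blinfun \<and> (\<forall>s t. T (s + t) = T s o\<^sub>L T t)"

definition isometric :: "(real \<Rightarrow> 'a::complex_banach \<Rightarrow>\<^sub>L 'a) \<Rightarrow> bool" where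
  "isometric T \<longleftrightarrow> (\<forall>t y. norm (blinfun_apply (T t) y) = norm y)"

definition strongly_continuous :: "(real \<Rightarrow> 'a::complex_banach \<Rightarrow>\<^sub>L 'a) \<Rightarrow> bool" where
  "strongly_continuous T \<longleftrightarrow> (\<forall>y. continuous_on UNIV (\<lambda>t. blinfun_apply (T t) y))"

(* The library constants has_bochner_integral and lebesgue_integral carry the sort constraint
   second_countable_topology on the target, which would restrict us to separable spaces.  The next
   two definitions repeat them verbatim without that constraint.  Nothing changes in substance:
   approximability in mean by simple functions already forces f to be almost separably valued. *)
definition has_bochner :: "'b measure \<Rightarrow> ('b \<Rightarrow> 'a::banach) \<Rightarrow> 'a \<Rightarrow> bool" where
  "has_bochner M f x \<longleftrightarrow>
     f \<in> borel_measurable M \<and>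
     (\<exists>s. (\<forall>i::nat. Bochner_Integration.simple_bochner_integrable M (s i)) \<and>
        (\<lambda>i. \<integral>\<^sup>+ t. norm (f t - s i t) \<partial>M) \<longlonglongrightarrow> 0 \<and>
        (\<lambda>i. Bochner_Integration.simple_bochner_integral M (s i)) \<longlonglongrightarrow> x)"

definition bochner_integral :: "'b measure \<Rightarrow> ('b \<Rightarrow> 'a::banach) \<Rightarrow> 'a" where
  "bochner_integral M f = (if \<exists>x. has_bochner M f x then THE x. has_bochner M f x else 0)"

lemma has_bochner_eq_has_bochner_integral:
  fixes f :: "'b \<Rightarrow> 'a::{banach, second_countable_topology}"
  shows "has_bochner M f x \<longleftrightarrow> has_bochner_integral M f x"
  unfolding has_bochner_def has_bochner_integral.simps by blast

lemma bochner_integral_eq_lebesgue_integral: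
  fixes f :: "'b \<Rightarrow> 'a::{banach, second_countable_topology}"
  shows "bochner_integral M f = integral\<^sup>L M f"
  unfolding bochner_integral_def lebesgue_integral_def has_bochner_eq_has_bochner_integral ..

definition L1_act :: "(real \<Rightarrow> 'a::complex_banach \<Rightarrow>\<^sub>L 'a) \<Rightarrow> (real \<Rightarrow> complex) \<Rightarrow> 'a \<Rightarrow> 'a" where
  "L1_act T f y = bochner_integral lborel (\<lambda>t. f t *\<^sub>C blinfun_apply (T (- t)) y)"

definition fourier :: "(real \<Rightarrow> complex) \<Rightarrow> real \<Rightarrow> complex" where
  "fourier f \<xi> = (\<integral>t. f t * exp (- \<i> * complex_of_real t * complex_of_real \<xi>) \<partial>lborel)"

(* Elements of L1 are represented by Borel functions that are integrable for Lebesgue measure;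
   L1_act and fourier only depend on the class modulo null sets. *)
definition beurling_spectrum :: "(real \<Rightarrow> 'a::complex_banach \<Rightarrow>\<^sub>L 'a) \<Rightarrow> real set" where
  "beurling_spectrum T =
     {\<xi>. \<forall>f :: real \<Rightarrow> complex.
           integrable lborel f \<and> (\<forall>y. L1_act T f y = 0) \<longrightarrow> fourier f \<xi> = 0}"

end

theory Submission
  imports Defs "HOL-Probability.Probability"
begin

text \<open>It suffices to prove the operator Bernstein bound \<open>norm (T t - id_blinfun) \<le> \<gamma> * t\<close>, because
  \<open>x \<le> 1 - cos x + sin x\<close> on \<open>[0, pi / 2]\<close>.  A compactly supported \<open>C\<^sup>2\<close> symbol \<open>p\<close> acts on
  the space through the integrable kernel \<open>inverse_fourier p\<close>, and multiplying \<open>p\<close> by a character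
  translates the orbit.  A symbol supported off the Beurling spectrum acts as zero: this is local, and
  near a point \<open>l\<close> off the spectrum a function annihilating the representation with nonzero transform
  at \<open>l\<close> contracts every a priori bound.  Hence each vector is a limit of vectors \<open>z\<close> in the range
  of symbols supported in \<open>[- e, \<gamma> + e]\<close>.  After centring the interval, \<open>sin (\<theta> x)\<close> is a power
  series in \<open>sin x\<close> with nonnegative coefficients of sum at most \<open>\<theta> pi / 2\<close>, and \<open>sin x\<close> acts as
  half a difference of two isometries; this gives
  \<open>norm (T t z - cis (\<gamma> t / 2) *\<^sub>C z) \<le> (\<gamma> / 2 + 2 e) t * norm z\<close>, and the scalar factor
  \<open>cis (\<gamma> t / 2)\<close> costs another \<open>\<gamma> t / 2\<close>.\<close>

section \<open>Bochner integrals in non-separable spaces\<close>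

text \<open>The spectrum is defined only through functions that annihilate the whole space, so
  everything about symbols is drawn from one estimate: the norm of \<open>multiplier p y\<close> is
  at most linear in a bound for the second derivative of \<open>p\<close>. Two derivatives make the
  kernel decay like 1 / (1 + t^2), and on a fixed interval they control \<open>p\<close> and its
  first derivative as well. Hence smallness of symbols always means C^2 smallness, also for the
  truncated sine series. This shapes the constants. At x = pi / 2 every power sin x ^ n has
  derivative 0 while sin (\<theta> x) has not if \<theta> < 1, so C^2 convergence fails there and
  the rescaled interval must stay strictly inside (- pi / 2, pi / 2). Of the 2 e in the bound, one e
  is the collar of the support and the other buys this strictness. The coefficient sum \<theta> pi /
  2 is inherited from sin y \<le> y at y = \<theta> pi / 2. If rescaling sends the half-width
  \<alpha> = \<gamma> / 2 + 2 e to pi / 2, the sine of t (x - \<gamma> / 2) / 2 has \<theta> = t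
  \<alpha> / pi and costs t \<alpha> / 2; up to an isometry the increment is twice this
  sine.\<close>

lemma borel_measurable_norm_diff_simple:
  fixes f s :: "'b \<Rightarrow> 'a::real_normed_vector"
  assumes f: "f \<in> borel_measurable M" and s: "simple_function M s"
  shows "(\<lambda>x. norm (f x - s x)) \<in> borel_measurable M"
\<comment> \<open>In a non-separable space the difference of two Borel functions need not be Borel.
  As \<open>s\<close> has finitely many values, it is enough to freeze its value \<open>i\<close>
  and to compose \<open>f\<close> with a continuous function.\<close>
proof (rule measurable_compose_countable'[where I="s ` space M" and f="\<lambda>i x. norm (f x - i)"])
  show "(\<lambda>x. norm (f x - i)) \<in> borel_measurable M" for i
    by (rule measurable_compose[OF f], rule borel_measurable_continuous_onI)
       (intro continuous_intros)
  show "s \<in> measurable M (count_space (s ` space M))"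
    using s by (auto intro: measurable_count_space_extend measurable_simple_function
        simp: simple_function_def measurable_count_space_eq2)
  show "countable (s ` space M)"
    using s by (simp add: simple_function_def countable_finite)
qed

text \<open>The triangle inequality is taken pointwise through \<open>f\<close>, whose integral need
  not be known to exist. This yields the Cauchy property of approximating integrals and, with
  \<open>t = 0\<close>, the norm bound for the limit.\<close>

lemma simple_bochner_integral_diff_le:
  fixes f :: "'b \<Rightarrow> 'a::banach"
  assumes f: "f \<in> borel_measurable M"
    and s: "Bochner_Integration.simple_bochner_integrable M s"
    and t: "Bochner_Integration.simple_bochner_integrable M t"
  shows "ennreal (norm (Bochner_Integration.simple_bochner_integral M s
             - Bochner_Integration.simple_bochner_integral M t))
         \<le> (\<integral>\<^sup>+ x. norm (f x - s x) \<partial>M) + (\<integral>\<^sup>+ x. norm (f x - t x) \<partial>M)"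
proof -
  have sf: "simple_function M s" "simple_function M t"
    using s t by (auto elim: Bochner_Integration.simple_bochner_integrable.cases)
  note [measurable] = borel_measurable_norm_diff_simple[OF f sf(1)]
    borel_measurable_norm_diff_simple[OF f sf(2)]
  have "ennreal (norm (Bochner_Integration.simple_bochner_integral M s
             - Bochner_Integration.simple_bochner_integral M t))
      = norm (Bochner_Integration.simple_bochner_integral M (\<lambda>x. s x - t x))"
    using s t by (subst Bochner_Integration.simple_bochner_integral_diff) auto
  also have "\<dots> \<le> Bochner_Integration.simple_bochner_integral M (\<lambda>x. norm (s x - t x))"
    using Bochner_Integration.simple_bochner_integrable_compose2[of "(-)" M "s" "t"] s t
    by (auto intro!: Bochner_Integration.simple_bochner_integral_norm_bound)
  also have "\<dots> = (\<integral>\<^sup>+x. norm (s x - t x) \<partial>M)"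
    using Bochner_Integration.simple_bochner_integrable_compose2[of "\<lambda>x y. norm (x - y)" M "s" "t"] s t
    by (auto intro!: Bochner_Integration.simple_bochner_integral_eq_nn_integral)
  also have "\<dots> \<le> (\<integral>\<^sup>+x. ennreal (norm (f x - s x)) + ennreal (norm (f x - t x)) \<partial>M)"
  proof (rule nn_integral_mono)
    fix x
    have "norm (s x - t x) \<le> norm (f x - s x) + norm (f x - t x)"
      by (metis dual_order.refl norm_diff_triangle_le norm_minus_commute)
    then show "ennreal (norm (s x - t x)) \<le> ennreal (norm (f x - s x)) + ennreal (norm (f x - t x))"
      by (metis ennreal_leI ennreal_plus norm_ge_zero)
  qed
  also have "\<dots> = (\<integral>\<^sup>+ x. norm (f x - s x) \<partial>M) + (\<integral>\<^sup>+ x. norm (f x - t x) \<partial>M)"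
    by (rule nn_integral_add) auto
  finally show ?thesis .
qed

lemma ennreal_tendsto_0_le:
  fixes a b :: "nat \<Rightarrow> ennreal"
  assumes "\<And>i. a i \<le> b i" "b \<longlonglongrightarrow> 0"
  shows "a \<longlonglongrightarrow> 0"
  by (rule tendsto_sandwich[OF _ _ tendsto_const[of 0] assms(2)]) (use assms(1) in auto)

lemma has_bochnerE:
  assumes "has_bochner M f x"
  obtains s where "f \<in> borel_measurable M"
    "\<And>i. Bochner_Integration.simple_bochner_integrable M (s i)"
    "(\<lambda>i. \<integral>\<^sup>+ t. norm (f t - s i t) \<partial>M) \<longlonglongrightarrow> 0"
    "(\<lambda>i. Bochner_Integration.simple_bochner_integral M (s i)) \<longlonglongrightarrow> x"
  using assms unfolding has_bochner_def by blast

lemma has_bochner_exists: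
  fixes f :: "'b \<Rightarrow> 'a::banach"
  assumes f: "f \<in> borel_measurable M"
    and s: "\<And>i. Bochner_Integration.simple_bochner_integrable M (s i)"
    and lim: "(\<lambda>i. \<integral>\<^sup>+ t. norm (f t - s i t) \<partial>M) \<longlonglongrightarrow> 0"
  shows "\<exists>x. has_bochner M f x"
proof -
  have "Cauchy (\<lambda>i. Bochner_Integration.simple_bochner_integral M (s i))"
  proof (rule metric_CauchyI)
    fix e :: real assume e: "e > 0"
    have "eventually (\<lambda>i. (\<integral>\<^sup>+ t. norm (f t - s i t) \<partial>M) < ennreal (e/2)) sequentially"
      using lim e by (intro order_tendstoD) auto
    then obtain N where N: "\<And>i. i \<ge> N \<Longrightarrow> (\<integral>\<^sup>+ t. norm (f t - s i t) \<partial>M) < ennreal (e/2)"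
      by (auto simp: eventually_sequentially)
    show "\<exists>N. \<forall>m\<ge>N. \<forall>n\<ge>N. dist (Bochner_Integration.simple_bochner_integral M (s m))
        (Bochner_Integration.simple_bochner_integral M (s n)) < e"
    proof (intro exI allI impI)
      fix m n assume mn: "N \<le> m" "N \<le> n"
      have "ennreal (norm (Bochner_Integration.simple_bochner_integral M (s m)
             - Bochner_Integration.simple_bochner_integral M (s n))) < ennreal (e/2) + ennreal (e/2)"
        by (rule le_less_trans[OF simple_bochner_integral_diff_le[OF f s s]])
           (intro add_strict_mono N mn)
      also have "\<dots> = ennreal e"
        using e by (simp flip: ennreal_plus)
      finally show "dist (Bochner_Integration.simple_bochner_integral M (s m))
        (Bochner_Integration.simple_bochner_integral M (s n)) < e"
        using e by (simp add: dist_norm ennreal_less_iff)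
    qed
  qed
  then obtain x where "(\<lambda>i. Bochner_Integration.simple_bochner_integral M (s i)) \<longlonglongrightarrow> x"
    by (auto simp: Cauchy_convergent_iff convergent_def)
  with f s lim have "has_bochner M f x" unfolding has_bochner_def by (intro conjI exI[of _ s]) auto
  then show ?thesis ..
qed

text \<open>Measurability of the sum is a separate hypothesis because, without separability, it does
  not follow from that of the summands. In the applications the sum is again an integrable scalar
  function times a bounded continuous map, where \<open>has_bochner_scaleC_exists\<close> supplies
  it.\<close>

lemma has_bochner_add:
  fixes f g :: "'b \<Rightarrow> 'a::banach"
  assumes f: "has_bochner M f x" and g: "has_bochner M g y"
    and fg: "(\<lambda>t. f t + g t) \<in> borel_measurable M"
  shows "has_bochner M (\<lambda>t. f t + g t) (x + y)"
proof -
  from f obtain s where s: "f \<in> borel_measurable M"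
    "\<And>i. Bochner_Integration.simple_bochner_integrable M (s i)"
    "(\<lambda>i. \<integral>\<^sup>+ t. norm (f t - s i t) \<partial>M) \<longlonglongrightarrow> 0"
    "(\<lambda>i. Bochner_Integration.simple_bochner_integral M (s i)) \<longlonglongrightarrow> x" by (rule has_bochnerE) blast
  from g obtain r where r: "g \<in> borel_measurable M"
    "\<And>i. Bochner_Integration.simple_bochner_integrable M (r i)"
    "(\<lambda>i. \<integral>\<^sup>+ t. norm (g t - r i t) \<partial>M) \<longlonglongrightarrow> 0"
    "(\<lambda>i. Bochner_Integration.simple_bochner_integral M (r i)) \<longlonglongrightarrow> y" by (rule has_bochnerE) blast
  have sf: "simple_function M (s i)" "simple_function M (r i)" for i
    using s(2)[of i] r(2)[of i] by (auto elim: Bochner_Integration.simple_bochner_integrable.cases)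
  note [measurable] = borel_measurable_norm_diff_simple[OF s(1) sf(1)]
    borel_measurable_norm_diff_simple[OF r(1) sf(2)]
  show ?thesis unfolding has_bochner_def
  proof (intro conjI exI[of _ "\<lambda>i t. s i t + r i t"] allI fg)
    show "Bochner_Integration.simple_bochner_integrable M (\<lambda>t. s i t + r i t)" for i
      using Bochner_Integration.simple_bochner_integrable_compose2[of "(+)", OF _ s(2)[of i] r(2)[of i]] by simp
    show "(\<lambda>i. Bochner_Integration.simple_bochner_integral M (\<lambda>t. s i t + r i t)) \<longlonglongrightarrow> x + y"
      using tendsto_add[OF s(4) r(4)] s(2) r(2)
      by (simp add: Bochner_Integration.simple_bochner_integral_add)
    have le: "(\<integral>\<^sup>+ t. norm (f t + g t - (s i t + r i t)) \<partial>M)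
        \<le> (\<integral>\<^sup>+ t. norm (f t - s i t) \<partial>M) + (\<integral>\<^sup>+ t. norm (g t - r i t) \<partial>M)" for i
    proof -
      have "(\<integral>\<^sup>+ t. norm (f t + g t - (s i t + r i t)) \<partial>M)
          \<le> (\<integral>\<^sup>+ t. ennreal (norm (f t - s i t)) + ennreal (norm (g t - r i t)) \<partial>M)"
      proof (rule nn_integral_mono)
        fix t
        have "norm (f t + g t - (s i t + r i t)) \<le> norm (f t - s i t) + norm (g t - r i t)"
          by (rule norm_diff_triangle_ineq)
        then show "ennreal (norm (f t + g t - (s i t + r i t)))
            \<le> ennreal (norm (f t - s i t)) + ennreal (norm (g t - r i t))"
          by (metis ennreal_leI ennreal_plus norm_ge_zero)
      qed
      also have "\<dots> = (\<integral>\<^sup>+ t. norm (f t - s i t) \<partial>M) + (\<integral>\<^sup>+ t. norm (g t - r i t) \<partial>M)"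
        by (rule nn_integral_add) auto
      finally show ?thesis .
    qed
    have "(\<lambda>i. (\<integral>\<^sup>+ t. norm (f t - s i t) \<partial>M) + (\<integral>\<^sup>+ t. norm (g t - r i t) \<partial>M)) \<longlonglongrightarrow> 0 + 0"
      by (intro tendsto_add s(3) r(3))
    from ennreal_tendsto_0_le[OF le, OF this[simplified]] show "(\<lambda>i. \<integral>\<^sup>+ t. norm (f t + g t - (s i t + r i t)) \<partial>M) \<longlonglongrightarrow> 0" .
  qed
qed

lemma has_bochner_bounded_linear:
  fixes f :: "'b \<Rightarrow> 'a::banach" and L :: "'a \<Rightarrow> 'c::banach"
  assumes L: "bounded_linear L" and f: "has_bochner M f x"
  shows "has_bochner M (\<lambda>t. L (f t)) (L x)"
proof -
  interpret L: bounded_linear L by fact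
  from f obtain s where s: "f \<in> borel_measurable M"
    "\<And>i. Bochner_Integration.simple_bochner_integrable M (s i)"
    "(\<lambda>i. \<integral>\<^sup>+ t. norm (f t - s i t) \<partial>M) \<longlonglongrightarrow> 0"
    "(\<lambda>i. Bochner_Integration.simple_bochner_integral M (s i)) \<longlonglongrightarrow> x" by (rule has_bochnerE) blast
  have sf: "simple_function M (s i)" for i
    using s(2)[of i] by (auto elim: Bochner_Integration.simple_bochner_integrable.cases)
  note [measurable] = borel_measurable_norm_diff_simple[OF s(1) sf]
  obtain K where K: "K > 0" "\<And>x. norm (L x) \<le> norm x * K"
    using L.pos_bounded by blast
  show ?thesis unfolding has_bochner_def
  proof (intro conjI exI[of _ "\<lambda>i t. L (s i t)"] allI)
    show "(\<lambda>t. L (f t)) \<in> borel_measurable M"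
      by (rule measurable_compose[OF s(1)], rule borel_measurable_continuous_onI)
         (rule L.continuous_on[OF continuous_on_id])
    show "Bochner_Integration.simple_bochner_integrable M (\<lambda>t. L (s i t))" for i
      using Bochner_Integration.simple_bochner_integrable_compose2[of "\<lambda>x y. L x", OF _ s(2)[of i] s(2)[of i]] L.zero by simp
    show "(\<lambda>i. Bochner_Integration.simple_bochner_integral M (\<lambda>t. L (s i t))) \<longlonglongrightarrow> L x"
      using L.tendsto[OF s(4)] s(2) L.linear
      by (simp add: Bochner_Integration.simple_bochner_integral_linear)
    have le: "(\<integral>\<^sup>+ t. norm (L (f t) - L (s i t)) \<partial>M)
        \<le> ennreal K * (\<integral>\<^sup>+ t. norm (f t - s i t) \<partial>M)" for i
    proof -
      have "(\<integral>\<^sup>+ t. norm (L (f t) - L (s i t)) \<partial>M)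
          \<le> (\<integral>\<^sup>+ t. ennreal K * ennreal (norm (f t - s i t)) \<partial>M)"
      proof (rule nn_integral_mono)
        fix t
        have "norm (L (f t) - L (s i t)) \<le> K * norm (f t - s i t)"
          using K(2)[of "f t - s i t"] by (simp add: L.diff mult.commute)
        then show "ennreal (norm (L (f t) - L (s i t))) \<le> ennreal K * ennreal (norm (f t - s i t))"
          using K(1) by (simp flip: ennreal_mult add: ennreal_leI)
      qed
      also have "\<dots> = ennreal K * (\<integral>\<^sup>+ t. norm (f t - s i t) \<partial>M)"
        by (rule nn_integral_cmult) auto
      finally show ?thesis .
    qed
    have "(\<lambda>i. ennreal K * (\<integral>\<^sup>+ t. norm (f t - s i t) \<partial>M)) \<longlonglongrightarrow> ennreal K * 0"
      by (intro ennreal_tendsto_cmult s(3)) auto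
    from ennreal_tendsto_0_le[OF le, OF this[simplified]] show "(\<lambda>i. \<integral>\<^sup>+ t. norm (L (f t) - L (s i t)) \<partial>M) \<longlonglongrightarrow> 0" .
  qed
qed

lemma has_bochner_norm_le:
  fixes f :: "'b \<Rightarrow> 'a::banach"
  assumes f: "has_bochner M f x"
  shows "ennreal (norm x) \<le> (\<integral>\<^sup>+ t. norm (f t) \<partial>M)"
proof -
  from f obtain s where s: "f \<in> borel_measurable M"
    "\<And>i. Bochner_Integration.simple_bochner_integrable M (s i)"
    "(\<lambda>i. \<integral>\<^sup>+ t. norm (f t - s i t) \<partial>M) \<longlonglongrightarrow> 0"
    "(\<lambda>i. Bochner_Integration.simple_bochner_integral M (s i)) \<longlonglongrightarrow> x" by (rule has_bochnerE) blast
  have z: "Bochner_Integration.simple_bochner_integrable M (\<lambda>_. 0::'a)"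
    by (auto intro!: Bochner_Integration.simple_bochner_integrable.intros)
  have z0: "Bochner_Integration.simple_bochner_integral M (\<lambda>_. 0::'a) = 0"
    unfolding Bochner_Integration.simple_bochner_integral_def by (rule sum.neutral) auto
  have le: "ennreal (norm (Bochner_Integration.simple_bochner_integral M (s i)))
      \<le> (\<integral>\<^sup>+ t. norm (f t - s i t) \<partial>M) + (\<integral>\<^sup>+ t. norm (f t) \<partial>M)" for i
    using simple_bochner_integral_diff_le[OF s(1) s(2)[of i] z] by (simp add: z0)
  have l1: "(\<lambda>i. (\<integral>\<^sup>+ t. norm (f t - s i t) \<partial>M) + (\<integral>\<^sup>+ t. norm (f t) \<partial>M))
      \<longlonglongrightarrow> 0 + (\<integral>\<^sup>+ t. norm (f t) \<partial>M)"
    by (intro tendsto_add s(3) tendsto_const)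
  have l2: "(\<lambda>i. ennreal (norm (Bochner_Integration.simple_bochner_integral M (s i)))) \<longlonglongrightarrow> ennreal (norm x)"
    by (intro tendsto_ennrealI tendsto_norm s(4))
  have "ennreal (norm x) \<le> 0 + (\<integral>\<^sup>+ t. norm (f t) \<partial>M)"
    by (rule LIMSEQ_le[OF l2 l1]) (use le in auto)
  then show ?thesis by simp
qed

lemma has_bochner_diff_norm_le:
  fixes f g :: "'b \<Rightarrow> 'a::banach"
  assumes f: "has_bochner M f x" and g: "has_bochner M g y"
    and fg: "(\<lambda>t. f t - g t) \<in> borel_measurable M"
  shows "ennreal (norm (x - y)) \<le> (\<integral>\<^sup>+ t. norm (f t - g t) \<partial>M)"
proof -
  have "has_bochner M (\<lambda>t. - g t) (- y)"
    by (rule has_bochner_bounded_linear[OF bounded_linear_minus[OF bounded_linear_ident] g])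
  from has_bochner_add[OF f this] fg have "has_bochner M (\<lambda>t. f t - g t) (x - y)" by simp
  then show ?thesis by (rule has_bochner_norm_le)
qed

lemma has_bochner_unique:
  assumes "has_bochner M f x" "has_bochner M f y"
  shows "x = y"
  using has_bochner_diff_norm_le[OF assms] by simp

lemma bochner_integral_eq: "has_bochner M f x \<Longrightarrow> bochner_integral M f = x"
  unfolding bochner_integral_def using has_bochner_unique by (metis the_equality)

text \<open>Translating the approximating simple functions preserves their range and the measure of
  every level set, hence their integrals and their distance to \<open>f\<close>. The lemma is the
  substitution behind \<open>L1_act_shift\<close>.\<close>

lemma has_bochner_shift:
  fixes f :: "real \<Rightarrow> 'a::banach"
  assumes f: "has_bochner lborel f x"
  shows "has_bochner lborel (\<lambda>t. f (t + c)) x"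
proof -
  have D: "distr lborel borel (\<lambda>t. t + c) = (lborel :: real measure)"
  proof -
    have "(\<lambda>t. t + c) = (+) c" by auto
    then show ?thesis using lborel_distr_plus[of c] by simp
  qed
  have meas: "(\<lambda>t. t + c) \<in> measurable lborel lborel" by simp
  from f obtain s where s: "f \<in> borel_measurable lborel"
    "\<And>i. Bochner_Integration.simple_bochner_integrable lborel (s i)"
    "(\<lambda>i. \<integral>\<^sup>+ t. norm (f t - s i t) \<partial>lborel) \<longlonglongrightarrow> 0"
    "(\<lambda>i. Bochner_Integration.simple_bochner_integral lborel (s i)) \<longlonglongrightarrow> x" by (rule has_bochnerE) blast
  have sf: "simple_function lborel (s i)" for i
    using s(2)[of i] by (auto elim: Bochner_Integration.simple_bochner_integrable.cases)
  have nn: "(\<lambda>t. norm (f t - s i t)) \<in> borel_measurable lborel" for i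
    by (rule borel_measurable_norm_diff_simple[OF s(1) sf])
  have [measurable]: "s i \<in> measurable lborel (count_space UNIV)" for i
    using sf by (rule measurable_simple_function)
  have em: "emeasure lborel {t. P (s i (t + c))} = emeasure lborel {t. P (s i t)}" for P i
  proof -
    have "s i -` {u. P u} \<inter> space lborel \<in> sets lborel"
      by (rule measurable_sets[OF measurable_simple_function[OF sf]]) simp
    then have A: "{t. P (s i t)} \<in> sets borel" by (simp add: vimage_def)
    have "emeasure lborel {t. P (s i t)} = emeasure (distr lborel borel (\<lambda>t. t + c)) {t. P (s i t)}"
      by (simp add: D)
    also have "\<dots> = emeasure lborel ((\<lambda>t. t + c) -` {t. P (s i t)} \<inter> space lborel)"
      by (rule emeasure_distr) (use A in auto)
    also have "((\<lambda>t. t + c) -` {t. P (s i t)} \<inter> space lborel) = {t. P (s i (t + c))}"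
      by auto
    finally show ?thesis by simp
  qed
  show ?thesis unfolding has_bochner_def
  proof (intro conjI exI[of _ "\<lambda>i t. s i (t + c)"] allI)
    show "(\<lambda>t. f (t + c)) \<in> borel_measurable lborel"
      by (rule measurable_compose[OF meas s(1)])
    have fin: "finite (range (s i))" for i using sf[of i] by (simp add: simple_function_def)
    have sur: "range (\<lambda>t. s i (t + c)) = range (s i)" for i
      by (rule set_eqI) (metis (mono_tags, lifting) diff_add_cancel rangeE rangeI)
    show "Bochner_Integration.simple_bochner_integrable lborel (\<lambda>t. s i (t + c))" for i
    proof (rule Bochner_Integration.simple_bochner_integrable.intros)
      show "simple_function lborel (\<lambda>t. s i (t + c))"
        unfolding simple_function_def
      proof (intro conjI ballI)
        show "finite ((\<lambda>t. s i (t + c)) ` space lborel)"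
          using fin[of i] sur[of i] by simp
        fix z
        have "(\<lambda>t. s i (t + c)) \<in> measurable lborel (count_space UNIV)"
          by (rule measurable_compose[OF meas]) measurable
        then show "(\<lambda>t. s i (t + c)) -` {z} \<inter> space lborel \<in> sets lborel"
          by (rule measurable_sets) auto
      qed
      show "emeasure lborel {y \<in> space lborel. s i (y + c) \<noteq> 0} \<noteq> \<infinity>"
        using em[of "\<lambda>u. u \<noteq> 0" i] s(2)[of i]
        by (auto simp: Bochner_Integration.simple_bochner_integrable.simps)
    qed
    have "Bochner_Integration.simple_bochner_integral lborel (\<lambda>t. s i (t + c))
        = Bochner_Integration.simple_bochner_integral lborel (s i)" for i
      unfolding Bochner_Integration.simple_bochner_integral_def
      using em[of "\<lambda>u. u = z" i for z] by (simp add: sur measure_def)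
    then show "(\<lambda>i. Bochner_Integration.simple_bochner_integral lborel (\<lambda>t. s i (t + c))) \<longlonglongrightarrow> x"
      using s(4) by simp
    have "(\<integral>\<^sup>+ t. norm (f (t + c) - s i (t + c)) \<partial>lborel) = (\<integral>\<^sup>+ t. norm (f t - s i t) \<partial>lborel)" for i
    proof -
      have "(\<integral>\<^sup>+ t. norm (f t - s i t) \<partial>lborel)
          = (\<integral>\<^sup>+ t. norm (f t - s i t) \<partial>distr lborel borel (\<lambda>t. t + c))" by (simp add: D)
      also have "\<dots> = (\<integral>\<^sup>+ t. norm (f (t + c) - s i (t + c)) \<partial>lborel)"
        by (rule nn_integral_distr) (use nn[of i] in simp_all)
      finally show ?thesis by simp
    qed
    then show "(\<lambda>i. \<integral>\<^sup>+ t. norm (f (t + c) - s i (t + c)) \<partial>lborel) \<longlonglongrightarrow> 0"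
      using s(3) by simp
  qed
qed

section \<open>Complex scalars and existence of the integral along a continuous orbit\<close>

lemma bounded_bilinear_scaleC: "bounded_bilinear (scaleC :: complex \<Rightarrow> 'a::complex_banach \<Rightarrow> 'a)"
proof
  show "\<exists>K. \<forall>a (b::'a). norm (a *\<^sub>C b) \<le> norm a * norm b * K"
    by (rule exI[of _ 1]) (simp add: norm_scaleC)
  show "(r *\<^sub>R a) *\<^sub>C b = r *\<^sub>R (a *\<^sub>C b)" "a *\<^sub>C (r *\<^sub>R b) = r *\<^sub>R (a *\<^sub>C b)" for r a and b :: 'a
    by (simp_all only: scaleR_scaleC[where ?'a='a] scaleC_scaleC scaleR_conv_of_real mult.commute)
qed (simp_all add: scaleC_add_left scaleC_add_right)

interpretation scaleC: bounded_bilinear "scaleC :: complex \<Rightarrow> 'a::complex_banach \<Rightarrow> 'a"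
  by (rule bounded_bilinear_scaleC)

lemma scaleC_one [simp]: "1 *\<^sub>C (x::'a::complex_banach) = x"
  using scaleR_scaleC[of 1 x] by simp

text \<open>No measurability theory for maps into the (possibly non-separable) product space is needed:
  a bounded continuous function on the line is a pointwise limit of step functions.\<close>

lemma has_bochner_scaleC_exists:
  fixes f :: "real \<Rightarrow> complex" and g :: "real \<Rightarrow> 'a::complex_banach"
  assumes f: "integrable lborel f" and g: "continuous_on UNIV g" and B: "\<And>t. norm (g t) \<le> B"
  shows "\<exists>x. has_bochner lborel (\<lambda>t. f t *\<^sub>C g t) x"
proof -
  have B0: "0 \<le> B" using B[of 0] order_trans[OF norm_ge_zero] by metis
  have fm[measurable]: "f \<in> borel_measurable lborel" using f by simp
  obtain s where s: "\<And>i. simple_function lborel (s i)"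
      "\<And>x. (\<lambda>i. s i x) \<longlonglongrightarrow> f x" "\<And>i x. dist (s i x) 0 \<le> 2 * dist (f x) 0"
    using borel_measurable_implies_sequence_metric[OF fm, of 0] by auto
  \<comment> \<open>\<open>q i t\<close> rounds \<open>t\<close> down to the grid of mesh 1 / (i +
    1). Cutting \<open>r i\<close> off outside [- i, i] leaves only finitely many grid points, so
    \<open>r i\<close> has finite range.\<close>
  define q where "q i t = real_of_int \<lfloor>real (Suc i) * t\<rfloor> / real (Suc i)" for i t
  define r where "r i t = (if \<bar>t\<bar> \<le> real i then s i t *\<^sub>C g (q i t) else 0)" for i t
  have qb: "\<bar>t - q i t\<bar> \<le> 1 / real (Suc i)" for i t
  proof -
    have "0 \<le> real (Suc i) * t - real_of_int \<lfloor>real (Suc i) * t\<rfloor>"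
      "real (Suc i) * t - real_of_int \<lfloor>real (Suc i) * t\<rfloor> \<le> 1" by linarith+
    moreover have "t - q i t = (real (Suc i) * t - real_of_int \<lfloor>real (Suc i) * t\<rfloor>) / real (Suc i)"
      unfolding q_def diff_divide_distrib by simp
    ultimately show ?thesis by (simp add: divide_right_mono del: of_nat_Suc)
  qed
  have qlim: "(\<lambda>i. q i t) \<longlonglongrightarrow> t" for t
  proof -
    have "(\<lambda>i. t - q i t) \<longlonglongrightarrow> 0"
      by (rule Lim_null_comparison[where g="\<lambda>i. 1 / real (Suc i)"])
         (use qb LIMSEQ_inverse_real_of_nat in \<open>auto simp: inverse_eq_divide\<close>)
    from tendsto_diff[OF tendsto_const[of t] this] show ?thesis by simp
  qed
  have rlim: "(\<lambda>i. r i t) \<longlonglongrightarrow> f t *\<^sub>C g t" for t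
  proof -
    have "(\<lambda>i. s i t *\<^sub>C g (q i t)) \<longlonglongrightarrow> f t *\<^sub>C g t"
    proof (intro scaleC.tendsto s(2))
      have "isCont g t" using g by (simp add: continuous_on_eq_continuous_at)
      then show "(\<lambda>i. g (q i t)) \<longlonglongrightarrow> g t" using qlim by (rule isCont_tendsto_compose)
    qed
    moreover have "eventually (\<lambda>i. r i t = s i t *\<^sub>C g (q i t)) sequentially"
      unfolding r_def using eventually_ge_at_top[of "nat \<lceil>\<bar>t\<bar>\<rceil>"]
    proof eventually_elim
      case (elim i)
      then have "\<bar>t\<bar> \<le> real i" by linarith
      then show ?case by simp
    qed
    ultimately show ?thesis by (simp cong: tendsto_cong)
  qed
  have rsf: "simple_function lborel (r i)" for i
  proof -
    define K where "K = \<lceil>real (Suc i) * real i\<rceil>"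
    \<comment> \<open>\<open>h\<close> is the index of the grid point. Inside [- i, i] the floor
      never exceeds \<open>K\<close>, so the value \<open>K + 1\<close> is free to mark the points
      outside.\<close>
    define h where "h t = (if \<bar>t\<bar> \<le> real i then \<lfloor>real (Suc i) * t\<rfloor> else K + 1)" for t
    have hsf: "simple_function lborel h"
      unfolding simple_function_def
    proof (intro conjI ballI)
      have "h t \<in> {- K - 1..K + 1}" for t
      proof (cases "\<bar>t\<bar> \<le> real i")
        case True
        have "\<bar>real (Suc i) * t\<bar> \<le> real (Suc i) * real i"
          using True unfolding abs_mult by (simp add: mult_left_mono)
        then have "\<bar>real (Suc i) * t\<bar> \<le> K" unfolding K_def by linarith
        then show ?thesis using True unfolding h_def by (simp; linarith)
      next
        case False
        have "0 \<le> K" unfolding K_def by (simp add: zero_le_ceiling) (smt (verit) of_nat_0_le_iff zero_le_mult_iff)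
        then show ?thesis using False by (simp add: h_def)
      qed
      then show "finite (h ` space lborel)"
        by (intro finite_subset[OF _ finite_atLeastAtMost_int[of "- K - 1" "K + 1"]]) auto
      fix z
      have "{t \<in> space lborel. h t = z} \<in> sets lborel" unfolding h_def by measurable
      moreover have "h -` {z} \<inter> space lborel = {t \<in> space lborel. h t = z}" by auto
      ultimately show "h -` {z} \<inter> space lborel \<in> sets lborel" by simp
    qed
    define v where "v a b = (if b = K + 1 then 0 else a *\<^sub>C g (real_of_int b / real (Suc i)))" for a b
    have "r i t = v (s i t) (h t)" for t
    proof (cases "\<bar>t\<bar> \<le> real i")
      case True
      have "real (Suc i) * t \<le> real (Suc i) * real i" using True by (intro mult_left_mono) auto
      then have "\<lfloor>real (Suc i) * t\<rfloor> \<noteq> K + 1" unfolding K_def by linarith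
      then show ?thesis using True by (simp add: r_def v_def h_def q_def)
    qed (simp add: r_def v_def h_def)
    moreover have "simple_function lborel (\<lambda>t. v (s i t) (h t))"
      by (rule simple_function_compose2[OF s(1) hsf])
    ultimately show ?thesis by (simp cong: simple_function_cong)
  qed
  have rb: "norm (r i t) \<le> 2 * B * norm (f t)" for i t
  proof -
    have "norm (s i t *\<^sub>C g (q i t)) \<le> (2 * norm (f t)) * B"
      unfolding norm_scaleC using s(3)[of i t] B by (intro mult_mono) auto
    then show ?thesis using B0 by (auto simp: r_def mult_ac)
  qed
  have F: "(\<lambda>t. f t *\<^sub>C g t) \<in> borel_measurable lborel"
    by (rule borel_measurable_LIMSEQ_metric[where f=r, OF borel_measurable_simple_function[OF rsf] rlim])
  have nint: "(\<integral>\<^sup>+ t. ennreal (norm (f t)) \<partial>lborel) < \<infinity>"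
    using f by (simp add: integrable_iff_bounded)
  have fin: "(\<integral>\<^sup>+ t. ennreal (K * norm (f t)) \<partial>lborel) < \<infinity>" if "0 \<le> K" for K
    using nint that by (simp add: ennreal_mult nn_integral_cmult ennreal_mult_less_top)
  show ?thesis
  proof (rule has_bochner_exists[OF F, where s=r])
    show "Bochner_Integration.simple_bochner_integrable lborel (r i)" for i
    proof (rule Bochner_Integration.simple_bochner_integrableI_bounded[OF rsf])
      have "(\<integral>\<^sup>+ t. ennreal (norm (r i t)) \<partial>lborel) \<le> (\<integral>\<^sup>+ t. ennreal (2 * B * norm (f t)) \<partial>lborel)"
        by (intro nn_integral_mono ennreal_leI rb)
      also have "\<dots> < \<infinity>" by (rule fin) (use B0 in simp)
      finally show "(\<integral>\<^sup>+ t. ennreal (norm (r i t)) \<partial>lborel) < \<infinity>" .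
    qed
    have "(\<lambda>i. \<integral>\<^sup>+ t. ennreal (norm (f t *\<^sub>C g t - r i t)) \<partial>lborel) \<longlonglongrightarrow> (\<integral>\<^sup>+ t. ennreal 0 \<partial>(lborel::real measure))"
    \<comment> \<open>The approximants \<open>s\<close> only satisfy |s| \<le> 2 |f|; together with
      the limit itself this makes 3 B |f| the dominating function.\<close>
    proof (rule nn_integral_dominated_convergence[where w="\<lambda>t. ennreal (3 * B * norm (f t))"])
      show "(\<lambda>t. ennreal (norm (f t *\<^sub>C g t - r i t))) \<in> borel_measurable lborel" for i
        using borel_measurable_norm_diff_simple[OF F rsf] by (intro measurable_compose[OF _ measurable_ennreal])
      show "(\<integral>\<^sup>+ t. ennreal (3 * B * norm (f t)) \<partial>lborel) < \<infinity>" by (rule fin) (use B0 in simp)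
      show "AE t in lborel. (\<lambda>i. ennreal (norm (f t *\<^sub>C g t - r i t))) \<longlonglongrightarrow> ennreal 0"
      proof (intro AE_I2 tendsto_ennrealI)
        fix t
        have "(\<lambda>i. norm (f t *\<^sub>C g t - r i t)) \<longlonglongrightarrow> norm (f t *\<^sub>C g t - f t *\<^sub>C g t)"
          by (intro tendsto_intros rlim)
        then show "(\<lambda>i. norm (f t *\<^sub>C g t - r i t)) \<longlonglongrightarrow> 0" by simp
      qed
      show "AE t in lborel. ennreal (norm (f t *\<^sub>C g t - r i t)) \<le> ennreal (3 * B * norm (f t))" for i
      proof (intro AE_I2 ennreal_leI)
        fix t
        have "norm (f t *\<^sub>C g t) \<le> B * norm (f t)"
          unfolding norm_scaleC mult.commute[of "cmod (f t)"] by (intro mult_right_mono B norm_ge_zero)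
        then show "norm (f t *\<^sub>C g t - r i t) \<le> 3 * B * norm (f t)"
          using rb[of i t] norm_triangle_ineq4[of "f t *\<^sub>C g t" "r i t"] by linarith
      qed
    qed auto
    then show "(\<lambda>i. \<integral>\<^sup>+ t. ennreal (norm (f t *\<^sub>C g t - r i t)) \<partial>lborel) \<longlonglongrightarrow> 0" by simp
  qed
qed

section \<open>Compactly supported symbols and their kernels\<close>

definition C2_derivs :: "(real \<Rightarrow> complex) \<Rightarrow> (real \<Rightarrow> complex) \<Rightarrow> (real \<Rightarrow> complex) \<Rightarrow> bool" where
  "C2_derivs p p1 p2 \<longleftrightarrow> (\<forall>x. (p has_vector_derivative p1 x) (at x)) \<and>
     (\<forall>x. (p1 has_vector_derivative p2 x) (at x)) \<and> continuous_on UNIV p2"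

text \<open>The endpoints belong to the zero set, so boundary terms of an integration by parts over
  [a, b] disappear and a mean value estimate can start from the value 0 at \<open>a\<close>.\<close>

definition vanishes_off :: "real \<Rightarrow> real \<Rightarrow> (real \<Rightarrow> complex) \<Rightarrow> bool" where
  "vanishes_off a b p \<longleftrightarrow> (\<forall>x. x \<le> a \<or> b \<le> x \<longrightarrow> p x = 0)"

text \<open>\<open>N\<close> is the only size that is recorded. On the fixed interval it bounds the
  first derivative by (b - a) N and the symbol by (b - a)^2 N, and it controls the L1 norm of the
  kernel.\<close>

definition test_fun :: "real \<Rightarrow> real \<Rightarrow> real \<Rightarrow> (real \<Rightarrow> complex) \<Rightarrow> bool" where
  "test_fun a b N p \<longleftrightarrow> a < b \<and> (\<exists>p1 p2. C2_derivs p p1 p2 \<and> vanishes_off a b p \<and>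
     vanishes_off a b p1 \<and> vanishes_off a b p2 \<and> (\<forall>x. norm (p2 x) \<le> N))"

text \<open>The sign matches the \<open>T (- t)\<close> in \<open>L1_act\<close>: multiplying the
  symbol by \<open>cis (s * x)\<close> shifts the kernel by \<open>s\<close>, which acts as
  \<open>T s\<close>. There is no factor 1 / (2 pi), so approximate identities converge to a nonzero
  multiple of the identity.\<close>

definition inverse_fourier :: "(real \<Rightarrow> complex) \<Rightarrow> real \<Rightarrow> complex" where
  "inverse_fourier p t = (\<integral>\<xi>. p \<xi> * cis (t * \<xi>) \<partial>lborel)"

lemma C2_derivsD:
  assumes "C2_derivs p p1 p2"
  shows "(p has_vector_derivative p1 x) (at x)" "(p1 has_vector_derivative p2 x) (at x)"
    "continuous_on UNIV p" "continuous_on UNIV p1" "continuous_on UNIV p2"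
  using assms unfolding C2_derivs_def continuous_on_eq_continuous_within
  by (auto intro: has_vector_derivative_continuous)

lemma C2_derivs_add:
  assumes "C2_derivs p p1 p2" "C2_derivs q q1 q2"
  shows "C2_derivs (\<lambda>x. p x + q x) (\<lambda>x. p1 x + q1 x) (\<lambda>x. p2 x + q2 x)"
  using assms unfolding C2_derivs_def
  by (auto intro!: has_vector_derivative_add continuous_on_add)

lemma C2_derivs_mult:
  assumes "C2_derivs p p1 p2" "C2_derivs q q1 q2"
  shows "C2_derivs (\<lambda>x. p x * q x) (\<lambda>x. p x * q1 x + p1 x * q x)
    (\<lambda>x. p x * q2 x + 2 * (p1 x * q1 x) + p2 x * q x)"
proof -
  note d = C2_derivsD[OF assms(1)] C2_derivsD[OF assms(2)]
  have "((\<lambda>x. p x * q1 x + p1 x * q x) has_vector_derivative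
      (p x * q2 x + p1 x * q1 x) + (p1 x * q1 x + p2 x * q x)) (at x)" for x
    by (intro has_vector_derivative_add has_vector_derivative_mult d)
  then show ?thesis unfolding C2_derivs_def
    by (auto intro!: has_vector_derivative_mult continuous_intros d simp: algebra_simps)
qed

lemma C2_derivs_const: "C2_derivs (\<lambda>x. c) (\<lambda>x. 0) (\<lambda>x. 0)"
  by (auto simp: C2_derivs_def)

lemma has_vector_derivative_cis:
  "((\<lambda>x. cis (c * x)) has_vector_derivative (\<i> * c * cis (c * x))) (at x)"
proof -
  have "((\<lambda>x. cis (c * x)) has_derivative (\<lambda>t. (c * t) *\<^sub>R (\<i> * cis (c * x)))) (at x)"
    by (auto intro!: derivative_eq_intros)
  then show ?thesis
    unfolding has_vector_derivative_def by (simp add: scaleR_conv_of_real mult_ac)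
qed

lemma C2_derivs_cis: "C2_derivs (\<lambda>x. cis (c * x)) (\<lambda>x. \<i> * c * cis (c * x)) (\<lambda>x. - complex_of_real (c * c) * cis (c * x))"
proof -
  have "((\<lambda>x. \<i> * c * cis (c * x)) has_vector_derivative (\<i> * c * (\<i> * c * cis (c * x)))) (at x)" for x
    by (intro has_vector_derivative_mult_right has_vector_derivative_cis)
  moreover have "\<i> * c * (\<i> * c * cis (c * x)) = - complex_of_real (c * c) * cis (c * x)" for x
    by (simp add: mult_ac)
  moreover have "continuous_on UNIV (\<lambda>x. - complex_of_real (c * c) * cis (c * x))"
    by (intro continuous_intros)
  ultimately show ?thesis unfolding C2_derivs_def
    using has_vector_derivative_cis by simp
qed

lemma test_fun_less: "test_fun a b N p \<Longrightarrow> a < b"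
  by (simp add: test_fun_def)

lemma test_fun_nonneg: "test_fun a b N p \<Longrightarrow> 0 \<le> N"
  unfolding test_fun_def using norm_ge_zero order_trans by blast

lemma test_funE:
  assumes "test_fun a b N p"
  obtains p1 p2 where "C2_derivs p p1 p2" "vanishes_off a b p" "vanishes_off a b p1"
    "vanishes_off a b p2" "\<And>x. norm (p2 x) \<le> N"
  using assms unfolding test_fun_def by blast

lemma test_fun_continuous: "test_fun a b N p \<Longrightarrow> continuous_on UNIV p"
  by (auto elim: test_funE dest: C2_derivsD)

lemma test_fun_vanishes: "test_fun a b N p \<Longrightarrow> vanishes_off a b p"
  by (auto elim: test_funE)

lemma norm_le_of_derivative_bound:
  fixes q :: "real \<Rightarrow> complex"
  assumes q: "\<And>x. (q has_vector_derivative q' x) (at x)"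
    and z: "vanishes_off a b q" "vanishes_off a b q'" and ab: "a < b" and B: "\<And>x. norm (q' x) \<le> B"
  shows "norm (q x) \<le> (b - a) * B"
proof -
  have B0: "0 \<le> B" using B[of a] order_trans[OF norm_ge_zero] by metis
  show ?thesis
  proof (cases "a \<le> x \<and> x \<le> b")
    case True
    have za: "q a = 0" "q' a = 0" using z by (auto simp: vanishes_off_def)
    \<comment> \<open>The linearisation is taken at \<open>a\<close>, where both \<open>q\<close>
      and its derivative vanish, so that only \<open>q x\<close> survives on the left.\<close>
    have "norm (q x - q a - (x - a) *\<^sub>R q' a) \<le> norm (x - a) * B"
      by (rule vector_differentiable_bound_linearization[where S=UNIV])
         (use q B za in \<open>auto intro: has_vector_derivative_at_within\<close>)
    also have "\<dots> \<le> (b - a) * B"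
      using True B0 by (intro mult_right_mono) auto
    finally show ?thesis using za by simp
  next
    case False
    then have "q x = 0" using z by (auto simp: vanishes_off_def)
    then show ?thesis using ab B0 by simp
  qed
qed

lemma test_fun_bounds:
  assumes "test_fun a b N p" "C2_derivs p p1 p2" "vanishes_off a b p1" "vanishes_off a b p2"
    "\<And>x. norm (p2 x) \<le> N"
  shows "norm (p1 x) \<le> (b - a) * N" "norm (p x) \<le> (b - a) * ((b - a) * N)"
proof -
  note ab = test_fun_less[OF assms(1)]
  show 1: "norm (p1 x) \<le> (b - a) * N" for x
    by (rule norm_le_of_derivative_bound[OF C2_derivsD(2)[OF assms(2)] assms(3,4) ab assms(5)])
  show "norm (p x) \<le> (b - a) * ((b - a) * N)"
    by (rule norm_le_of_derivative_bound[OF C2_derivsD(1)[OF assms(2)] test_fun_vanishes[OF assms(1)] assms(3) ab 1])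
qed

section \<open>Decay and integrability of kernels\<close>

lemma vanishes_off_indicator:
  "vanishes_off a b p \<Longrightarrow> p = (\<lambda>x. indicator {a..b} x *\<^sub>R p x)"
  by (auto simp: vanishes_off_def indicator_def fun_eq_iff)

lemma integrable_vanishes_off:
  assumes "continuous_on UNIV p" "vanishes_off a b p"
  shows "integrable lborel p"
  by (subst vanishes_off_indicator[OF assms(2)], rule borel_integrable_compact)
     (use assms(1) in \<open>auto intro: continuous_on_subset\<close>)

lemma norm_integral_vanishes_off_le:
  assumes "vanishes_off a b p" "\<And>x. norm (p x) \<le> N" "a \<le> b"
  shows "norm (\<integral>x. p x \<partial>lborel) \<le> (b - a) * N"
proof -
  have N0: "0 \<le> N" using assms(2)[of a] order_trans[OF norm_ge_zero] by metis
  have "norm (\<integral>x. p x \<partial>lborel) \<le> (\<integral>x. N * indicator {a..b} x \<partial>lborel)"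
  \<comment> \<open>If \<open>p\<close> is not integrable, its integral is 0 by convention and the
    bound is trivial.\<close>
  proof (cases "integrable lborel p")
    case True
    show ?thesis
    proof (rule Bochner_Integration.integral_norm_bound_integral[OF True])
      show "integrable lborel (\<lambda>x. N * indicator {a..b} x)"
        by (intro integrable_mult_right integrable_real_indicator) (auto simp: emeasure_lborel_Icc_eq)
      fix x show "norm (p x) \<le> N * indicator {a..b} x"
        using assms(1) assms(2)[of x] by (auto simp: vanishes_off_def indicator_def)
    qed
  qed (use N0 in \<open>simp add: not_integrable_integral_eq\<close>)
  also have "\<dots> = (b - a) * N" using assms(3) by simp
  finally show ?thesis .
qed

lemma vanishes_off_mult: "vanishes_off a b p \<Longrightarrow> vanishes_off a b (\<lambda>x. p x * q x)"
  by (simp add: vanishes_off_def)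

lemma test_fun_integrable_cis:
  assumes "test_fun a b N p"
  shows "integrable lborel (\<lambda>\<xi>. p \<xi> * cis (t * \<xi>))"
  by (rule integrable_vanishes_off[OF _ vanishes_off_mult[OF test_fun_vanishes[OF assms]]])
     (intro continuous_intros test_fun_continuous[OF assms])

text \<open>The trivial estimate gives \<open>(b - a) ^ 3 * N\<close>; two integrations by parts
  give \<open>(b - a) * N\<close> for t^2 times the kernel. Adding the two produces the factor
  \<open>inverse (1 + t\<^sup>2)\<close>.\<close>

lemma norm_inverse_fourier_le:
  assumes p: "test_fun a b N p"
  shows "norm (inverse_fourier p t) \<le> N * ((b - a) ^ 3 + (b - a)) * inverse (1 + t\<^sup>2)"
proof -
  from p obtain p1 p2 where d: "C2_derivs p p1 p2" and z: "vanishes_off a b p" "vanishes_off a b p1"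
    "vanishes_off a b p2" and N: "\<And>x. norm (p2 x) \<le> N" by (rule test_funE) blast
  note ab = test_fun_less[OF p] and dd = C2_derivsD[OF d]
  let ?e = "\<lambda>\<xi>. cis (t * \<xi>)"
  have 1: "norm (inverse_fourier p t) \<le> (b - a) * ((b - a) * ((b - a) * N))"
    unfolding inverse_fourier_def
    by (rule norm_integral_vanishes_off_le[OF vanishes_off_mult[OF z(1)]])
       (use ab test_fun_bounds(2)[OF p d z(2,3) N] in \<open>auto simp: norm_mult\<close>)
  have i2: "integrable lborel (\<lambda>\<xi>. p2 \<xi> * ?e \<xi>)"
    by (rule integrable_vanishes_off[OF _ vanishes_off_mult[OF z(3)]]) (intro continuous_intros dd)
  have n2: "norm (\<integral>\<xi>. p2 \<xi> * ?e \<xi> \<partial>lborel) \<le> (b - a) * N"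
    by (rule norm_integral_vanishes_off_le[OF vanishes_off_mult[OF z(3)]])
       (use ab N in \<open>auto simp: norm_mult\<close>)
  \<comment> \<open>This primitive performs both integrations by parts at once: its derivative is
    \<open>?f\<close>, and its boundary values vanish with \<open>p\<close> and
    \<open>p1\<close>.\<close>
  let ?F = "\<lambda>\<xi>. p1 \<xi> * ?e \<xi> - (\<i> * t) * (p \<xi> * ?e \<xi>)"
  let ?f = "\<lambda>\<xi>. p2 \<xi> * ?e \<xi> + (t * t) * (p \<xi> * ?e \<xi>)"
  have "(?F has_vector_derivative ((p1 \<xi> * (\<i> * t * ?e \<xi>) + p2 \<xi> * ?e \<xi>)
      - (\<i> * t) * (p \<xi> * (\<i> * t * ?e \<xi>) + p1 \<xi> * ?e \<xi>))) (at \<xi>)" for \<xi>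
    by (intro has_vector_derivative_diff has_vector_derivative_mult_right has_vector_derivative_mult
        has_vector_derivative_cis dd)
  moreover have "((p1 \<xi> * (\<i> * t * ?e \<xi>) + p2 \<xi> * ?e \<xi>)
      - (\<i> * t) * (p \<xi> * (\<i> * t * ?e \<xi>) + p1 \<xi> * ?e \<xi>)) = ?f \<xi>" for \<xi>
    by (simp add: algebra_simps)
  ultimately have F: "(?F has_vector_derivative ?f \<xi>) (at \<xi>)" for \<xi> by simp
  have "has_bochner_integral lborel (\<lambda>x. indicator {a..b} x *\<^sub>R ?f x) (?F b - ?F a)"
  proof (rule has_bochner_integral_FTC_Icc)
    show "a \<le> b" using ab by simp
    show "(?F has_vector_derivative ?f x) (at x within {a..b})" for x
      by (rule has_vector_derivative_at_within[OF F])
    show "continuous_on {a..b} ?f"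
      by (rule continuous_on_subset[of UNIV]) (intro continuous_intros dd, simp)
  qed
  moreover have "(\<lambda>x. indicator {a..b} x *\<^sub>R ?f x) = ?f"
    by (rule vanishes_off_indicator[symmetric]) (use z in \<open>auto simp: vanishes_off_def\<close>)
  moreover have "?F b - ?F a = 0" using z by (auto simp: vanishes_off_def)
  ultimately have "has_bochner_integral lborel ?f 0" by simp
  then have "(\<integral>\<xi>. ?f \<xi> \<partial>lborel) = 0" by (rule has_bochner_integral_integral_eq)
  moreover have "(\<integral>\<xi>. ?f \<xi> \<partial>lborel) = (\<integral>\<xi>. p2 \<xi> * ?e \<xi> \<partial>lborel) + (t * t) * inverse_fourier p t"
    unfolding inverse_fourier_def using i2 test_fun_integrable_cis[OF p]
    by (subst Bochner_Integration.integral_add) auto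
  ultimately have "(t * t) * inverse_fourier p t = - (\<integral>\<xi>. p2 \<xi> * ?e \<xi> \<partial>lborel)"
    by (simp add: eq_neg_iff_add_eq_0 add.commute)
  then have "norm ((t * t) * inverse_fourier p t) \<le> (b - a) * N" using n2 by simp
  then have 2: "t\<^sup>2 * norm (inverse_fourier p t) \<le> (b - a) * N"
    by (simp add: norm_mult power2_eq_square)
  have "norm (inverse_fourier p t) * (1 + t\<^sup>2) \<le> N * ((b - a) ^ 3 + (b - a))"
    using 1 2 by (simp add: algebra_simps power3_eq_cube)
  moreover have "0 < 1 + t\<^sup>2" by (simp add: add_pos_nonneg)
  ultimately show ?thesis by (simp add: field_simps)
qed

lemma integrable_inverse_1_plus_square': "integrable lborel (\<lambda>t::real. inverse (1 + t\<^sup>2))"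
  using integrable_inverse_1_plus_square by (simp add: set_integrable_def)

lemma borel_measurable_inverse_fourier:
  assumes "continuous_on UNIV p"
  shows "inverse_fourier p \<in> borel_measurable borel"
proof -
  have "(\<lambda>(t, \<xi>). p \<xi> * cis (t * \<xi>)) \<in> borel_measurable (borel :: (real \<times> real) measure)"
    by (rule borel_measurable_continuous_onI)
       (auto simp: case_prod_beta intro!: continuous_intros continuous_on_compose2[OF assms])
  then have "(\<lambda>(t, \<xi>). p \<xi> * cis (t * \<xi>)) \<in> borel_measurable (borel \<Otimes>\<^sub>M lborel)"
    by (simp add: borel_prod[symmetric] cong: measurable_cong_sets)
  from lborel.borel_measurable_lebesgue_integral[OF this] show ?thesis
    unfolding inverse_fourier_def[abs_def] by simp
qed

lemma integrable_inverse_fourier: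
  assumes p: "test_fun a b N p"
  shows "integrable lborel (inverse_fourier p)"
proof (rule Bochner_Integration.integrable_bound)
  show "integrable lborel (\<lambda>t::real. N * ((b - a) ^ 3 + (b - a)) * inverse (1 + t\<^sup>2))"
    by (intro integrable_mult_right integrable_inverse_1_plus_square')
  show "inverse_fourier p \<in> borel_measurable lborel"
    using borel_measurable_inverse_fourier[OF test_fun_continuous[OF p]] by simp
  show "AE t in lborel. norm (inverse_fourier p t) \<le> norm (N * ((b - a) ^ 3 + (b - a)) * inverse (1 + t\<^sup>2))"
    by (intro AE_I2 order_trans[OF norm_inverse_fourier_le[OF p]]) simp
qed

text \<open>The constant depends on the support alone. Its cubic term comes from the trivial
  estimate of the kernel and its linear term from the integration by parts.\<close>

definition kernel_bound :: "real \<Rightarrow> real \<Rightarrow> real" where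
  "kernel_bound a b = ((b - a) ^ 3 + (b - a)) * (\<integral>t. inverse (1 + t\<^sup>2) \<partial>lborel)"

lemma integral_norm_inverse_fourier_le:
  assumes p: "test_fun a b N p"
  shows "(\<integral>t. norm (inverse_fourier p t) \<partial>lborel) \<le> kernel_bound a b * N"
proof -
  have "(\<integral>t. norm (inverse_fourier p t) \<partial>lborel)
      \<le> (\<integral>t. N * ((b - a) ^ 3 + (b - a)) * inverse (1 + t\<^sup>2) \<partial>lborel)"
    by (intro Bochner_Integration.integral_mono integrable_norm integrable_inverse_fourier[OF p]
       integrable_mult_right integrable_inverse_1_plus_square' norm_inverse_fourier_le[OF p])
  also have "\<dots> = kernel_bound a b * N" by (simp add: kernel_bound_def)
  finally show ?thesis .
qed

lemma kernel_bound_nonneg: "a \<le> b \<Longrightarrow> 0 \<le> kernel_bound a b"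
  unfolding kernel_bound_def by (intro mult_nonneg_nonneg integral_nonneg_AE) auto

section \<open>Operations on symbols and kernels\<close>

lemma inverse_fourier_add:
  assumes "test_fun a b N p" "test_fun a' b' N' q"
  shows "inverse_fourier (\<lambda>x. p x + q x) t = inverse_fourier p t + inverse_fourier q t"
  unfolding inverse_fourier_def
  using test_fun_integrable_cis[OF assms(1)] test_fun_integrable_cis[OF assms(2)]
  by (simp add: distrib_right)

lemma inverse_fourier_cmult: "inverse_fourier (\<lambda>x. c * p x) t = c * inverse_fourier p t"
  unfolding inverse_fourier_def by (simp add: mult.assoc)

lemma inverse_fourier_modulate: "inverse_fourier (\<lambda>x. cis (s * x) * p x) t = inverse_fourier p (t + s)"
  unfolding inverse_fourier_def by (simp add: algebra_simps flip: cis_mult)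

text \<open>Leibniz rule for the second derivative; the powers of \<open>b - a\<close> come from
  \<open>test_fun_bounds\<close>. The factor \<open>m\<close> is estimated on [a, b] only, because
  the factors in the applications, a character minus its value at a point and the remainders of a
  series, are small only there.\<close>

lemma test_fun_mult:
  assumes p: "test_fun a b N p" and m: "C2_derivs m m1 m2"
    and A: "\<And>x. a \<le> x \<Longrightarrow> x \<le> b \<Longrightarrow> norm (m x) \<le> A0" "\<And>x. a \<le> x \<Longrightarrow> x \<le> b \<Longrightarrow> norm (m1 x) \<le> A1"
      "\<And>x. a \<le> x \<Longrightarrow> x \<le> b \<Longrightarrow> norm (m2 x) \<le> A2"
  shows "test_fun a b ((A0 + 2 * A1 * (b - a) + A2 * (b - a)\<^sup>2) * N) (\<lambda>x. m x * p x)"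
proof -
  from p obtain p1 p2 where d: "C2_derivs p p1 p2" and z: "vanishes_off a b p" "vanishes_off a b p1"
    "vanishes_off a b p2" and N: "\<And>x. norm (p2 x) \<le> N" by (rule test_funE) blast
  note ab = test_fun_less[OF p] and N0 = test_fun_nonneg[OF p]
  have A0: "0 \<le> A0" "0 \<le> A1" "0 \<le> A2"
    using A[of a] ab order_trans[OF norm_ge_zero] by (metis less_imp_le order_refl)+
  have "norm (m x * p2 x + 2 * (m1 x * p1 x) + m2 x * p x) \<le> (A0 + 2 * A1 * (b - a) + A2 * (b - a)\<^sup>2) * N" for x
  proof (cases "a \<le> x \<and> x \<le> b")
    case True
    have "norm (m x * p2 x + 2 * (m1 x * p1 x) + m2 x * p x)
        \<le> norm (m x * p2 x) + norm (2 * (m1 x * p1 x)) + norm (m2 x * p x)"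
      by (rule order_trans[OF norm_triangle_ineq add_mono[OF norm_triangle_ineq order_refl]])
    also have "\<dots> = norm (m x) * norm (p2 x) + 2 * (norm (m1 x) * norm (p1 x)) + norm (m2 x) * norm (p x)"
      by (simp add: norm_mult)
    also have "\<dots> \<le> A0 * N + 2 * (A1 * ((b - a) * N)) + A2 * ((b - a) * ((b - a) * N))"
      using True A N test_fun_bounds[OF p d z(2,3) N] A0
      by (intro add_mono mult_mono mult_left_mono) auto
    also have "\<dots> = (A0 + 2 * A1 * (b - a) + A2 * (b - a)\<^sup>2) * N"
      by (simp add: algebra_simps power2_eq_square)
    finally show ?thesis .
  next
    case False
    then have "p x = 0" "p1 x = 0" "p2 x = 0" using z by (auto simp: vanishes_off_def)
    then show ?thesis using A0 N0 ab by simp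
  qed
  moreover have "vanishes_off a b (\<lambda>x. m x * p x)" "vanishes_off a b (\<lambda>x. m x * p1 x + m1 x * p x)"
    "vanishes_off a b (\<lambda>x. m x * p2 x + 2 * (m1 x * p1 x) + m2 x * p x)"
    using z by (auto simp: vanishes_off_def)
  ultimately show ?thesis
    unfolding test_fun_def using ab C2_derivs_mult[OF m d]
    by (intro conjI exI[of _ "\<lambda>x. m x * p1 x + m1 x * p x"]
        exI[of _ "\<lambda>x. m x * p2 x + 2 * (m1 x * p1 x) + m2 x * p x"]) auto
qed

lemma continuous_bounded_on_Icc:
  fixes f :: "real \<Rightarrow> complex"
  assumes "continuous_on UNIV f"
  shows "\<exists>B. \<forall>x. a \<le> x \<longrightarrow> x \<le> b \<longrightarrow> norm (f x) \<le> B"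
proof -
  have "bounded (f ` {a..b})"
    by (intro compact_imp_bounded compact_continuous_image continuous_on_subset[OF assms]) auto
  then show ?thesis by (simp add: bounded_iff) (meson atLeastAtMost_iff)
qed

lemma test_fun_mult_exists:
  assumes p: "test_fun a b N p" and m: "C2_derivs m m1 m2"
  obtains N' where "test_fun a b N' (\<lambda>x. m x * p x)"
proof -
  note d = C2_derivsD(3-5)[OF m]
  obtain A0 where A0: "\<And>x. a \<le> x \<Longrightarrow> x \<le> b \<Longrightarrow> norm (m x) \<le> A0"
    using continuous_bounded_on_Icc[OF d(1)] by metis
  obtain A1 where A1: "\<And>x. a \<le> x \<Longrightarrow> x \<le> b \<Longrightarrow> norm (m1 x) \<le> A1"
    using continuous_bounded_on_Icc[OF d(2)] by metis
  obtain A2 where A2: "\<And>x. a \<le> x \<Longrightarrow> x \<le> b \<Longrightarrow> norm (m2 x) \<le> A2"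
    using continuous_bounded_on_Icc[OF d(3)] by metis
  from test_fun_mult[OF p m A0 A1 A2] show ?thesis by (rule that)
qed

lemma test_funI:
  assumes "a < b" "C2_derivs p p1 p2" "vanishes_off a b p" "vanishes_off a b p1" "vanishes_off a b p2"
  obtains N where "test_fun a b N p"
proof -
  obtain N where N: "\<And>x. a \<le> x \<Longrightarrow> x \<le> b \<Longrightarrow> norm (p2 x) \<le> N"
    using continuous_bounded_on_Icc[OF C2_derivsD(5)[OF assms(2)]] by metis
  have "norm (p2 x) \<le> max N 0" for x
    using N[of x] assms(5) by (cases "a \<le> x \<and> x \<le> b") (auto simp: vanishes_off_def)
  then have "test_fun a b (max N 0) p" unfolding test_fun_def using assms
    by (intro conjI exI[of _ p1] exI[of _ p2]) auto
  then show ?thesis by (rule that)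
qed

lemma test_fun_cmult: "test_fun a b N p \<Longrightarrow> test_fun a b (norm c * N) (\<lambda>x. c * p x)"
  using test_fun_mult[OF _ C2_derivs_const, of a b N p c "norm c" 0 0] by simp

lemma test_fun_add:
  assumes "test_fun a b N p" "test_fun a b N' q"
  shows "test_fun a b (N + N') (\<lambda>x. p x + q x)"
proof -
  from assms(1) obtain p1 p2 where p: "C2_derivs p p1 p2" "vanishes_off a b p" "vanishes_off a b p1"
    "vanishes_off a b p2" "\<And>x. norm (p2 x) \<le> N" by (rule test_funE) blast
  from assms(2) obtain q1 q2 where q: "C2_derivs q q1 q2" "vanishes_off a b q" "vanishes_off a b q1"
    "vanishes_off a b q2" "\<And>x. norm (q2 x) \<le> N'" by (rule test_funE) blast
  have "norm (p2 x + q2 x) \<le> N + N'" for x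
    using norm_triangle_ineq[of "p2 x" "q2 x"] p(5)[of x] q(5)[of x] by linarith
  then show ?thesis
    unfolding test_fun_def using C2_derivs_add[OF p(1) q(1)] p q test_fun_less[OF assms(1)]
    by (intro conjI exI[of _ "\<lambda>x. p1 x + q1 x"] exI[of _ "\<lambda>x. p2 x + q2 x"]) (auto simp: vanishes_off_def)
qed

lemma vanishes_off_mono: "vanishes_off a b p \<Longrightarrow> a' \<le> a \<Longrightarrow> b \<le> b' \<Longrightarrow> vanishes_off a' b' p"
  by (auto simp: vanishes_off_def)

lemma test_fun_mono:
  assumes "test_fun a b N p" "a' \<le> a" "b \<le> b'" "N \<le> N'"
  shows "test_fun a' b' N' p"
proof -
  from assms(1) obtain p1 p2 where p: "C2_derivs p p1 p2" "vanishes_off a b p" "vanishes_off a b p1"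
    "vanishes_off a b p2" "\<And>x. norm (p2 x) \<le> N" by (rule test_funE) blast
  then show ?thesis unfolding test_fun_def
    using vanishes_off_mono[OF _ assms(2,3)] assms(2-4) test_fun_less[OF assms(1)]
    by (intro conjI exI[of _ p1] exI[of _ p2]) (auto intro: order_trans)
qed

lemma cmod_cis_diff_le: "cmod (cis x - cis y) \<le> \<bar>x - y\<bar>"
proof -
  have "cis x - cis y = cis y * (exp (\<i> * of_real (x - y)) - 1)"
    unfolding cis_conv_exp[symmetric] by (simp add: right_diff_distrib cis_mult)
  then have "cmod (cis x - cis y) = 2 * \<bar>sin ((x - y) / 2)\<bar>"
    by (simp only: norm_mult norm_cis dist_exp_i_1 mult_1)
  also have "\<dots> \<le> 2 * \<bar>(x - y) / 2\<bar>" by (intro mult_left_mono abs_sin_x_le_abs_x) auto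
  finally show ?thesis by simp
qed

text \<open>The factor vanishes at \<open>l\<close>, so on the interval it is at most |s| (b - a);
  each further derivative costs a factor |s|, matched by a factor b - a in
  \<open>test_fun_mult\<close>. The result is small as soon as |s| (b - a) is, which drives the
  contraction near a point off the spectrum.\<close>

lemma test_fun_cis_diff:
  assumes p: "test_fun a b N p" and l: "a \<le> l" "l \<le> b"
  shows "test_fun a b ((3 * (\<bar>s\<bar> * (b - a)) + (\<bar>s\<bar> * (b - a))\<^sup>2) * N) (\<lambda>x. (cis (s * x) - cis (s * l)) * p x)"
proof -
  have c: "C2_derivs (\<lambda>x. cis (s * x) + (- cis (s * l))) (\<lambda>x. \<i> * s * cis (s * x) + 0)
      (\<lambda>x. - complex_of_real (s * s) * cis (s * x) + 0)"
    by (intro C2_derivs_add C2_derivs_cis C2_derivs_const)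
  have 0: "cmod (cis (s * x) + - cis (s * l)) \<le> \<bar>s\<bar> * (b - a)" if "a \<le> x" "x \<le> b" for x
  proof -
    have "cmod (cis (s * x) - cis (s * l)) \<le> \<bar>s\<bar> * \<bar>x - l\<bar>"
      using cmod_cis_diff_le[of "s * x" "s * l"] by (simp add: abs_mult flip: right_diff_distrib)
    also have "\<dots> \<le> \<bar>s\<bar> * (b - a)" using that l by (intro mult_left_mono) auto
    finally show ?thesis by simp
  qed
  have 1: "cmod (\<i> * s * cis (s * x) + 0) \<le> \<bar>s\<bar>" for x by (simp add: norm_mult)
  have 2: "cmod (- complex_of_real (s * s) * cis (s * x) + 0) \<le> \<bar>s\<bar>\<^sup>2" for x
    by (simp add: norm_mult power2_eq_square)
  have "test_fun a b ((\<bar>s\<bar> * (b - a) + 2 * \<bar>s\<bar> * (b - a) + \<bar>s\<bar>\<^sup>2 * (b - a)\<^sup>2) * N)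
      (\<lambda>x. (cis (s * x) + - cis (s * l)) * p x)"
    by (rule test_fun_mult[OF p c 0 1 2])
  moreover have "\<bar>s\<bar> * (b - a) + 2 * \<bar>s\<bar> * (b - a) + \<bar>s\<bar>\<^sup>2 * (b - a)\<^sup>2
      = 3 * (\<bar>s\<bar> * (b - a)) + (\<bar>s\<bar> * (b - a))\<^sup>2"
    by (simp only: power_mult_distrib)
  ultimately show ?thesis by simp
qed

section \<open>Multipliers of an isometric representation\<close>

lemma nn_integral_eq_lebesgue:
  fixes g :: "real \<Rightarrow> real"
  assumes "integrable lborel g" "\<And>t. 0 \<le> g t"
  shows "(\<integral>\<^sup>+ t. ennreal (g t) \<partial>lborel) = ennreal (\<integral>t. g t \<partial>lborel)"
  by (rule nn_integral_eq_integral) (use assms in auto)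

lemma test_fun_cis_mult:
  assumes "test_fun a b N p"
  obtains N' where "test_fun a b N' (\<lambda>x. cis (s * x) * p x)"
  using test_fun_mult_exists[OF assms C2_derivs_cis] .

text \<open>The weight is the factor of \<open>test_fun_cis_diff\<close> for |s| = |t| and an
  interval of length 1 / (n + 1), capped at 2, the trivial bound for an orbit increment. The cap
  provides the dominating function 2 |f|; an integrable \<open>f\<close> may have infinite
  moments.\<close>

lemma integral_min_scaled_tendsto_0:
  fixes f :: "real \<Rightarrow> complex"
  assumes f: "integrable lborel f"
  shows "(\<lambda>n. \<integral>t. norm (f t) * min 2 (3 * (\<bar>t\<bar> * (1 / real (Suc n))) + (\<bar>t\<bar> * (1 / real (Suc n)))\<^sup>2) \<partial>lborel)
    \<longlonglongrightarrow> 0"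
proof -
  have "(\<lambda>n. \<integral>t. norm (f t) * min 2 (3 * (\<bar>t\<bar> * (1 / real (Suc n))) + (\<bar>t\<bar> * (1 / real (Suc n)))\<^sup>2) \<partial>lborel)
    \<longlonglongrightarrow> (\<integral>t. 0 \<partial>(lborel :: real measure))"
  proof (rule integral_dominated_convergence[where w="\<lambda>t. norm (f t) * 2"])
    show "integrable lborel (\<lambda>t. norm (f t) * 2)" using f by simp
    have [measurable]: "f \<in> borel_measurable lborel" using f by simp
    show "(\<lambda>t. norm (f t) * min 2 (3 * (\<bar>t\<bar> * (1 / real (Suc n))) + (\<bar>t\<bar> * (1 / real (Suc n)))\<^sup>2))
      \<in> borel_measurable lborel" for n by measurable
    have s: "(\<lambda>n. 1 / real (Suc n)) \<longlonglongrightarrow> 0"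
      using LIMSEQ_inverse_real_of_nat by (simp add: inverse_eq_divide)
    have "(\<lambda>n. norm (f t) * min 2 (3 * (\<bar>t\<bar> * (1 / real (Suc n))) + (\<bar>t\<bar> * (1 / real (Suc n)))\<^sup>2))
        \<longlonglongrightarrow> norm (f t) * min 2 (3 * (\<bar>t\<bar> * 0) + (\<bar>t\<bar> * 0)\<^sup>2)" for t
      by (intro tendsto_mult tendsto_min tendsto_add tendsto_power tendsto_const s)
    then show "AE t in lborel. (\<lambda>n. norm (f t) * min 2 (3 * (\<bar>t\<bar> * (1 / real (Suc n))) + (\<bar>t\<bar> * (1 / real (Suc n)))\<^sup>2)) \<longlonglongrightarrow> 0"
      by simp
    show "AE t in lborel. norm (norm (f t) * min 2 (3 * (\<bar>t\<bar> * (1 / real (Suc n))) + (\<bar>t\<bar> * (1 / real (Suc n)))\<^sup>2))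
        \<le> norm (f t) * 2" for n
    proof (rule AE_I2)
      fix t :: real
      have "0 \<le> min 2 (3 * (\<bar>t\<bar> * (1 / real (Suc n))) + (\<bar>t\<bar> * (1 / real (Suc n)))\<^sup>2)" by simp
      then have "\<bar>min 2 (3 * (\<bar>t\<bar> * (1 / real (Suc n))) + (\<bar>t\<bar> * (1 / real (Suc n)))\<^sup>2)\<bar> \<le> 2" by linarith
      then show "norm (norm (f t) * min 2 (3 * (\<bar>t\<bar> * (1 / real (Suc n))) + (\<bar>t\<bar> * (1 / real (Suc n)))\<^sup>2))
        \<le> norm (f t) * 2"
        unfolding real_norm_def abs_mult by (intro mult_mono) auto
    qed
  qed simp
  then show ?thesis by simp
qed

locale isometric_representation =
  fixes T :: "real \<Rightarrow> 'a::complex_banach \<Rightarrow>\<^sub>L 'a"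
  assumes rep: "representation T" and iso: "isometric T" and sc: "strongly_continuous T"
begin

lemma norm_T [simp]: "norm (blinfun_apply (T t) y) = norm y"
  using iso by (simp add: isometric_def)

lemma T_0 [simp]: "blinfun_apply (T 0) y = y"
  using rep by (simp add: representation_def)

lemma T_add: "blinfun_apply (T (s + t)) y = blinfun_apply (T s) (blinfun_apply (T t) y)"
  using rep by (simp add: representation_def)

lemma T_scaleC: "blinfun_apply (T t) (c *\<^sub>C y) = c *\<^sub>C blinfun_apply (T t) y"
  using rep by (simp add: representation_def complex_linear_def)

lemma continuous_T: "continuous_on UNIV (\<lambda>t. blinfun_apply (T t) y)"
  using sc by (simp add: strongly_continuous_def)

lemma continuous_T_uminus: "continuous_on UNIV (\<lambda>t. blinfun_apply (T (- t)) y)"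
  by (rule continuous_on_compose2[OF continuous_T]) (auto intro: continuous_intros)

section \<open>Linearity, norm bound and translation law of the action of integrable
  functions\<close>

lemma L1_act_has_bochner:
  assumes "integrable lborel f"
  shows "has_bochner lborel (\<lambda>t. f t *\<^sub>C blinfun_apply (T (- t)) y) (L1_act T f y)"
proof -
  obtain x where x: "has_bochner lborel (\<lambda>t. f t *\<^sub>C blinfun_apply (T (- t)) y) x"
    using has_bochner_scaleC_exists[OF assms continuous_T_uminus, of y "norm y"] by auto
  then show ?thesis unfolding L1_act_def bochner_integral_eq[OF x] .
qed

lemma L1_act_add:
  assumes "integrable lborel f" "integrable lborel g"
  shows "L1_act T (\<lambda>t. f t + g t) y = L1_act T f y + L1_act T g y"
proof -
  have fg: "integrable lborel (\<lambda>t. f t + g t)" using assms by simp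
  have eq: "(f t + g t) *\<^sub>C v = f t *\<^sub>C v + g t *\<^sub>C v" for t and v :: 'a
    by (rule scaleC_add_left)
  note h = L1_act_has_bochner[OF fg, of y]
  have "(\<lambda>t. (f t + g t) *\<^sub>C blinfun_apply (T (- t)) y) \<in> borel_measurable lborel"
    using h unfolding has_bochner_def by blast
  then have "has_bochner lborel (\<lambda>t. f t *\<^sub>C blinfun_apply (T (- t)) y + g t *\<^sub>C blinfun_apply (T (- t)) y)
      (L1_act T f y + L1_act T g y)"
    unfolding eq by (rule has_bochner_add[OF L1_act_has_bochner[OF assms(1)] L1_act_has_bochner[OF assms(2)]])
  from has_bochner_unique[OF h[unfolded eq] this] show ?thesis .
qed

lemma L1_act_cmult:
  assumes "integrable lborel f"
  shows "L1_act T (\<lambda>t. c * f t) y = c *\<^sub>C L1_act T f y"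
proof -
  have cf: "integrable lborel (\<lambda>t. c * f t)" using assms by simp
  have "has_bochner lborel (\<lambda>t. c *\<^sub>C (f t *\<^sub>C blinfun_apply (T (- t)) y)) (c *\<^sub>C L1_act T f y)"
    by (rule has_bochner_bounded_linear[OF scaleC.bounded_linear_right L1_act_has_bochner[OF assms]])
  from has_bochner_unique[OF L1_act_has_bochner[OF cf, of y, folded scaleC_scaleC] this] show ?thesis .
qed

lemma norm_L1_act_le:
  assumes "integrable lborel f"
  shows "norm (L1_act T f y) \<le> (\<integral>t. norm (f t) \<partial>lborel) * norm y"
proof -
  have "ennreal (norm (L1_act T f y)) \<le> (\<integral>\<^sup>+ t. norm (f t *\<^sub>C blinfun_apply (T (- t)) y) \<partial>lborel)"
    by (rule has_bochner_norm_le[OF L1_act_has_bochner[OF assms]])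
  also have "\<dots> = (\<integral>\<^sup>+ t. ennreal (norm (f t) * norm y) \<partial>lborel)"
    by (simp add: norm_scaleC)
  also have "\<dots> = ennreal (\<integral>t. norm (f t) * norm y \<partial>lborel)"
    by (rule nn_integral_eq_lebesgue) (use assms in auto)
  also have "\<dots> = ennreal ((\<integral>t. norm (f t) \<partial>lborel) * norm y)" by simp
  finally show ?thesis by (subst (asm) ennreal_le_iff) auto
qed

lemma L1_act_shift:
  assumes "integrable lborel f"
  shows "blinfun_apply (T s) (L1_act T f y) = L1_act T (\<lambda>t. f (t + s)) y"
proof -
  have fs: "integrable lborel (\<lambda>t. f (t + s))"
    using lborel_integrable_real_affine[OF assms, of 1 s] by (simp add: add.commute)
  have "has_bochner lborel (\<lambda>t. blinfun_apply (T s) (f t *\<^sub>C blinfun_apply (T (- t)) y))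
      (blinfun_apply (T s) (L1_act T f y))"
    by (rule has_bochner_bounded_linear[OF blinfun.bounded_linear_right L1_act_has_bochner[OF assms]])
  from has_bochner_shift[OF this, of s]
  have "has_bochner lborel (\<lambda>t. f (t + s) *\<^sub>C blinfun_apply (T (- t)) y)
      (blinfun_apply (T s) (L1_act T f y))"
    by (simp add: T_scaleC flip: T_add)
  from has_bochner_unique[OF this L1_act_has_bochner[OF fs]] show ?thesis .
qed

text \<open>If the orbit of \<open>z\<close> were the character at \<open>l\<close>, the function
  \<open>f\<close> would act on \<open>z\<close> as the scalar \<open>fourier f l\<close>; the error
  is the deviation of the orbit from that character. It serves twice: for an annihilating
  \<open>f\<close> at a point off the spectrum, and at \<open>l = 0\<close> for an approximate
  identity.\<close>

lemma norm_fourier_scaleC_diff_le: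
  assumes f: "integrable lborel f"
  shows "ennreal (norm (L1_act T f z - fourier f l *\<^sub>C z))
    \<le> (\<integral>\<^sup>+ t. norm (f t) * norm (blinfun_apply (T (- t)) z - cis (- t * l) *\<^sub>C z) \<partial>lborel)"
proof -
  have e: "exp (- \<i> * complex_of_real t * complex_of_real l) = cis (- t * l)" for t
    by (simp add: cis_conv_exp mult.assoc)
  have fm: "f \<in> borel_measurable lborel" using f by simp
  have cm: "(\<lambda>t. cis (- t * l)) \<in> borel_measurable lborel"
    by (simp, intro borel_measurable_continuous_onI continuous_intros)
  have fi: "integrable lborel (\<lambda>t. f t * cis (- t * l))"
    by (rule Bochner_Integration.integrable_bound[OF f borel_measurable_times[OF fm cm]]) (simp add: norm_mult)
  have "has_bochner lborel (\<lambda>t. f t * cis (- t * l)) (fourier f l)"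
    unfolding has_bochner_eq_has_bochner_integral fourier_def e by (rule has_bochner_integral_integrable[OF fi])
  from has_bochner_bounded_linear[OF scaleC.bounded_linear_left[of z] this]
  have 1: "has_bochner lborel (\<lambda>t. (f t * cis (- t * l)) *\<^sub>C z) (fourier f l *\<^sub>C z)" .
  have eq: "f t *\<^sub>C blinfun_apply (T (- t)) z - (f t * cis (- t * l)) *\<^sub>C z
      = f t *\<^sub>C (blinfun_apply (T (- t)) z - cis (- t * l) *\<^sub>C z)" for t
    by (simp add: scaleC.diff_right scaleC_scaleC)
  have g: "continuous_on UNIV (\<lambda>t. blinfun_apply (T (- t)) z - cis (- t * l) *\<^sub>C z)"
    by (intro continuous_on_diff continuous_T_uminus scaleC.continuous_on continuous_intros)
  have gb: "norm (blinfun_apply (T (- t)) z - cis (- t * l) *\<^sub>C z) \<le> 2 * norm z" for t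
    using norm_triangle_ineq4[of "blinfun_apply (T (- t)) z" "cis (- t * l) *\<^sub>C z"] by (simp add: norm_scaleC)
  have m: "(\<lambda>t. f t *\<^sub>C (blinfun_apply (T (- t)) z - cis (- t * l) *\<^sub>C z)) \<in> borel_measurable lborel"
    using has_bochner_scaleC_exists[OF f g gb] unfolding has_bochner_def by blast
  from has_bochner_diff_norm_le[OF L1_act_has_bochner[OF f, of z] 1, unfolded eq, OF m]
  show ?thesis unfolding norm_scaleC .
qed

text \<open>Writing formally T t = exp (i t D), this is 2 pi p(D), the functional calculus of the
  generator.\<close>

definition multiplier :: "(real \<Rightarrow> complex) \<Rightarrow> 'a \<Rightarrow> 'a" where
  "multiplier p y = L1_act T (inverse_fourier p) y"

lemma multiplier_add:
  assumes "test_fun a b N p" "test_fun a' b' N' q"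
  shows "multiplier (\<lambda>x. p x + q x) y = multiplier p y + multiplier q y"
  unfolding multiplier_def
    L1_act_add[OF integrable_inverse_fourier[OF assms(1)] integrable_inverse_fourier[OF assms(2)], symmetric]
  by (simp add: inverse_fourier_add[OF assms, abs_def])

lemma multiplier_cmult:
  assumes "test_fun a b N p"
  shows "multiplier (\<lambda>x. c * p x) y = c *\<^sub>C multiplier p y"
  unfolding multiplier_def L1_act_cmult[OF integrable_inverse_fourier[OF assms], symmetric]
  by (simp add: inverse_fourier_cmult[abs_def])

lemma multiplier_diff:
  assumes "test_fun a b N p" "test_fun a' b' N' q"
  shows "multiplier (\<lambda>x. p x - q x) y = multiplier p y - multiplier q y"
  using multiplier_add[OF assms(1) test_fun_cmult[OF assms(2), of "-1"]] multiplier_cmult[OF assms(2), of "-1"]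
  by (simp add: scaleC.minus_left)

lemma multiplier_cis:
  assumes "test_fun a b N p"
  shows "multiplier (\<lambda>x. cis (s * x) * p x) y = blinfun_apply (T s) (multiplier p y)"
  unfolding multiplier_def L1_act_shift[OF integrable_inverse_fourier[OF assms]]
  by (simp add: inverse_fourier_modulate[abs_def])

lemma norm_multiplier_le:
  assumes "test_fun a b N p"
  shows "norm (multiplier p y) \<le> kernel_bound a b * norm y * N"
proof -
  have "norm (multiplier p y) \<le> (\<integral>t. norm (inverse_fourier p t) \<partial>lborel) * norm y"
    unfolding multiplier_def by (rule norm_L1_act_le[OF integrable_inverse_fourier[OF assms]])
  also have "\<dots> \<le> (kernel_bound a b * N) * norm y"
    by (intro mult_right_mono integral_norm_inverse_fourier_le[OF assms]) simp
  finally show ?thesis by (simp add: mult_ac)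
qed

lemma multiplier_cis_diff:
  assumes "test_fun a b N p"
  shows "multiplier (\<lambda>x. (cis (s * x) - cis (s * l)) * p x) y
    = blinfun_apply (T s) (multiplier p y) - cis (s * l) *\<^sub>C multiplier p y"
proof -
  obtain N' where N': "test_fun a b N' (\<lambda>x. cis (s * x) * p x)"
    using test_fun_cis_mult[OF assms] .
  show ?thesis
    using multiplier_diff[OF N' test_fun_cmult[OF assms]] multiplier_cis[OF assms] multiplier_cmult[OF assms]
    by (simp add: left_diff_distrib)
qed

text \<open>If \<open>f\<close> annihilates the representation, then \<open>fourier f l *\<^sub>C z\<close> is controlled by the
  increments of the orbit of \<open>z\<close> against the character at \<open>l\<close>.  For \<open>z = multiplier p y\<close> with
  \<open>p\<close> supported near \<open>l\<close> these increments are again multipliers, with smaller second derivatives;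
  so any bound for \<open>multiplier p y\<close> linear in those derivatives can be halved.\<close>

lemma multiplier_vanishes_near:
  assumes l: "l \<notin> beurling_spectrum T"
  obtains d where "0 < d" "\<And>a b N p y. test_fun a b N p \<Longrightarrow> l - d \<le> a \<Longrightarrow> b \<le> l + d \<Longrightarrow> multiplier p y = 0"
proof -
  from l obtain f where f: "integrable lborel f" and f0: "\<And>y. L1_act T f y = 0" and F: "fourier f l \<noteq> 0"
    unfolding beurling_spectrum_def by blast
  let ?w = "\<lambda>r t. min 2 (3 * (\<bar>t\<bar> * r) + (\<bar>t\<bar> * r)\<^sup>2) :: real"
  \<comment> \<open>The threshold is half the modulus of \<open>fourier f l\<close>: dividing by
    that modulus later leaves the contraction factor 1 / 2. It fixes the length \<open>r\<close> of
    the interval around \<open>l\<close>.\<close>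
  have "eventually (\<lambda>n. (\<integral>t. norm (f t) * ?w (1 / real (Suc n)) t \<partial>lborel) < norm (fourier f l) / 2) sequentially"
    by (rule order_tendstoD(2)[OF integral_min_scaled_tendsto_0[OF f]]) (use F in simp)
  then obtain n where n: "(\<integral>t. norm (f t) * ?w (1 / real (Suc n)) t \<partial>lborel) < norm (fourier f l) / 2"
    by (auto simp: eventually_sequentially)
  define r where "r = 1 / real (Suc n)"
  have r: "0 < r" by (simp add: r_def)
  have fw: "integrable lborel (\<lambda>t. norm (f t) * ?w r t)"
  proof (rule Bochner_Integration.integrable_bound[where f="\<lambda>t. norm (f t) * 2"])
    show "integrable lborel (\<lambda>t. norm (f t) * 2)" using f by simp
    have [measurable]: "f \<in> borel_measurable lborel" using f by simp
    show "(\<lambda>t. norm (f t) * ?w r t) \<in> borel_measurable lborel" by measurable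
    have "\<bar>?w r t\<bar> \<le> 2" for t
    proof -
      have "0 \<le> ?w r t" using r by simp
      then show ?thesis by linarith
    qed
    then show "AE t in lborel. norm (norm (f t) * ?w r t) \<le> norm (norm (f t) * 2)"
      unfolding real_norm_def abs_mult by (intro AE_I2 mult_mono) auto
  qed
  define a b where "a = l - r / 2" and "b = l + r / 2"
  have ab: "a \<le> l" "l \<le> b" "b - a = r" using r by (simp_all add: a_def b_def)
  have step: "norm (multiplier p y) \<le> M / 2 * N"
    if M: "\<And>N p. test_fun a b N p \<Longrightarrow> norm (multiplier p y) \<le> M * N" and M0: "0 \<le> M"
      and p: "test_fun a b N p" for M N p y
  proof -
    define z where "z = multiplier p y"
    note N0 = test_fun_nonneg[OF p]
    have zb: "norm z \<le> M * N" unfolding z_def by (rule M[OF p])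
    \<comment> \<open>The increment has two bounds: twice the norm of \<open>z\<close>, and the
      hypothesis on \<open>M\<close> applied to the symbol of the increment. Their minimum is the
      weight whose integral against |f| was made small.\<close>
    have inc: "norm (blinfun_apply (T (- t)) z - cis (- t * l) *\<^sub>C z) \<le> M * N * ?w r t" for t
    proof -
      have "norm (blinfun_apply (T (- t)) z - cis (- t * l) *\<^sub>C z) \<le> 2 * norm z"
        using norm_triangle_ineq4[of "blinfun_apply (T (- t)) z" "cis (- t * l) *\<^sub>C z"] by (simp add: norm_scaleC)
      also have "\<dots> \<le> (M * N) * 2" using zb by simp
      finally have 1: "norm (blinfun_apply (T (- t)) z - cis (- t * l) *\<^sub>C z) \<le> (M * N) * 2" .
      have "norm (blinfun_apply (T (- t)) z - cis (- t * l) *\<^sub>C z)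
          \<le> M * ((3 * (\<bar>t\<bar> * r) + (\<bar>t\<bar> * r)\<^sup>2) * N)"
        using M[OF test_fun_cis_diff[OF p ab(1,2), of "- t"]]
        unfolding multiplier_cis_diff[OF p] z_def ab(3) by simp
      then have 2: "norm (blinfun_apply (T (- t)) z - cis (- t * l) *\<^sub>C z)
          \<le> (M * N) * (3 * (\<bar>t\<bar> * r) + (\<bar>t\<bar> * r)\<^sup>2)" by (simp only: mult_ac)
      show ?thesis using 1 2 by (simp add: min_def)
    qed
    have "ennreal (norm (fourier f l) * norm z) = ennreal (norm (L1_act T f z - fourier f l *\<^sub>C z))"
      by (simp add: f0 norm_scaleC)
    also have "\<dots> \<le> (\<integral>\<^sup>+ t. norm (f t) * norm (blinfun_apply (T (- t)) z - cis (- t * l) *\<^sub>C z) \<partial>lborel)"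
      by (rule norm_fourier_scaleC_diff_le[OF f])
    also have "\<dots> \<le> (\<integral>\<^sup>+ t. ennreal ((M * N) * (norm (f t) * ?w r t)) \<partial>lborel)"
    proof (intro nn_integral_mono ennreal_leI)
      fix t
      have "norm (f t) * norm (blinfun_apply (T (- t)) z - cis (- t * l) *\<^sub>C z)
          \<le> norm (f t) * (M * N * ?w r t)" by (intro mult_left_mono inc norm_ge_zero)
      then show "norm (f t) * norm (blinfun_apply (T (- t)) z - cis (- t * l) *\<^sub>C z)
          \<le> (M * N) * (norm (f t) * ?w r t)" by (simp only: mult_ac)
    qed
    also have "\<dots> = ennreal (\<integral>t. (M * N) * (norm (f t) * ?w r t) \<partial>lborel)"
      by (rule nn_integral_eq_lebesgue)
         (use fw M0 N0 r in \<open>auto intro!: mult_nonneg_nonneg integrable_mult_right simp del: integrable_mult_right_iff\<close>)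
    also have "(\<integral>t. (M * N) * (norm (f t) * ?w r t) \<partial>lborel) = (M * N) * (\<integral>t. norm (f t) * ?w r t \<partial>lborel)"
      by simp
    finally have "ennreal (norm (fourier f l) * norm z) \<le> ennreal ((M * N) * (\<integral>t. norm (f t) * ?w r t \<partial>lborel))" .
    moreover have "(M * N) * (\<integral>t. norm (f t) * ?w r t \<partial>lborel) \<le> (M * N) * (norm (fourier f l) / 2)"
      using n M0 N0 unfolding r_def by (intro mult_left_mono) auto
    ultimately have "ennreal (norm (fourier f l) * norm z) \<le> ennreal ((M * N) * (norm (fourier f l) / 2))"
      by (meson ennreal_leI order_trans)
    then have "norm (fourier f l) * norm z \<le> (M * N) * (norm (fourier f l) / 2)"
      using M0 N0 by (subst (asm) ennreal_le_iff) auto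
    then have "norm (fourier f l) * norm z \<le> norm (fourier f l) * (M / 2 * N)"
      by (simp add: mult_ac)
    then show ?thesis using F unfolding z_def by simp
  qed
  \<comment> \<open>The iteration starts from the kernel estimate, whose constant may depend on
    \<open>y\<close> but not on the symbol; this uniformity lets \<open>step\<close> apply to all
    symbols on [a, b] at every stage.\<close>
  have all: "norm (multiplier p y) \<le> (kernel_bound a b * norm y) / 2 ^ k * N" if "test_fun a b N p" for k N p y
    using that
  proof (induction k arbitrary: N p)
    case 0
    then show ?case using norm_multiplier_le by simp
  next
    case (Suc k)
    have "0 \<le> kernel_bound a b * norm y / 2 ^ k"
      using kernel_bound_nonneg[of a b] ab by simp
    from step[OF Suc.IH this Suc.prems] show ?case by (simp add: mult_ac)
  qed
  have "multiplier p y = 0" if p: "test_fun a' b' N p" and "l - r / 2 \<le> a'" "b' \<le> l + r / 2" for a' b' N p y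
  proof -
    have "test_fun a b N p"
      by (rule test_fun_mono[OF p]) (use that in \<open>auto simp: a_def b_def\<close>)
    from all[OF this] have le: "norm (multiplier p y) \<le> (kernel_bound a b * norm y * N) * (1 / 2) ^ k" for k
      by (simp add: power_divide)
    have "(\<lambda>k. (kernel_bound a b * norm y * N) * (1 / 2) ^ k) \<longlonglongrightarrow> (kernel_bound a b * norm y * N) * 0"
      by (intro tendsto_mult tendsto_const LIMSEQ_power_zero) simp
    then have "norm (multiplier p y) \<le> (kernel_bound a b * norm y * N) * 0"
      by (rule LIMSEQ_le_const) (use le in blast)
    then show ?thesis by simp
  qed
  moreover have "0 < r / 2" using r by simp
  ultimately show ?thesis by (rule that[rotated])
qed

end

section \<open>Symbols supported off the spectrum\<close>

lemma C2_derivs_diff: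
  assumes "C2_derivs p p1 p2" "C2_derivs q q1 q2"
  shows "C2_derivs (\<lambda>x. p x - q x) (\<lambda>x. p1 x - q1 x) (\<lambda>x. p2 x - q2 x)"
  using assms unfolding C2_derivs_def
  by (auto intro!: has_vector_derivative_diff continuous_on_diff)

lemma vanishes_off_derivative:
  fixes q q' :: "real \<Rightarrow> complex"
  assumes q: "\<And>x. (q has_vector_derivative q' x) (at x)" and z: "vanishes_off a b q"
  shows "vanishes_off a b q'"
  unfolding vanishes_off_def
proof (intro allI impI)
  fix x assume x: "x \<le> a \<or> b \<le> x"
  \<comment> \<open>A unit interval lying outside (a, b) with \<open>x\<close> as one end. On it
    \<open>q\<close> is constantly 0, and uniqueness of the one-sided derivative gives the claim
    even when \<open>x\<close> is \<open>a\<close> or \<open>b\<close>.\<close>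
  define c d where "c = (if x \<le> a then x - 1 else x)" and "d = (if x \<le> a then x else x + 1)"
  have cd: "c < d" "x \<in> cbox c d" by (auto simp: c_def d_def)
  have q0: "q y = 0" if "y \<in> cbox c d" for y
    using that x z by (auto simp: c_def d_def vanishes_off_def split: if_splits)
  have "((\<lambda>y. 0) has_vector_derivative q' x) (at x within cbox c d)"
    by (rule has_vector_derivative_transform[OF cd(2) _ has_vector_derivative_at_within[OF q]])
       (simp add: q0)
  from vector_derivative_unique_within_closed_interval[OF cd this has_vector_derivative_const]
  show "q' x = 0" .
qed

lemma test_fun_exists:
  assumes "a < b" "C2_derivs p p1 p2" "vanishes_off a b p"
  obtains N where "test_fun a b N p"
proof -
  have 1: "vanishes_off a b p1"
    by (rule vanishes_off_derivative[OF C2_derivsD(1)[OF assms(2)] assms(3)])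
  have 2: "vanishes_off a b p2"
    by (rule vanishes_off_derivative[OF C2_derivsD(2)[OF assms(2)] 1])
  from test_funI[OF assms 1 2] show ?thesis using that by metis
qed

section \<open>Cut-off functions of class C^2\<close>

lemma DERIV_max_0_power:
  assumes "0 < n"
  shows "((\<lambda>x::real. max 0 x ^ Suc n) has_real_derivative real (Suc n) * max 0 x ^ n) (at x)"
proof (cases x "0::real" rule: linorder_cases)
  case less
  have d: "((\<lambda>x. 0) has_real_derivative 0) (at x)" by simp
  have eq: "real (Suc n) * max 0 x ^ n = 0" using less assms by simp
  show ?thesis unfolding eq
    by (rule has_field_derivative_transform_within_open[OF d, of "{..<0}"]) (use less in auto)
next
  case greater
  have d: "((\<lambda>x. x ^ Suc n) has_real_derivative real (Suc n) * x ^ n) (at x)"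
    using DERIV_pow[of "Suc n" x] by simp
  have eq: "real (Suc n) * max 0 x ^ n = real (Suc n) * x ^ n" using greater by simp
  show ?thesis unfolding eq
    by (rule has_field_derivative_transform_within_open[OF d, of "{0<..}"]) (use greater in auto)
next
  case equal
  have "((\<lambda>y::real. (max 0 y ^ Suc n - max 0 0 ^ Suc n) / (y - 0)) \<longlongrightarrow> 0) (at 0)"
  proof (rule Lim_null_comparison)
    have "norm ((max 0 y ^ Suc n - max 0 0 ^ Suc n) / (y - 0)) \<le> \<bar>y\<bar> ^ n" for y :: real
      by (cases "y > 0") (auto simp: max_def)
    then show "\<forall>\<^sub>F y in at 0. norm ((max 0 y ^ Suc n - max 0 0 ^ Suc n) / (y - 0)) \<le> \<bar>y :: real\<bar> ^ n"
      by (rule always_eventually[OF allI])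
    have "((\<lambda>y::real. \<bar>y\<bar> ^ n) \<longlongrightarrow> \<bar>0\<bar> ^ n) (at 0)" by (intro tendsto_intros)
    then show "((\<lambda>y::real. \<bar>y\<bar> ^ n) \<longlongrightarrow> 0) (at 0)" unfolding abs_zero zero_power[OF assms] .
  qed
  then show ?thesis using equal assms by (simp add: has_field_derivative_iff zero_power)
qed

definition third_diff :: "(real \<Rightarrow> real) \<Rightarrow> real \<Rightarrow> real" where
  "third_diff F x = F x - 3 * F (x - 1) + 3 * F (x - 2) - F (x - 3)"

lemma DERIV_third_diff:
  assumes "\<And>x. (F has_real_derivative F' x) (at x)"
  shows "(third_diff F has_real_derivative third_diff F' x) (at x)"
proof -
  have s: "((\<lambda>x. F (x - c)) has_real_derivative F' (x - c)) (at x)" for c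
    using DERIV_shift[of F "F' (x - c)" x "- c"] assms[of "x - c"] by simp
  have "((\<lambda>x. F x - 3 * F (x - 1) + 3 * F (x - 2) - F (x - 3)) has_real_derivative
      (F' x - 3 * F' (x - 1) + 3 * F' (x - 2) - F' (x - 3))) (at x)"
    by (intro DERIV_diff DERIV_add DERIV_cmult s assms)
  then show ?thesis by (simp add: third_diff_def[abs_def])
qed

text \<open>A twice continuously differentiable step of width \<open>3 * h\<close>: the third difference of the
  truncated cube is locally polynomial, and it annihilates quadratic terms.\<close>

definition soft_step :: "real \<Rightarrow> real \<Rightarrow> real \<Rightarrow> complex" where
  "soft_step u h x = complex_of_real (third_diff (\<lambda>y. max 0 y ^ 3) ((x - u) / h) / 6)"

lemma soft_step_0: "0 < h \<Longrightarrow> x \<le> u \<Longrightarrow> soft_step u h x = 0"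
proof -
  assume "0 < h" "x \<le> u"
  then have "(x - u) / h \<le> 0" by (simp add: divide_nonpos_pos)
  then show ?thesis by (simp add: soft_step_def third_diff_def)
qed

text \<open>From 3 on none of the four cubes is truncated, and the third difference of y^3 with unit
  step is 3! = 6, which explains the normalisation of \<open>soft_step\<close>.\<close>

lemma soft_step_1: "0 < h \<Longrightarrow> u + 3 * h \<le> x \<Longrightarrow> soft_step u h x = 1"
proof -
  assume "0 < h" "u + 3 * h \<le> x"
  then have "3 \<le> (x - u) / h" by (simp add: field_simps)
  moreover have "third_diff (\<lambda>y. max 0 y ^ 3) v = 6" if "3 \<le> v" for v
    using that by (simp add: third_diff_def power3_eq_cube algebra_simps)
  ultimately show ?thesis by (simp add: soft_step_def)
qed

lemma C2_derivs_soft_step: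
  assumes h: "0 < h"
  obtains s1 s2 where "C2_derivs (soft_step u h) s1 s2"
proof -
  have D: "((\<lambda>x. complex_of_real (F ((x - u) / h) / c)) has_vector_derivative
      complex_of_real (F' ((x - u) / h) / (c * h))) (at x)"
    if "\<And>x. (F has_real_derivative F' x) (at x)" for F F' c x
  proof -
    have "((\<lambda>x. (x - u) / h) has_real_derivative 1 / h) (at x)"
      using h by (auto intro!: derivative_eq_intros)
    from DERIV_cdivide[OF DERIV_chain2[OF that this], of c]
    have "((\<lambda>x. F ((x - u) / h) / c) has_vector_derivative F' ((x - u) / h) / (c * h)) (at x)"
      unfolding has_real_derivative_iff_has_vector_derivative by (simp add: field_simps)
    from bounded_linear.has_vector_derivative[OF bounded_linear_of_real this] show ?thesis .
  qed
  have 3: "(third_diff (\<lambda>y. max 0 y ^ 3) has_real_derivative third_diff (\<lambda>y. 3 * max 0 y ^ 2) x) (at x)" for x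
    by (rule DERIV_third_diff) (use DERIV_max_0_power[of 2] in \<open>simp add: numeral_eq_Suc\<close>)
  have "((\<lambda>y::real. 3 * max 0 y ^ 2) has_real_derivative 6 * max 0 x) (at x)" for x
    using DERIV_cmult[OF DERIV_max_0_power[of 1 x], of 3] by (simp add: numeral_2_eq_2)
  then have 2: "(third_diff (\<lambda>y. 3 * max 0 y ^ 2) has_real_derivative third_diff (\<lambda>y. 6 * max 0 y) x) (at x)" for x
    by (rule DERIV_third_diff)
  have "continuous_on UNIV (\<lambda>x. complex_of_real (third_diff (\<lambda>y. 6 * max 0 y) ((x - u) / h) / (6 * h * h)))"
    using h unfolding third_diff_def by (intro continuous_intros) auto
  then have "C2_derivs (soft_step u h) (\<lambda>x. complex_of_real (third_diff (\<lambda>y. 3 * max 0 y ^ 2) ((x - u) / h) / (6 * h)))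
      (\<lambda>x. complex_of_real (third_diff (\<lambda>y. 6 * max 0 y) ((x - u) / h) / (6 * h * h)))"
    unfolding C2_derivs_def soft_step_def[abs_def] using D[OF 3] D[OF 2] by blast
  then show ?thesis by (rule that)
qed

lemma C2_derivs_bump:
  assumes h: "0 < h" "0 < k"
  obtains s1 s2 where "C2_derivs (\<lambda>x. soft_step u h x - soft_step v k x) s1 s2"
proof -
  obtain s1 s2 where s: "C2_derivs (soft_step u h) s1 s2" using C2_derivs_soft_step[OF h(1)] .
  obtain r1 r2 where r: "C2_derivs (soft_step v k) r1 r2" using C2_derivs_soft_step[OF h(2)] .
  from C2_derivs_diff[OF s r] show ?thesis by (rule that)
qed

text \<open>Beyond \<open>v + 3 * h\<close> both steps equal 1 and cancel. The two ramps may
  overlap, as they do for \<open>v = u + h\<close> in the partition of a symbol; if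
  \<open>u + 3 * h\<close> is at most \<open>v\<close>, the bump is 1 in between.\<close>

lemma test_fun_bump:
  assumes h: "0 < h" "u < v"
  obtains N where "test_fun u (v + 3 * h) N (\<lambda>x. soft_step u h x - soft_step v h x)"
proof -
  obtain s1 s2 where s: "C2_derivs (\<lambda>x. soft_step u h x - soft_step v h x) s1 s2"
    using C2_derivs_bump[OF h(1) h(1)] .
  have "vanishes_off u (v + 3 * h) (\<lambda>x. soft_step u h x - soft_step v h x)"
    unfolding vanishes_off_def using h by (auto simp: soft_step_0 soft_step_1)
  from test_fun_exists[OF _ s this] show ?thesis using that h by auto
qed

text \<open>Fubini moves the transform from \<open>q\<close> to the Gaussian density, whose
  characteristic function is known.\<close>

lemma gaussian_times_inverse_fourier:
  assumes q: "continuous_on UNIV q" "vanishes_off a b q"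
  shows "(\<integral>t. complex_of_real (std_normal_density t) * inverse_fourier q t \<partial>lborel)
    = (\<integral>v. q v * complex_of_real (exp (- (v\<^sup>2) / 2)) \<partial>lborel)"
proof -
  let ?f = "\<lambda>t v. complex_of_real (std_normal_density t) * (q v * cis (t * v))"
  have iq: "integrable lborel q" by (rule integrable_vanishes_off[OF q])
  have iqc: "integrable lborel (\<lambda>v. q v * cis (t * v))" for t
    by (rule integrable_vanishes_off[OF _ vanishes_off_mult[OF q(2)]]) (intro continuous_intros q)
  have m: "case_prod ?f \<in> borel_measurable (lborel \<Otimes>\<^sub>M lborel)"
  proof -
    have "(\<lambda>(t, v). q v * cis (t * v)) \<in> borel_measurable (borel :: (real \<times> real) measure)"
      by (rule borel_measurable_continuous_onI)
         (auto simp: case_prod_beta intro!: continuous_intros continuous_on_compose2[OF q(1)])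
    then have [measurable]: "(\<lambda>(t, v). q v * cis (t * v)) \<in> borel_measurable (lborel \<Otimes>\<^sub>M lborel)"
      by (simp add: borel_prod[symmetric] cong: measurable_cong_sets)
    have "(\<lambda>x. complex_of_real (std_normal_density (fst x)) * (\<lambda>(t, v). q v * cis (t * v)) x)
        \<in> borel_measurable (lborel \<Otimes>\<^sub>M lborel)" by measurable
    then show ?thesis by (simp add: case_prod_beta)
  qed
  have ni: "integrable lborel (\<lambda>t. std_normal_density t)" by simp
  have "integrable (lborel \<Otimes>\<^sub>M lborel) (case_prod ?f)"
  proof (rule lborel_pair.Fubini_integrable[OF m])
    have "integrable lborel (\<lambda>t. std_normal_density t * (\<integral>v. norm (q v) \<partial>lborel))"
      using ni by simp
    then show "integrable lborel (\<lambda>t. \<integral>v. norm (case (t, v) of (t, v) \<Rightarrow> ?f t v) \<partial>lborel)"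
      by (simp add: norm_mult)
    show "AE t in lborel. integrable lborel (\<lambda>v. case (t, v) of (t, v) \<Rightarrow> ?f t v)"
      using iqc by auto
  qed
  from lborel_pair.Fubini_integral[OF this]
  have "(\<integral>t. (\<integral>v. ?f t v \<partial>lborel) \<partial>lborel) = (\<integral>v. (\<integral>t. ?f t v \<partial>lborel) \<partial>lborel)" by simp
  moreover have "(\<integral>v. ?f t v \<partial>lborel) = complex_of_real (std_normal_density t) * inverse_fourier q t" for t
    unfolding inverse_fourier_def by simp
  moreover have "(\<integral>t. ?f t v \<partial>lborel) = q v * complex_of_real (exp (- (v\<^sup>2) / 2))" for v
  proof -
    have "(\<integral>t. ?f t v \<partial>lborel) = q v * (\<integral>t. std_normal_density t *\<^sub>R cis (t * v) \<partial>lborel)"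
      by (subst Bochner_Integration.integral_mult_right_zero[symmetric])
         (simp add: scaleR_conv_of_real mult_ac)
    also have "(\<integral>t. std_normal_density t *\<^sub>R cis (t * v) \<partial>lborel) = char std_normal_distribution v"
      unfolding char_def
      by (subst integral_density) (auto simp: normal_density_nonneg cis_conv_exp mult_ac)
    also have "\<dots> = complex_of_real (exp (- (v\<^sup>2) / 2))" by (simp add: char_std_normal_distribution)
    finally show ?thesis .
  qed
  ultimately show ?thesis by (simp only:)
qed

lemma inverse_fourier_scale:
  assumes "0 < R"
  shows "inverse_fourier (\<lambda>x. p (x / R)) t = R * inverse_fourier p (R * t)"
proof -
  have "inverse_fourier (\<lambda>x. p (x / R)) t
      = \<bar>R\<bar> *\<^sub>R (\<integral>x. p ((0 + R * x) / R) * cis (t * (0 + R * x)) \<partial>lborel)"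
    unfolding inverse_fourier_def using assms by (intro lborel_integral_real_affine) auto
  then show ?thesis using assms by (simp add: inverse_fourier_def scaleR_conv_of_real mult_ac)
qed

text \<open>The value is \<open>2 * pi * p 0\<close>: Fourier inversion at a single point, by Gaussian summation.\<close>

lemma integral_inverse_fourier_nonzero:
  assumes p: "test_fun a b N p" and p0: "p 0 \<noteq> 0"
  shows "(\<integral>t. inverse_fourier p t \<partial>lborel) \<noteq> 0"
proof -
  let ?k = "inverse_fourier p" and ?n = "\<lambda>n. real (Suc n)"
  let ?A = "\<lambda>n. \<integral>v. p (v / ?n n) * complex_of_real (exp (- (v\<^sup>2) / 2)) \<partial>lborel"
  note pc = test_fun_continuous[OF p] and ki = integrable_inverse_fourier[OF p]
  have gi: "integrable lborel (\<lambda>v::real. exp (- (v\<^sup>2) / 2))"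
  proof -
    have "integrable lborel (\<lambda>v. sqrt (2 * pi) * std_normal_density v)" by simp
    then show ?thesis by (simp add: std_normal_density_def del: integrable_mult_right_iff)
  qed
  have gI: "(\<integral>v. exp (- ((v::real)\<^sup>2) / 2) \<partial>lborel) = sqrt (2 * pi)"
  proof -
    have "(\<integral>v. sqrt (2 * pi) * std_normal_density v \<partial>lborel) = sqrt (2 * pi)" by simp
    then show ?thesis by (simp add: std_normal_density_def del: integral_mult_right_zero)
  qed
  have s0: "(\<lambda>n. v / ?n n) \<longlonglongrightarrow> 0" for v :: real
    using tendsto_mult[OF tendsto_const[of v] LIMSEQ_inverse_real_of_nat] by (simp add: divide_inverse)
  obtain B where B: "\<And>x. norm (p x) \<le> B"
  proof -
    obtain B where B: "\<forall>x. a \<le> x \<longrightarrow> x \<le> b \<longrightarrow> norm (p x) \<le> B"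
      using continuous_bounded_on_Icc[OF pc] by metis
    have "norm (p x) \<le> max 0 B" for x
      using B test_fun_vanishes[OF p] by (cases "a \<le> x \<and> x \<le> b") (auto simp: vanishes_off_def le_max_iff_disj)
    then show ?thesis by (rule that)
  qed
  have B0: "0 \<le> B" using B[of 0] order_trans[OF norm_ge_zero] by metis
  have "?A \<longlonglongrightarrow> (\<integral>v. p 0 * complex_of_real (exp (- (v\<^sup>2) / 2)) \<partial>lborel)"
  proof (rule integral_dominated_convergence[where w="\<lambda>v. B * exp (- (v\<^sup>2) / 2)"])
    have [measurable]: "p \<in> borel_measurable borel" by (rule borel_measurable_continuous_onI[OF pc])
    show "(\<lambda>v. p (v / ?n n) * complex_of_real (exp (- (v\<^sup>2) / 2))) \<in> borel_measurable lborel" for n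
      by measurable
    show "(\<lambda>v. p 0 * complex_of_real (exp (- (v\<^sup>2) / 2))) \<in> borel_measurable lborel" by measurable
    show "integrable lborel (\<lambda>v. B * exp (- (v\<^sup>2) / 2))" using gi by (rule integrable_mult_right)
    show "AE v in lborel. (\<lambda>n. p (v / ?n n) * complex_of_real (exp (- (v\<^sup>2) / 2)))
        \<longlonglongrightarrow> p 0 * complex_of_real (exp (- (v\<^sup>2) / 2))"
    proof (intro AE_I2 tendsto_mult tendsto_const)
      fix v
      have "isCont p 0" using pc by (simp add: continuous_on_eq_continuous_at)
      then show "(\<lambda>n. p (v / ?n n)) \<longlonglongrightarrow> p 0" using s0 by (rule isCont_tendsto_compose)
    qed
    show "AE v in lborel. norm (p (v / ?n n) * complex_of_real (exp (- (v\<^sup>2) / 2))) \<le> B * exp (- (v\<^sup>2) / 2)" for n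
      unfolding norm_mult norm_of_real by (intro AE_I2 mult_mono B B0) auto
  qed
  also have "(\<integral>v. p 0 * complex_of_real (exp (- (v\<^sup>2) / 2)) \<partial>lborel) = p 0 * complex_of_real (sqrt (2 * pi))"
    using gI by (simp only: integral_mult_right_zero integral_complex_of_real)
  finally have lim1: "?A \<longlonglongrightarrow> p 0 * complex_of_real (sqrt (2 * pi))" .
  \<comment> \<open>The same numbers on the kernel side: dilating the symbol turns the density into
    one stretched by n + 1, which converges pointwise to its value at 0. Comparing the two limits
    isolates the integral of the kernel.\<close>
  have A: "?A n = (\<integral>t. complex_of_real (std_normal_density (t / ?n n)) * ?k t \<partial>lborel)" for n
  proof -
    let ?q = "\<lambda>x. p (x / ?n n)"
    have q: "continuous_on UNIV ?q"
      by (rule continuous_on_compose2[OF pc]) (auto intro!: continuous_intros)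
    have "vanishes_off (?n n * a) (?n n * b) ?q"
      using test_fun_vanishes[OF p] by (auto simp: vanishes_off_def field_simps simp del: of_nat_Suc)
    from gaussian_times_inverse_fourier[OF q this]
    have "?A n = (\<integral>u. complex_of_real (std_normal_density u) * (?n n * ?k (?n n * u)) \<partial>lborel)"
      by (simp add: inverse_fourier_scale del: of_nat_Suc)
    also have "\<dots> = \<bar>?n n\<bar> *\<^sub>R (\<integral>u. complex_of_real (std_normal_density ((0 + ?n n * u) / ?n n)) * ?k (0 + ?n n * u) \<partial>lborel)"
      by (subst Bochner_Integration.integral_scaleR_right[symmetric])
         (auto simp: scaleR_conv_of_real mult_ac simp del: of_nat_Suc)
    also have "\<dots> = (\<integral>t. complex_of_real (std_normal_density (t / ?n n)) * ?k t \<partial>lborel)"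
      by (rule lborel_integral_real_affine[symmetric]) simp
    finally show ?thesis .
  qed
  have "?A \<longlonglongrightarrow> (\<integral>t. complex_of_real (std_normal_density 0) * ?k t \<partial>lborel)"
    unfolding A
  proof (rule integral_dominated_convergence[where w="\<lambda>t. norm (?k t)"])
    have [measurable]: "?k \<in> borel_measurable borel" using ki by simp
    show "(\<lambda>t. complex_of_real (std_normal_density (t / ?n n)) * ?k t) \<in> borel_measurable lborel" for n
      by measurable
    show "(\<lambda>t. complex_of_real (std_normal_density 0) * ?k t) \<in> borel_measurable lborel" by measurable
    show "integrable lborel (\<lambda>t. norm (?k t))" using ki by simp
    show "AE t in lborel. (\<lambda>n. complex_of_real (std_normal_density (t / ?n n)) * ?k t)
        \<longlonglongrightarrow> complex_of_real (std_normal_density 0) * ?k t"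
      unfolding std_normal_density_def
    proof (intro AE_I2 tendsto_mult tendsto_const tendsto_of_real tendsto_exp tendsto_divide tendsto_minus tendsto_power)
      show "(\<lambda>n. t / ?n n) \<longlonglongrightarrow> 0" for t using s0 .
    qed simp
    have le1: "std_normal_density x \<le> 1" for x
    proof -
      have "1 \<le> sqrt (2 * pi)" using pi_gt3 by (simp add: real_le_rsqrt)
      then show ?thesis unfolding std_normal_density_def by (intro mult_le_one) auto
    qed
    show "AE t in lborel. norm (complex_of_real (std_normal_density (t / ?n n)) * ?k t) \<le> norm (?k t)" for n
      unfolding norm_mult norm_of_real
      by (intro AE_I2 mult_left_le_one_le) (use le1 normal_density_nonneg in auto)
  qed
  from LIMSEQ_unique[OF lim1 this]
  have "p 0 * complex_of_real (sqrt (2 * pi)) = complex_of_real (std_normal_density 0) * (\<integral>t. ?k t \<partial>lborel)"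
    by simp
  then show ?thesis using p0 by auto
qed

section \<open>Localisation to the spectrum and approximation of vectors\<close>

context isometric_representation
begin

lemma multiplier_0: "test_fun a b N p \<Longrightarrow> (\<And>x. q x = 0) \<Longrightarrow> multiplier q y = 0"
proof -
  assume p: "test_fun a b N p" and "\<And>x. q x = 0"
  then have "q = (\<lambda>x. 0 * p x)" by auto
  then show ?thesis using multiplier_cmult[OF p, of 0] by (simp add: scaleC.zero_left)
qed

text \<open>Compactness gives a Lebesgue number for the intervals on which vanishing is known. The
  symbol is then cut into pieces shorter than it, and the pieces telescope.\<close>

lemma multiplier_vanishes_off_spectrum:
  assumes p: "test_fun a b N p" and sp: "{a..b} \<inter> beurling_spectrum T = {}"
  shows "multiplier p y = 0"
proof -
  note ab = test_fun_less[OF p]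
  define good where "good l d \<longleftrightarrow> (\<forall>a b N p. test_fun a b N p \<longrightarrow> l - d \<le> a \<longrightarrow> b \<le> l + d \<longrightarrow> multiplier p y = 0)" for l d
  have ex: "\<exists>d>0. good l d" if "l \<in> {a..b}" for l
  proof -
    have "l \<notin> beurling_spectrum T" using that sp by blast
    from multiplier_vanishes_near[OF this] show ?thesis unfolding good_def by metis
  qed
  let ?G = "{ball l d | l d. 0 < d \<and> good l d}"
  have cover: "{a..b} \<subseteq> \<Union>?G"
  proof
    fix l assume l: "l \<in> {a..b}"
    from ex[OF l] obtain d where "0 < d" "good l d" by blast
    then have "l \<in> ball l d" "ball l d \<in> ?G" by auto
    then show "l \<in> \<Union>?G" by blast
  qed
  obtain e where e: "0 < e" "\<And>x. x \<in> {a..b} \<Longrightarrow> \<exists>G\<in>?G. ball x e \<subseteq> G"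
    by (rule Heine_Borel_lemma[OF compact_Icc cover]) auto
  \<comment> \<open>A piece has support of length 4 h < e, so it lies in the ball of radius e around
    any of its points.\<close>
  define h where "h = e / 5"
  have h: "0 < h" using e by (simp add: h_def)
  have piece: "multiplier (\<lambda>x. (soft_step u h x - soft_step (u + h) h x) * p x) y = 0" for u
  proof -
    have "u < u + h" using h by simp
    obtain N' where N': "test_fun u (u + 4 * h) N' (\<lambda>x. soft_step u h x - soft_step (u + h) h x)"
      using test_fun_bump[OF h \<open>u < u + h\<close>] by (auto simp: algebra_simps)
    obtain p1 p2 where d: "C2_derivs p p1 p2" using p by (rule test_funE)
    obtain N'' where "test_fun u (u + 4 * h) N'' (\<lambda>x. p x * (soft_step u h x - soft_step (u + h) h x))"
      using test_fun_mult_exists[OF N' d] .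
    then have t: "test_fun u (u + 4 * h) N'' (\<lambda>x. (soft_step u h x - soft_step (u + h) h x) * p x)"
      by (simp add: mult.commute)
    show ?thesis
    proof (cases "\<exists>x. x \<in> {a..b} \<and> x \<in> {u..u + 4 * h}")
      case True
      then obtain x where x: "x \<in> {a..b}" "x \<in> {u..u + 4 * h}" by blast
      from e(2)[OF x(1)] obtain l d where ld: "good l d" "ball x e \<subseteq> ball l d" by blast
      have "u \<in> ball x e" "u + 4 * h \<in> ball x e" using x(2) e(1) by (auto simp: h_def dist_real_def)
      then have "u \<in> ball l d" "u + 4 * h \<in> ball l d" using ld by blast+
      then have "l - d \<le> u" "u + 4 * h \<le> l + d" by (auto simp: dist_real_def)
      then show ?thesis using ld(1) t unfolding good_def by blast
    next
      case False
      have "(soft_step u h x - soft_step (u + h) h x) * p x = 0" for x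
        using False test_fun_vanishes[OF p] test_fun_vanishes[OF N']
        unfolding vanishes_off_def by (metis atLeastAtMost_iff linorder_le_cases mult_eq_0_iff)
      then show ?thesis by (rule multiplier_0[OF p])
    qed
  qed
  \<comment> \<open>The step starting at \<open>u 0\<close> has already reached 1 at
    \<open>a\<close>, so the symbol \<open>(1 - soft_step (u n) h x) * p x\<close> is 0 for
    \<open>n = 0\<close>. It equals \<open>p\<close> once \<open>u n\<close> has passed
    \<open>b\<close>, and consecutive symbols differ by one piece.\<close>
  define u where "u n = a - 3 * h + real n * h" for n
  have C: "\<exists>N. test_fun a b N (\<lambda>x. (1 - soft_step (u n) h x) * p x)" for n
  proof -
    obtain s1 s2 where s: "C2_derivs (soft_step (u n) h) s1 s2" using C2_derivs_soft_step[OF h] .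
    from test_fun_mult_exists[OF p C2_derivs_diff[OF C2_derivs_const[of 1] s]] show ?thesis by metis
  qed
  have ind: "multiplier (\<lambda>x. (1 - soft_step (u n) h x) * p x) y = 0" for n
  proof (induction n)
    case 0
    have "(1 - soft_step (u 0) h x) * p x = 0" for x
    proof (cases "x \<le> a")
      case True then show ?thesis using test_fun_vanishes[OF p] by (simp add: vanishes_off_def)
    next
      case False then show ?thesis using h by (simp add: soft_step_1 u_def)
    qed
    then show ?case by (rule multiplier_0[OF p])
  next
    case (Suc n)
    have us: "u (Suc n) = u n + h" by (simp add: u_def algebra_simps)
    obtain N1 where 1: "test_fun a b N1 (\<lambda>x. (1 - soft_step (u n) h x) * p x)" using C[of n] by blast
    obtain N2 where 2: "test_fun a b N2 (\<lambda>x. (1 - soft_step (u (Suc n)) h x) * p x)" using C[of "Suc n"] by blast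
    have "multiplier (\<lambda>x. (1 - soft_step (u (Suc n)) h x) * p x - (1 - soft_step (u n) h x) * p x) y
        = multiplier (\<lambda>x. (soft_step (u n) h x - soft_step (u n + h) h x) * p x) y"
      unfolding us by (simp add: algebra_simps)
    then show ?case using multiplier_diff[OF 2 1, of y] piece[of "u n"] Suc.IH by simp
  qed
  obtain n where "(b - a + 3 * h) / h \<le> real n" using real_arch_simple by blast
  then have n: "b \<le> u n" using h by (simp add: u_def field_simps)
  have "(\<lambda>x. (1 - soft_step (u n) h x) * p x) = p"
  proof
    fix x
    show "(1 - soft_step (u n) h x) * p x = p x"
    proof (cases "b \<le> x")
      case True then show ?thesis using test_fun_vanishes[OF p] by (simp add: vanishes_off_def)
    next
      case False then show ?thesis using h n by (simp add: soft_step_0)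
    qed
  qed
  then show ?thesis using ind[of n] by simp
qed

text \<open>Dilating the symbol by n concentrates its kernel to n k(n t) and preserves the total
  mass. That mass is the Fourier transform at 0, so the error is governed by the orbit increments
  near time 0, which strong continuity makes small.\<close>

lemma multiplier_scaled_tendsto:
  assumes p: "test_fun a b N p" and pn: "\<And>n. test_fun (real (Suc n) * a) (real (Suc n) * b) (N' n) (\<lambda>x. p (x / real (Suc n)))"
  shows "(\<lambda>n. multiplier (\<lambda>x. p (x / real (Suc n))) y) \<longlonglongrightarrow> (\<integral>t. inverse_fourier p t \<partial>lborel) *\<^sub>C y"
proof -
  let ?k = "inverse_fourier p" and ?n = "\<lambda>n. real (Suc n)"
  note ki = integrable_inverse_fourier[OF p]
  have km[measurable]: "?k \<in> borel_measurable borel" using ki by simp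
  define g where "g t = norm (blinfun_apply (T (- t)) y - y)" for t
  have gc: "continuous_on UNIV g"
    unfolding g_def by (intro continuous_intros continuous_T_uminus)
  have gm[measurable]: "g \<in> borel_measurable borel" by (rule borel_measurable_continuous_onI[OF gc])
  have g0: "0 \<le> g t" for t by (simp add: g_def)
  have g2: "g t \<le> 2 * norm y" for t
    unfolding g_def using norm_triangle_ineq4[of "blinfun_apply (T (- t)) y" y] by simp
  have isc: "inverse_fourier (\<lambda>x. p (x / ?n n)) t = ?n n * ?k (?n n * t)" for n t
    by (rule inverse_fourier_scale) simp
  have sc: "(\<integral>t. F (?n n * t) \<partial>lborel) = (1 / ?n n) *\<^sub>R (\<integral>t. F t \<partial>lborel)" for n and F :: "real \<Rightarrow> 'c::{banach, second_countable_topology}"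
    using lborel_integral_real_affine[of "?n n" F 0] by simp
  have ft: "fourier (inverse_fourier (\<lambda>x. p (x / ?n n))) 0 = (\<integral>t. ?k t \<partial>lborel)" for n
    unfolding fourier_def isc using sc[of ?k n] by (simp add: scaleR_conv_of_real del: of_nat_Suc)
  have bi: "integrable lborel (\<lambda>u. norm (?k u) * g (u / ?n n))" for n
  proof (rule Bochner_Integration.integrable_bound[where f="\<lambda>u. norm (?k u) * (2 * norm y)"])
    show "integrable lborel (\<lambda>u. norm (?k u) * (2 * norm y))" using ki by simp
    show "AE u in lborel. norm (norm (?k u) * g (u / ?n n)) \<le> norm (norm (?k u) * (2 * norm y))"
      unfolding norm_mult by (intro AE_I2 mult_mono) (use g0 g2 in auto)
  qed measurable
  have bound: "norm (multiplier (\<lambda>x. p (x / ?n n)) y - (\<integral>t. ?k t \<partial>lborel) *\<^sub>C y)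
      \<le> (\<integral>u. norm (?k u) * g (u / ?n n) \<partial>lborel)" for n
  proof -
    let ?F = "\<lambda>u. norm (?k u) * g (u / ?n n)"
    have Fi: "integrable lborel (\<lambda>t. ?n n * ?F (?n n * t))"
      using lborel_integrable_real_affine[OF bi[of n], of "?n n" 0] by simp
    have "ennreal (norm (multiplier (\<lambda>x. p (x / ?n n)) y - (\<integral>t. ?k t \<partial>lborel) *\<^sub>C y))
      \<le> (\<integral>\<^sup>+ t. norm (inverse_fourier (\<lambda>x. p (x / ?n n)) t) * norm (blinfun_apply (T (- t)) y - cis (- t * 0) *\<^sub>C y) \<partial>lborel)"
      unfolding multiplier_def ft[of n, symmetric]
      by (rule norm_fourier_scaleC_diff_le[OF integrable_inverse_fourier[OF pn]])
    also have "\<dots> = (\<integral>\<^sup>+ t. ennreal (?n n * ?F (?n n * t)) \<partial>lborel)"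
      unfolding isc by (simp add: g_def norm_mult mult.assoc del: of_nat_Suc)
    also have "\<dots> = ennreal (\<integral>t. ?n n * ?F (?n n * t) \<partial>lborel)"
      by (rule nn_integral_eq_lebesgue[OF Fi]) (simp add: g0)
    also have "(\<integral>t. ?n n * ?F (?n n * t) \<partial>lborel) = (\<integral>u. ?F u \<partial>lborel)"
      using sc[of ?F n] by (simp del: of_nat_Suc)
    finally show ?thesis
      by (subst (asm) ennreal_le_iff) (auto intro!: integral_nonneg_AE simp: g0)
  qed
  have "(\<lambda>n. \<integral>u. norm (?k u) * g (u / ?n n) \<partial>lborel) \<longlonglongrightarrow> (\<integral>u. 0 \<partial>(lborel :: real measure))"
  proof (rule integral_dominated_convergence[where w="\<lambda>u. norm (?k u) * (2 * norm y)"])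
    show "integrable lborel (\<lambda>u. norm (?k u) * (2 * norm y))" using ki by simp
    show "AE u in lborel. (\<lambda>n. norm (?k u) * g (u / ?n n)) \<longlonglongrightarrow> 0"
    proof (rule AE_I2)
      fix u
      have "(\<lambda>n. u / ?n n) \<longlonglongrightarrow> 0"
        using tendsto_mult[OF tendsto_const[of u] LIMSEQ_inverse_real_of_nat] by (simp add: divide_inverse)
      moreover have "isCont g 0" using gc by (simp add: continuous_on_eq_continuous_at)
      ultimately have "(\<lambda>n. g (u / ?n n)) \<longlonglongrightarrow> g 0" by (rule isCont_tendsto_compose[rotated])
      from tendsto_mult[OF tendsto_const[of "norm (?k u)"] this]
      show "(\<lambda>n. norm (?k u) * g (u / ?n n)) \<longlonglongrightarrow> 0" by (simp add: g_def)
    qed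
    show "AE u in lborel. norm (norm (?k u) * g (u / ?n n)) \<le> norm (?k u) * (2 * norm y)" for n
      unfolding norm_mult by (intro AE_I2 mult_mono) (use g0 g2 in auto)
  qed (use bi in auto)
  then have "(\<lambda>n. \<integral>u. norm (?k u) * g (u / ?n n) \<partial>lborel) \<longlonglongrightarrow> 0" by simp
  then have "(\<lambda>n. multiplier (\<lambda>x. p (x / ?n n)) y - (\<integral>t. ?k t \<partial>lborel) *\<^sub>C y) \<longlonglongrightarrow> 0"
    by (rule Lim_null_comparison[rotated]) (use bound in auto)
  then show ?thesis by (rule LIM_zero_cancel)
qed

text \<open>The dilated symbols of an approximate identity spread over the line, but their parts
  left and right of the spectrum act as zero. What remains has support in a fixed neighbourhood of
  [0, \<gamma>] and acts in the same way. The constant \<open>c\<close> is the mass of the undilated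
  kernel.\<close>

lemma spectral_approximation:
  assumes sp: "beurling_spectrum T \<subseteq> {0..\<gamma>}" and \<gamma>: "0 \<le> \<gamma>" and e: "0 < e"
  obtains c \<psi> N where "c \<noteq> 0" "\<And>n. test_fun (- e) (\<gamma> + e) (N n) (\<psi> n)"
    "\<And>y. (\<lambda>n. multiplier (\<psi> n) y) \<longlonglongrightarrow> c *\<^sub>C y"
proof -
  let ?n = "\<lambda>n. real (Suc n)"
  \<comment> \<open>This bump has its support in [- 4, 4] and equals 1 on [- 1, 1]; the value at 0
    is what makes the mass nonzero.\<close>
  define \<sigma> where "\<sigma> x = soft_step (- 4) 1 x - soft_step 1 1 x" for x
  obtain N where \<sigma>: "test_fun (- 4) 4 N \<sigma>"
    using test_fun_bump[of 1 "-4" 1] by (auto simp: \<sigma>_def[abs_def])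
  have \<sigma>0: "\<sigma> 0 \<noteq> 0" by (simp add: \<sigma>_def soft_step_0 soft_step_1)
  have \<sigma>n: "(\<lambda>x. \<sigma> (x / ?n n)) = (\<lambda>x. soft_step (?n n * - 4) (?n n) x - soft_step (?n n) (?n n) x)" for n
  proof -
    have 1: "(x / ?n n - - 4) / 1 = (x - ?n n * - 4) / ?n n" for x
      by (simp add: field_simps del: of_nat_Suc)
    have 2: "(x / ?n n - 1) / 1 = (x - ?n n) / ?n n" for x
      by (simp add: field_simps del: of_nat_Suc)
    show ?thesis unfolding \<sigma>_def soft_step_def 1 2 ..
  qed
  have "\<exists>N'. test_fun (?n n * - 4) (?n n * 4) N' (\<lambda>x. \<sigma> (x / ?n n))" for n
  proof -
    have "0 < ?n n" "?n n * - 4 < ?n n" by linarith+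
    then obtain M where "test_fun (?n n * - 4) (?n n + 3 * ?n n) M (\<lambda>x. \<sigma> (x / ?n n))"
      unfolding \<sigma>n by (rule test_fun_bump)
    moreover have "?n n + 3 * ?n n = ?n n * 4" by simp
    ultimately show ?thesis by metis
  qed
  then obtain N' where N': "\<And>n. test_fun (?n n * - 4) (?n n * 4) (N' n) (\<lambda>x. \<sigma> (x / ?n n))"
    by metis
  \<comment> \<open>A step with parameter e / 6 has a ramp of length e / 2. The cut-off is thus 1
    from - e / 2 to \<gamma> + e / 2, and the discarded parts \<open>L\<close> and \<open>R\<close>
    stay at distance e / 2 from [0, \<gamma>].\<close>
  define \<psi> where "\<psi> n x = (soft_step (- e) (e / 6) x - soft_step (\<gamma> + e / 2) (e / 6) x) * \<sigma> (x / ?n n)" for n x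
  have e6: "0 < e / 6" using e by simp
  have C\<sigma>: "\<exists>s1 s2. C2_derivs (\<lambda>x. \<sigma> (x / ?n n)) s1 s2" for n
    using N' by (meson test_funE)
  have "\<exists>M. test_fun (- e) (\<gamma> + e) M (\<psi> n)" for n
  proof -
    obtain s1 s2 where s: "C2_derivs (\<lambda>x. \<sigma> (x / ?n n)) s1 s2" using C\<sigma> by blast
    obtain M where "test_fun (- e) (\<gamma> + e / 2 + 3 * (e / 6)) M (\<lambda>x. soft_step (- e) (e / 6) x - soft_step (\<gamma> + e / 2) (e / 6) x)"
      using test_fun_bump[OF e6, of "- e" "\<gamma> + e / 2"] e \<gamma> by auto
    then have "test_fun (- e) (\<gamma> + e) M (\<lambda>x. soft_step (- e) (e / 6) x - soft_step (\<gamma> + e / 2) (e / 6) x)"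
      by (simp add: add.assoc)
    then obtain M' where M': "test_fun (- e) (\<gamma> + e) M' (\<lambda>x. \<sigma> (x / ?n n)
        * (soft_step (- e) (e / 6) x - soft_step (\<gamma> + e / 2) (e / 6) x))"
      using test_fun_mult_exists[OF _ s] by metis
    have "(\<lambda>x. \<sigma> (x / ?n n) * (soft_step (- e) (e / 6) x - soft_step (\<gamma> + e / 2) (e / 6) x)) = \<psi> n"
      by (simp add: \<psi>_def fun_eq_iff)
    with M' show ?thesis by metis
  qed
  then obtain M where M: "\<And>n. test_fun (- e) (\<gamma> + e) (M n) (\<psi> n)" by metis
  have "multiplier (\<psi> n) y = multiplier (\<lambda>x. \<sigma> (x / ?n n)) y" for n y
  proof -
    define L where "L x = (1 - soft_step (- e) (e / 6) x) * \<sigma> (x / ?n n)" for x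
    define R where "R x = soft_step (\<gamma> + e / 2) (e / 6) x * \<sigma> (x / ?n n)" for x
    obtain s1 s2 where s: "C2_derivs (\<lambda>x. \<sigma> (x / ?n n)) s1 s2" using C\<sigma> by blast
    obtain l1 l2 where l: "C2_derivs (soft_step (- e) (e / 6)) l1 l2" using C2_derivs_soft_step[OF e6] .
    obtain r1 r2 where r: "C2_derivs (soft_step (\<gamma> + e / 2) (e / 6)) r1 r2" using C2_derivs_soft_step[OF e6] .
    have z\<sigma>: "vanishes_off (?n n * - 4) (?n n * 4) (\<lambda>x. \<sigma> (x / ?n n))" by (rule test_fun_vanishes[OF N'])
    have "vanishes_off (?n n * - 4 - e) (- e / 2) L"
      using z\<sigma> e soft_step_1[OF e6, of "- e"] by (auto simp: vanishes_off_def L_def)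
    moreover have "\<exists>a b. C2_derivs L a b"
      using C2_derivs_mult[OF C2_derivs_diff[OF C2_derivs_const[of 1] l] s]
      unfolding L_def[abs_def] by blast
    moreover have "?n n * - 4 - e < - e / 2" using e by (simp add: algebra_simps add_pos_nonneg)
    ultimately obtain A where A: "test_fun (?n n * - 4 - e) (- e / 2) A L"
      using test_fun_exists by metis
    have "vanishes_off (\<gamma> + e / 2) (\<gamma> + e + ?n n * 4) R"
      using z\<sigma> e \<gamma> soft_step_0[OF e6, of _ "\<gamma> + e / 2"] by (auto simp: vanishes_off_def R_def)
    moreover have "\<exists>a b. C2_derivs R a b"
      using C2_derivs_mult[OF r s] unfolding R_def[abs_def] by blast
    moreover have "\<gamma> + e / 2 < \<gamma> + e + ?n n * 4" using e by (simp add: algebra_simps add_pos_nonneg)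
    ultimately obtain B where B: "test_fun (\<gamma> + e / 2) (\<gamma> + e + ?n n * 4) B R"
      using test_fun_exists by metis
    have "multiplier L y = 0"
      by (rule multiplier_vanishes_off_spectrum[OF A]) (use sp e in fastforce)
    moreover have "multiplier R y = 0"
      by (rule multiplier_vanishes_off_spectrum[OF B]) (use sp e in fastforce)
    moreover have "multiplier (\<lambda>x. \<sigma> (x / ?n n) - \<psi> n x) y = multiplier (\<lambda>x. L x + R x) y"
      by (rule arg_cong[of _ _ "\<lambda>q. multiplier q y"]) (simp add: \<psi>_def L_def R_def algebra_simps fun_eq_iff)
    ultimately show ?thesis
      using multiplier_diff[OF N' M] multiplier_add[OF A B] by simp
  qed
  moreover have "(\<lambda>n. multiplier (\<lambda>x. \<sigma> (x / ?n n)) y) \<longlonglongrightarrow> (\<integral>t. inverse_fourier \<sigma> t \<partial>lborel) *\<^sub>C y" for y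
    by (rule multiplier_scaled_tendsto[OF \<sigma> N'])
  ultimately have "(\<lambda>n. multiplier (\<psi> n) y) \<longlonglongrightarrow> (\<integral>t. inverse_fourier \<sigma> t \<partial>lborel) *\<^sub>C y" for y
    by (simp only:)
  from that[OF integral_inverse_fourier_nonzero[OF \<sigma> \<sigma>0] M this] show ?thesis .
qed

end

section \<open>A Bernstein inequality\<close>

text \<open>Taylor coefficients of \<open>sin (\<theta> * arcsin v)\<close>, read off from the differential equation
  \<open>(1 - v\<^sup>2) P'' - v P' + \<theta>\<^sup>2 P = 0\<close>.  For \<open>0 \<le> \<theta> \<le> 1\<close> they are nonnegative.\<close>

fun sin_arcsin_coeff :: "real \<Rightarrow> nat \<Rightarrow> real" where
  "sin_arcsin_coeff \<theta> 0 = 0"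
| "sin_arcsin_coeff \<theta> (Suc 0) = \<theta>"
| "sin_arcsin_coeff \<theta> (Suc (Suc n)) =
     ((real n)\<^sup>2 - \<theta>\<^sup>2) / ((real n + 1) * (real n + 2)) * sin_arcsin_coeff \<theta> n"

text \<open>The factor of the recursion can be negative only at \<open>n = 0\<close>, where it
  multiplies the coefficient 0; for larger \<open>n\<close> one has \<theta>^2 \<le> 1 \<le> n^2.
  The bound 1 makes the series converge on (- 1, 1).\<close>

lemma sin_arcsin_coeff_bounds:
  assumes "0 \<le> \<theta>" "\<theta> \<le> 1"
  shows "0 \<le> sin_arcsin_coeff \<theta> n \<and> sin_arcsin_coeff \<theta> n \<le> 1"
  using assms
proof (induction \<theta> n rule: sin_arcsin_coeff.induct)
  case (3 \<theta> n)
  show ?case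
  proof (cases "n = 0")
    case True
    then show ?thesis by (simp add: numeral_2_eq_2)
  next
    case False
    then have n1: "1 \<le> real n" by simp
    have "\<theta>\<^sup>2 \<le> 1\<^sup>2" using 3 by (intro power_mono) auto
    moreover have "1\<^sup>2 \<le> (real n)\<^sup>2" using n1 by (intro power_mono) auto
    ultimately have q0: "0 \<le> (real n)\<^sup>2 - \<theta>\<^sup>2" by simp
    have "(real n)\<^sup>2 - \<theta>\<^sup>2 \<le> (real n + 1) * (real n + 2)"
      by (simp add: algebra_simps power2_eq_square add_increasing)
    then have "((real n)\<^sup>2 - \<theta>\<^sup>2) / ((real n + 1) * (real n + 2)) \<le> 1"
      by (simp add: divide_le_eq)
    moreover have "0 \<le> ((real n)\<^sup>2 - \<theta>\<^sup>2) / ((real n + 1) * (real n + 2))"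
      using q0 by (intro divide_nonneg_nonneg) auto
    moreover have "0 \<le> sin_arcsin_coeff \<theta> n \<and> sin_arcsin_coeff \<theta> n \<le> 1"
      by (rule "3.IH"[OF "3.prems"])
    ultimately show ?thesis
      unfolding sin_arcsin_coeff.simps by (blast intro: mult_nonneg_nonneg mult_le_one)
  qed
qed auto

lemma sums_tail_le:
  fixes f g :: "nat \<Rightarrow> real"
  assumes "f sums s" "g sums t" "\<And>n. \<bar>f n\<bar> \<le> g n"
  shows "\<bar>s - (\<Sum>n<N. f n)\<bar> \<le> t - (\<Sum>n<N. g n)"
proof -
  have f: "(\<lambda>n. f (n + N)) sums (s - (\<Sum>n<N. f n))" by (rule sums_split_initial_segment[OF assms(1)])
  have g: "(\<lambda>n. g (n + N)) sums (t - (\<Sum>n<N. g n))" by (rule sums_split_initial_segment[OF assms(2)])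
  have "s - (\<Sum>n<N. f n) \<le> t - (\<Sum>n<N. g n)"
    by (rule sums_le[OF _ f g]) (use assms(3) abs_le_D1 in blast)
  moreover have "- (s - (\<Sum>n<N. f n)) \<le> t - (\<Sum>n<N. g n)"
    by (rule sums_le[OF _ sums_minus[OF f] g]) (use assms(3) abs_le_D2 in blast)
  ultimately show ?thesis by linarith
qed

lemma abs_sin_less_1: "\<bar>x\<bar> < pi / 2 \<Longrightarrow> \<bar>sin x\<bar> < (1 :: real)"
proof -
  assume "\<bar>x\<bar> < pi / 2"
  then have "0 < cos x" by (intro cos_gt_zero_pi) auto
  then have "0 < (cos x)\<^sup>2" by simp
  then have "(sin x)\<^sup>2 < 1" using sin_cos_squared_add[of x] by linarith
  then show ?thesis by (simp add: abs_square_less_1)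
qed

section \<open>The series of sin (\<theta> arcsin v) and its differential equation\<close>

locale sin_arcsin_series =
  fixes \<theta> :: real
  assumes \<theta>: "0 < \<theta>" "\<theta> \<le> 1"
begin

abbreviation "c \<equiv> sin_arcsin_coeff \<theta>"

definition P where "P v = (\<Sum>n. c n * v ^ n)"
definition P1 where "P1 v = (\<Sum>n. diffs c n * v ^ n)"
definition P2 where "P2 v = (\<Sum>n. diffs (diffs c) n * v ^ n)"

lemma c_bounds: "0 \<le> c n" "c n \<le> 1"
  using sin_arcsin_coeff_bounds[of \<theta> n] \<theta> by auto

lemma summable_c:
  assumes "\<bar>v :: real\<bar> < 1"
  shows "summable (\<lambda>n. c n * v ^ n)"
proof (rule summable_comparison_test'[where N=0])
  show "summable (\<lambda>n. \<bar>v\<bar> ^ n)" using assms by (simp add: summable_geometric)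
  show "norm (c n * v ^ n) \<le> \<bar>v\<bar> ^ n" for n
    using c_bounds[of n] by (simp add: abs_mult power_abs mult_left_le_one_le)
qed

lemma summable_diffs_c:
  assumes "\<bar>v :: real\<bar> < 1"
  shows "summable (\<lambda>n. diffs c n * v ^ n)"
  by (rule termdiff_converges[where K=1]) (use assms summable_c in auto)

lemma summable_diffs2_c:
  assumes "\<bar>v :: real\<bar> < 1"
  shows "summable (\<lambda>n. diffs (diffs c) n * v ^ n)"
  by (rule termdiff_converges[where K=1]) (use assms summable_diffs_c in auto)

lemma sums_P: "\<bar>v :: real\<bar> < 1 \<Longrightarrow> (\<lambda>n. c n * v ^ n) sums P v"
  unfolding P_def by (rule summable_sums[OF summable_c])

lemma sums_P1: "\<bar>v :: real\<bar> < 1 \<Longrightarrow> (\<lambda>n. real n * c n * v ^ (n - 1)) sums P1 v"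
  unfolding P1_def using diffs_equiv[OF summable_diffs_c] by simp

lemma sums_P2:
  assumes "\<bar>v :: real\<bar> < 1"
  shows "(\<lambda>n. real n * real (n - 1) * c n * v ^ (n - 2)) sums P2 v"
proof -
  have "(\<lambda>n. real n * diffs c n * v ^ (n - 1)) sums P2 v"
    unfolding P2_def using diffs_equiv[OF summable_diffs2_c[OF assms]] by simp
  then have "(\<lambda>n. real (Suc n) * real (Suc n - 1) * c (Suc n) * v ^ (Suc n - 2)) sums P2 v"
    by (simp add: diffs_def mult_ac)
  from this[THEN sums_Suc[where f="\<lambda>n. real n * real (n - 1) * c n * v ^ (n - 2)"]] show ?thesis by simp
qed

text \<open>The recursion read as a formula for the second formal derivative. It expands
  \<open>P2\<close> in unshifted powers of \<open>v\<close>, and comparing this with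
  \<open>sums_P2\<close> yields the differential equation.\<close>

lemma sums_P2': "\<bar>v :: real\<bar> < 1 \<Longrightarrow> (\<lambda>n. ((real n)\<^sup>2 - \<theta>\<^sup>2) * c n * v ^ n) sums P2 v"
proof -
  assume v: "\<bar>v\<bar> < 1"
  have "diffs (diffs c) n = ((real n)\<^sup>2 - \<theta>\<^sup>2) * c n" for n
  proof -
    have "(real n + 1) * (real n + 2) \<noteq> 0" by (simp add: add_nonneg_eq_0_iff)
    then show ?thesis by (simp add: diffs_def add.commute)
  qed
  then show ?thesis unfolding P2_def using summable_sums[OF summable_diffs2_c[OF v]] by simp
qed

lemma P_ode:
  assumes v: "\<bar>v :: real\<bar> < 1"
  shows "(1 - v\<^sup>2) * P2 v - v * P1 v + \<theta>\<^sup>2 * P v = 0"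
proof -
  have "(\<lambda>n. v\<^sup>2 * (real n * real (n - 1) * c n * v ^ (n - 2)) + v * (real n * c n * v ^ (n - 1))
      - \<theta>\<^sup>2 * (c n * v ^ n)) sums (v\<^sup>2 * P2 v + v * P1 v - \<theta>\<^sup>2 * P v)"
    by (intro sums_diff sums_add sums_mult sums_P sums_P1 sums_P2 v)
  moreover have "v\<^sup>2 * (real n * real (n - 1) * c n * v ^ (n - 2)) + v * (real n * c n * v ^ (n - 1))
      - \<theta>\<^sup>2 * (c n * v ^ n) = ((real n)\<^sup>2 - \<theta>\<^sup>2) * c n * v ^ n" for n
  proof -
    \<comment> \<open>The exponents \<open>n - 1\<close> and \<open>n - 2\<close> are truncated for
      small \<open>n\<close>; there the factors n and n (n - 1) vanish instead.\<close>
    consider "n = 0" | "n = 1" | k where "n = Suc (Suc k)" by (metis One_nat_def not0_implies_Suc)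
    then show ?thesis by cases (simp_all add: algebra_simps power2_eq_square del: sin_arcsin_coeff.simps(3))
  qed
  ultimately have "v\<^sup>2 * P2 v + v * P1 v - \<theta>\<^sup>2 * P v = P2 v"
    using sums_unique2 sums_P2'[OF v] by simp
  then show ?thesis by (simp add: algebra_simps)
qed

lemma DERIV_P: "\<bar>v :: real\<bar> < 1 \<Longrightarrow> (P has_real_derivative P1 v) (at v)"
  unfolding P_def[abs_def] P1_def
  by (rule termdiffs_strong'[where K=1]) (use summable_c in auto)

lemma DERIV_P1: "\<bar>v :: real\<bar> < 1 \<Longrightarrow> (P1 has_real_derivative P2 v) (at v)"
  unfolding P1_def[abs_def] P2_def
  by (rule termdiffs_strong'[where K=1]) (use summable_diffs_c in auto)

text \<open>The substitution v = sin x turns the equation into y'' = - \<theta>^2 y, which sin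
  (\<theta> x) solves with the same initial data. \<open>E\<close> is the energy of the difference
  of the two solutions; it is conserved and vanishes at 0.\<close>

lemma P_sin:
  assumes x: "\<bar>x\<bar> < pi / 2"
  shows "P (sin x) = sin (\<theta> * x)" "P1 (sin x) * cos x = \<theta> * cos (\<theta> * x)"
    "P2 (sin x) * (cos x)\<^sup>2 - P1 (sin x) * sin x = - (\<theta>\<^sup>2) * sin (\<theta> * x)"
proof -
  define E where "E t = (P1 (sin t) * cos t - \<theta> * cos (\<theta> * t))\<^sup>2 + \<theta>\<^sup>2 * (P (sin t) - sin (\<theta> * t))\<^sup>2" for t
  have ode: "P2 (sin t) * (cos t)\<^sup>2 - P1 (sin t) * sin t = - (\<theta>\<^sup>2) * P (sin t)" if "\<bar>t\<bar> < pi / 2" for t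
  proof -
    have "(cos t)\<^sup>2 = 1 - (sin t)\<^sup>2" by (rule cos_squared_eq)
    then show ?thesis using P_ode[OF abs_sin_less_1[OF that]]
      by (simp only:) (simp add: algebra_simps)
  qed
  have dE: "(E has_real_derivative 0) (at t)" if t: "\<bar>t\<bar> < pi / 2" for t
  proof -
    note s = abs_sin_less_1[OF t]
    have dP: "((\<lambda>t. P (sin t)) has_real_derivative P1 (sin t) * cos t) (at t)"
      by (rule DERIV_chain2[OF _ DERIV_sin]) (rule DERIV_P[OF s])
    have dP1: "((\<lambda>t. P1 (sin t)) has_real_derivative P2 (sin t) * cos t) (at t)"
      by (rule DERIV_chain2[OF _ DERIV_sin]) (rule DERIV_P1[OF s])
    have d0: "((\<lambda>t. P (sin t) - sin (\<theta> * t)) has_real_derivative P1 (sin t) * cos t - \<theta> * cos (\<theta> * t)) (at t)"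
      by (intro DERIV_diff dP) (auto intro!: derivative_eq_intros)
    have "((\<lambda>t. P1 (sin t) * cos t - \<theta> * cos (\<theta> * t)) has_real_derivative
        (P2 (sin t) * cos t) * cos t + P1 (sin t) * (- sin t) - \<theta> * (- sin (\<theta> * t) * \<theta>)) (at t)"
      by (auto intro!: derivative_eq_intros dP1)
    moreover have "(P2 (sin t) * cos t) * cos t + P1 (sin t) * (- sin t) - \<theta> * (- sin (\<theta> * t) * \<theta>)
        = - (\<theta>\<^sup>2) * (P (sin t) - sin (\<theta> * t))"
      using ode[OF t] by (simp add: algebra_simps power2_eq_square)
    ultimately have d1: "((\<lambda>t. P1 (sin t) * cos t - \<theta> * cos (\<theta> * t)) has_real_derivative
        - (\<theta>\<^sup>2) * (P (sin t) - sin (\<theta> * t))) (at t)" by simp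
    have D: "(E has_real_derivative
        2 * (P1 (sin t) * cos t - \<theta> * cos (\<theta> * t)) * (- (\<theta>\<^sup>2) * (P (sin t) - sin (\<theta> * t)))
        + \<theta>\<^sup>2 * (2 * (P (sin t) - sin (\<theta> * t)) * (P1 (sin t) * cos t - \<theta> * cos (\<theta> * t)))) (at t)"
      unfolding E_def[abs_def] power2_eq_square[of "_ - _"]
      using DERIV_add[OF DERIV_mult[OF d1 d1] DERIV_cmult[OF DERIV_mult[OF d0 d0], of "\<theta>\<^sup>2"]]
      by (simp add: algebra_simps)
    have Z: "2 * (P1 (sin t) * cos t - \<theta> * cos (\<theta> * t)) * (- (\<theta>\<^sup>2) * (P (sin t) - sin (\<theta> * t)))
        + \<theta>\<^sup>2 * (2 * (P (sin t) - sin (\<theta> * t)) * (P1 (sin t) * cos t - \<theta> * cos (\<theta> * t))) = 0"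
      by (simp add: algebra_simps)
    show ?thesis using D unfolding Z .
  qed
  have "P 0 = 0" unfolding P_def using sums_unique[OF powser_sums_zero[of c]] by simp
  moreover have "P1 0 = \<theta>" unfolding P1_def using sums_unique[OF powser_sums_zero[of "diffs c"]] by (simp add: diffs_def)
  ultimately have E0: "E 0 = 0" by (simp add: E_def)
  have "E x = E 0"
    by (rule DERIV_isconst3[of "- (pi / 2)" "pi / 2"]) (use x dE in \<open>auto simp: abs_less_iff\<close>)
  then have "E x = 0" using E0 by simp
  then have "P1 (sin x) * cos x - \<theta> * cos (\<theta> * x) = 0 \<and> \<theta>\<^sup>2 * (P (sin x) - sin (\<theta> * x))\<^sup>2 = 0"
    unfolding E_def by (subst (asm) add_nonneg_eq_0_iff) auto
  then show 1: "P (sin x) = sin (\<theta> * x)" and "P1 (sin x) * cos x = \<theta> * cos (\<theta> * x)"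
    using \<theta> by auto
  show "P2 (sin x) * (cos x)\<^sup>2 - P1 (sin x) * sin x = - (\<theta>\<^sup>2) * sin (\<theta> * x)"
    using ode[OF x] 1 by simp
qed

text \<open>For 0 \<le> q < 1 nonnegativity bounds the weighted partial sum by \<open>P q\<close>,
  that is sin (\<theta> arcsin q) \<le> \<theta> pi / 2. A partial sum is a polynomial in
  \<open>q\<close>, so \<open>q\<close> may tend to 1.\<close>

lemma sum_c_le: "(\<Sum>n<N. c n) \<le> \<theta> * (pi / 2)"
proof -
  let ?r = "\<lambda>k. 1 - 1 / real (Suc (Suc k))"
  have bound: "(\<Sum>n<N. c n * q ^ n) \<le> \<theta> * (pi / 2)" if q: "0 \<le> q" "q < 1" for q
  proof -
    define t where "t = arcsin q"
    have t: "sin t = q" "- (pi / 2) < t" "t < pi / 2" "0 \<le> t"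
      using q arcsin_lt_bounded[of q] arcsin_nonneg[of q] by (auto simp: t_def)
    have "(\<Sum>n<N. c n * q ^ n) \<le> P q"
      unfolding P_def by (rule sum_le_suminf[OF summable_c]) (use q c_bounds in auto)
    also have "\<dots> = sin (\<theta> * t)" using P_sin(1)[of t] t by (simp add: abs_less_iff)
    also have "\<dots> \<le> \<theta> * t" using sin_x_le_x[of "\<theta> * t"] \<theta> t by simp
    also have "\<dots> \<le> \<theta> * (pi / 2)" using t \<theta> by (intro mult_left_mono) auto
    finally show ?thesis .
  qed
  have le: "(\<Sum>n<N. c n * ?r k ^ n) \<le> \<theta> * (pi / 2)" for k
    by (rule bound) (simp_all add: field_simps)
  have "(\<lambda>k. 1 / real (Suc k)) \<longlonglongrightarrow> 0"
    using LIMSEQ_inverse_real_of_nat by (simp add: inverse_eq_divide)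
  then have "(\<lambda>k. 1 / real (Suc (Suc k))) \<longlonglongrightarrow> 0" by (rule LIMSEQ_Suc)
  then have "(\<lambda>k. \<Sum>n<N. c n * ?r k ^ n) \<longlonglongrightarrow> (\<Sum>n<N. c n * (1 - 0) ^ n)"
    by (intro tendsto_sum tendsto_mult tendsto_power tendsto_diff tendsto_const)
  then have "(\<Sum>n<N. c n * (1 - 0) ^ n) \<le> \<theta> * (pi / 2)"
    by (rule LIMSEQ_le_const2) (use le in blast)
  then show ?thesis by simp
qed

section \<open>The truncation error with its first two derivatives\<close>

definition remainder where
  "remainder N x = sin (\<theta> * x) - (\<Sum>n<N. c n * sin x ^ n)"
definition remainder1 where
  "remainder1 N x = \<theta> * cos (\<theta> * x) - (\<Sum>n<N. real n * c n * sin x ^ (n - 1)) * cos x"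
definition remainder2 where
  "remainder2 N x = - (\<theta>\<^sup>2) * sin (\<theta> * x)
     - ((\<Sum>n<N. real n * real (n - 1) * c n * sin x ^ (n - 2)) * (cos x)\<^sup>2
        - (\<Sum>n<N. real n * c n * sin x ^ (n - 1)) * sin x)"

lemma DERIV_remainder: "(remainder N has_real_derivative remainder1 N x) (at x)"
proof -
  have "((\<lambda>x. \<Sum>n<N. c n * sin x ^ n) has_real_derivative
      (\<Sum>n<N. c n * (real n * (cos x * sin x ^ (n - 1))))) (at x)"
    by (intro DERIV_sum DERIV_cmult) (auto intro!: derivative_eq_intros)
  moreover have "(\<Sum>n<N. c n * (real n * (cos x * sin x ^ (n - 1)))) = (\<Sum>n<N. real n * c n * sin x ^ (n - 1)) * cos x"
    unfolding sum_distrib_right by (intro sum.cong) auto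
  moreover have "((\<lambda>x. sin (\<theta> * x)) has_real_derivative \<theta> * cos (\<theta> * x)) (at x)"
    by (auto intro!: derivative_eq_intros)
  ultimately show ?thesis
    unfolding remainder_def[abs_def] remainder1_def by (simp add: DERIV_diff)
qed

lemma DERIV_remainder1: "(remainder1 N has_real_derivative remainder2 N x) (at x)"
proof -
  have s: "((\<lambda>x. \<Sum>n<N. real n * c n * sin x ^ (n - 1)) has_real_derivative
      (\<Sum>n<N. real n * c n * (real (n - 1) * (cos x * sin x ^ (n - 1 - 1))))) (at x)"
    by (intro DERIV_sum DERIV_cmult) (auto intro!: derivative_eq_intros)
  have e: "(\<Sum>n<N. real n * c n * (real (n - 1) * (cos x * sin x ^ (n - 1 - 1))))
      = (\<Sum>n<N. real n * real (n - 1) * c n * sin x ^ (n - 2)) * cos x"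
    unfolding sum_distrib_right by (intro sum.cong) (auto simp: numeral_2_eq_2)
  have "((\<lambda>x. \<theta> * cos (\<theta> * x)) has_real_derivative - (\<theta>\<^sup>2) * sin (\<theta> * x)) (at x)"
    by (auto intro!: derivative_eq_intros simp: power2_eq_square)
  from DERIV_diff[OF this DERIV_mult[OF s[unfolded e] DERIV_cos]]
  show ?thesis unfolding remainder1_def[abs_def] remainder2_def
    by (simp add: algebra_simps power2_eq_square)
qed

lemma continuous_remainder2: "continuous_on UNIV (remainder2 N)"
  unfolding remainder2_def[abs_def] by (intro continuous_intros)

text \<open>With nonnegative coefficients, the tails at sin x are dominated by those at sin \<rho> <
  1, for the series and for both differentiated series. The chain rule adds only factors sin x and
  cos x, so the sum of the three tails serves as a common bound.\<close>

lemma remainder_bounds: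
  assumes r: "0 \<le> \<rho>" "\<rho> < pi / 2"
  obtains A where "A \<longlonglongrightarrow> 0" "\<And>N x. \<bar>x\<bar> \<le> \<rho> \<Longrightarrow> \<bar>remainder N x\<bar> \<le> A N"
    "\<And>N x. \<bar>x\<bar> \<le> \<rho> \<Longrightarrow> \<bar>remainder1 N x\<bar> \<le> A N" "\<And>N x. \<bar>x\<bar> \<le> \<rho> \<Longrightarrow> \<bar>remainder2 N x\<bar> \<le> A N"
proof -
  define v where "v = sin \<rho>"
  have v: "0 \<le> v" "v < 1"
    using r abs_sin_less_1[of \<rho>] pi_gt_zero unfolding v_def by (auto intro!: sin_ge_zero)
  then have av: "\<bar>v\<bar> < 1" by simp
  define A0 where "A0 N = P v - (\<Sum>n<N. c n * v ^ n)" for N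
  define A1 where "A1 N = P1 v - (\<Sum>n<N. real n * c n * v ^ (n - 1))" for N
  define A2 where "A2 N = P2 v - (\<Sum>n<N. real n * real (n - 1) * c n * v ^ (n - 2))" for N
  have "(\<lambda>N. A0 N + A1 N + A2 N) \<longlonglongrightarrow> (P v - P v) + (P1 v - P1 v) + (P2 v - P2 v)"
    unfolding A0_def A1_def A2_def
    by (intro tendsto_add tendsto_diff tendsto_const sums_P[OF av, unfolded sums_def]
        sums_P1[OF av, unfolded sums_def] sums_P2[OF av, unfolded sums_def])
  then have lim: "(\<lambda>N. A0 N + A1 N + A2 N) \<longlonglongrightarrow> 0" by simp
  have sv: "\<bar>sin x\<bar> \<le> v" if "\<bar>x\<bar> \<le> \<rho>" for x
  proof -
    have "sin x \<le> sin \<rho>" "sin (- \<rho>) \<le> sin x"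
      by (rule sin_monotone_2pi_le; use that r in linarith)+
    then show ?thesis by (simp add: v_def abs_le_iff)
  qed
  have pw: "\<bar>sin x ^ k\<bar> \<le> v ^ k" if "\<bar>x\<bar> \<le> \<rho>" for x k
    unfolding power_abs using sv[OF that] by (intro power_mono) auto
  have B: "\<bar>P (sin x) - (\<Sum>n<N. c n * sin x ^ n)\<bar> \<le> A0 N"
    "\<bar>P1 (sin x) - (\<Sum>n<N. real n * c n * sin x ^ (n - 1))\<bar> \<le> A1 N"
    "\<bar>P2 (sin x) - (\<Sum>n<N. real n * real (n - 1) * c n * sin x ^ (n - 2))\<bar> \<le> A2 N"
    if x: "\<bar>x\<bar> \<le> \<rho>" for x N
  proof -
    have s: "\<bar>sin x\<bar> < 1" using sv[OF x] v by linarith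
    show "\<bar>P (sin x) - (\<Sum>n<N. c n * sin x ^ n)\<bar> \<le> A0 N"
      unfolding A0_def by (rule sums_tail_le[OF sums_P[OF s] sums_P[OF av]])
        (use pw[OF x] c_bounds in \<open>auto simp: abs_mult intro!: mult_left_mono\<close>)
    show "\<bar>P1 (sin x) - (\<Sum>n<N. real n * c n * sin x ^ (n - 1))\<bar> \<le> A1 N"
      unfolding A1_def by (rule sums_tail_le[OF sums_P1[OF s] sums_P1[OF av]])
        (use pw[OF x] c_bounds in \<open>auto simp: abs_mult intro!: mult_left_mono\<close>)
    show "\<bar>P2 (sin x) - (\<Sum>n<N. real n * real (n - 1) * c n * sin x ^ (n - 2))\<bar> \<le> A2 N"
      unfolding A2_def by (rule sums_tail_le[OF sums_P2[OF s] sums_P2[OF av]])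
        (use pw[OF x] c_bounds in \<open>auto simp: abs_mult intro!: mult_left_mono\<close>)
  qed
  have A: "0 \<le> A0 N" "0 \<le> A1 N" "0 \<le> A2 N" for N
    using order_trans[OF abs_ge_zero B(1)[of 0 N]] order_trans[OF abs_ge_zero B(2)[of 0 N]]
      order_trans[OF abs_ge_zero B(3)[of 0 N]] r by simp_all
  show ?thesis
  proof (rule that[OF lim])
    fix N x assume x: "\<bar>x\<bar> \<le> \<rho>"
    then have xp: "\<bar>x\<bar> < pi / 2" using r by simp
    note p = P_sin[OF xp] and b = B[OF x, of N] and a = A[of N]
    show "\<bar>remainder N x\<bar> \<le> A0 N + A1 N + A2 N"
      unfolding remainder_def p(1)[symmetric] using a b(1) by linarith
    have c1: "\<bar>u * cos x\<bar> \<le> \<bar>u\<bar>" "\<bar>u * sin x\<bar> \<le> \<bar>u\<bar>" for u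
      by (simp_all add: abs_mult mult_left_le)
    show "\<bar>remainder1 N x\<bar> \<le> A0 N + A1 N + A2 N"
      unfolding remainder1_def p(2)[symmetric] left_diff_distrib[symmetric]
      using a b(2) order_trans[OF c1(1)] by (smt (verit))
    have "remainder2 N x = (P2 (sin x) - (\<Sum>n<N. real n * real (n - 1) * c n * sin x ^ (n - 2))) * cos x * cos x
        - (P1 (sin x) - (\<Sum>n<N. real n * c n * sin x ^ (n - 1))) * sin x"
      unfolding remainder2_def p(3)[symmetric] by (simp add: algebra_simps power2_eq_square)
    also have "\<bar>\<dots>\<bar> \<le> A2 N + A1 N"
    proof -
      let ?u = "P2 (sin x) - (\<Sum>n<N. real n * real (n - 1) * c n * sin x ^ (n - 2))"
      let ?w = "P1 (sin x) - (\<Sum>n<N. real n * c n * sin x ^ (n - 1))"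
      have "\<bar>?u * cos x * cos x\<bar> \<le> A2 N"
        using c1(1)[of "?u * cos x"] c1(1)[of ?u] b(3) by linarith
      moreover have "\<bar>?w * sin x\<bar> \<le> A1 N" using c1(2)[of ?w] b(2) by linarith
      ultimately show ?thesis by linarith
    qed
    finally show "\<bar>remainder2 N x\<bar> \<le> A0 N + A1 N + A2 N" using a(1) by linarith
  qed
qed

end

lemma C2_derivs_of_real_affine:
  assumes "\<And>x. (g has_real_derivative g1 x) (at x)" "\<And>x. (g1 has_real_derivative g2 x) (at x)"
    "continuous_on UNIV g2"
  shows "C2_derivs (\<lambda>x. complex_of_real (g (\<tau> * (x - c)))) (\<lambda>x. complex_of_real (\<tau> * g1 (\<tau> * (x - c))))
    (\<lambda>x. complex_of_real (\<tau> * (\<tau> * g2 (\<tau> * (x - c)))))"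
proof -
  have a: "((\<lambda>x. \<tau> * (x - c)) has_real_derivative \<tau>) (at x)" for x
    by (auto intro!: derivative_eq_intros)
  have d: "((\<lambda>x. complex_of_real (k * h (\<tau> * (x - c)))) has_vector_derivative
      complex_of_real (k * (\<tau> * h' (\<tau> * (x - c))))) (at x)"
    if "\<And>x. (h has_real_derivative h' x) (at x)" for h h' k x
  proof -
    have "((\<lambda>x. k * h (\<tau> * (x - c))) has_real_derivative k * (\<tau> * h' (\<tau> * (x - c)))) (at x)"
      using DERIV_cmult[OF DERIV_chain2[OF that a], of k] by (simp add: mult.commute)
    then have "((\<lambda>x. k * h (\<tau> * (x - c))) has_vector_derivative k * (\<tau> * h' (\<tau> * (x - c)))) (at x)"
      by (simp add: has_real_derivative_iff_has_vector_derivative)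
    from bounded_linear.has_vector_derivative[OF bounded_linear_of_real this] show ?thesis .
  qed
  have "continuous_on UNIV (\<lambda>x. complex_of_real (\<tau> * (\<tau> * g2 (\<tau> * (x - c)))))"
    by (intro continuous_intros continuous_on_compose2[OF assms(3)]) auto
  then show ?thesis
    unfolding C2_derivs_def using d[OF assms(1), of 1] d[OF assms(2), of \<tau>] by simp
qed

lemma C2_derivs_sin:
  obtains s1 s2 where "C2_derivs (\<lambda>x. complex_of_real (sin (\<tau> * (x - c)))) s1 s2"
proof -
  have "C2_derivs (\<lambda>x. complex_of_real (sin (\<tau> * (x - c)))) (\<lambda>x. complex_of_real (\<tau> * cos (\<tau> * (x - c))))
    (\<lambda>x. complex_of_real (\<tau> * (\<tau> * - sin (\<tau> * (x - c)))))"
    by (rule C2_derivs_of_real_affine) (auto intro!: derivative_eq_intros continuous_intros)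
  then show ?thesis by (rule that)
qed

lemma sin_eq_cis: "complex_of_real (sin (\<tau> * (x - c)))
    = (- \<i> / 2 * cis (- (\<tau> * c))) * cis (\<tau> * x) + (\<i> / 2 * cis (\<tau> * c)) * cis (- \<tau> * x)"
proof -
  have "- \<i> / 2 * (cis u - cis (- u)) = complex_of_real (sin u)" for u
    by (simp add: complex_eq_iff)
  from this[of "\<tau> * (x - c)"] show ?thesis
    by (simp add: algebra_simps cis_mult)
qed

context isometric_representation
begin

lemma multiplier_sin:
  assumes p: "test_fun a b N p"
  shows "multiplier (\<lambda>x. complex_of_real (sin (\<tau> * (x - c))) * p x) y
    = (- \<i> / 2 * cis (- (\<tau> * c))) *\<^sub>C blinfun_apply (T \<tau>) (multiplier p y)
      + (\<i> / 2 * cis (\<tau> * c)) *\<^sub>C blinfun_apply (T (- \<tau>)) (multiplier p y)"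
proof -
  let ?A = "- \<i> / 2 * cis (- (\<tau> * c))" and ?B = "\<i> / 2 * cis (\<tau> * c)"
  obtain N1 where 1: "test_fun a b N1 (\<lambda>x. cis (\<tau> * x) * p x)" using test_fun_cis_mult[OF p] .
  obtain N2 where 2: "test_fun a b N2 (\<lambda>x. cis (- \<tau> * x) * p x)" using test_fun_cis_mult[OF p] .
  have "(\<lambda>x. complex_of_real (sin (\<tau> * (x - c))) * p x)
      = (\<lambda>x. ?A * (cis (\<tau> * x) * p x) + ?B * (cis (- \<tau> * x) * p x))"
    unfolding sin_eq_cis by (simp only: distrib_right mult.assoc)
  then show ?thesis
    using multiplier_add[OF test_fun_cmult[OF 1, of ?A] test_fun_cmult[OF 2, of ?B]]
      multiplier_cmult[OF 1, of ?A] multiplier_cmult[OF 2, of ?B] multiplier_cis[OF p]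
    by (simp only:)
qed

lemma norm_multiplier_sin_le:
  assumes p: "test_fun a b N p"
  shows "norm (multiplier (\<lambda>x. complex_of_real (sin (\<tau> * (x - c))) * p x) y) \<le> norm (multiplier p y)"
proof -
  have "norm ((- \<i> / 2 * cis (- (\<tau> * c))) *\<^sub>C blinfun_apply (T \<tau>) (multiplier p y)
      + (\<i> / 2 * cis (\<tau> * c)) *\<^sub>C blinfun_apply (T (- \<tau>)) (multiplier p y))
    \<le> norm ((- \<i> / 2 * cis (- (\<tau> * c))) *\<^sub>C blinfun_apply (T \<tau>) (multiplier p y))
      + norm ((\<i> / 2 * cis (\<tau> * c)) *\<^sub>C blinfun_apply (T (- \<tau>)) (multiplier p y))"
    by (rule norm_triangle_ineq)
  also have "\<dots> = norm (multiplier p y)" by (simp add: norm_scaleC norm_mult)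
  finally show ?thesis unfolding multiplier_sin[OF p] .
qed

text \<open>Each further sine is applied to the symbol of the previous step, so the induction has to
  carry along that this is again a test function.\<close>

lemma norm_multiplier_sin_power_le:
  assumes p: "test_fun a b N p"
  shows "(\<exists>N'. test_fun a b N' (\<lambda>x. complex_of_real (sin (\<tau> * (x - c)) ^ n) * p x)) \<and>
    norm (multiplier (\<lambda>x. complex_of_real (sin (\<tau> * (x - c)) ^ n) * p x) y) \<le> norm (multiplier p y)"
proof (induction n)
  case 0
  then show ?case using p by auto
next
  case (Suc n)
  then obtain N' where N': "test_fun a b N' (\<lambda>x. complex_of_real (sin (\<tau> * (x - c)) ^ n) * p x)" by blast
  have eq: "(\<lambda>x. complex_of_real (sin (\<tau> * (x - c)) ^ Suc n) * p x)
      = (\<lambda>x. complex_of_real (sin (\<tau> * (x - c))) * (complex_of_real (sin (\<tau> * (x - c)) ^ n) * p x))"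
    by (simp add: mult.assoc)
  obtain s1 s2 where s: "C2_derivs (\<lambda>x. complex_of_real (sin (\<tau> * (x - c)))) s1 s2" using C2_derivs_sin .
  obtain N'' where "test_fun a b N'' (\<lambda>x. complex_of_real (sin (\<tau> * (x - c)) ^ Suc n) * p x)"
    unfolding eq using test_fun_mult_exists[OF N' s] .
  moreover have "norm (multiplier (\<lambda>x. complex_of_real (sin (\<tau> * (x - c)) ^ Suc n) * p x) y) \<le> norm (multiplier p y)"
    unfolding eq using norm_multiplier_sin_le[OF N', of \<tau> c y] Suc.IH by linarith
  ultimately show ?case by blast
qed

lemma norm_multiplier_sin_polynomial_le:
  assumes p: "test_fun a b N p"
  shows "(\<exists>N'. test_fun a b N' (\<lambda>x. complex_of_real (\<Sum>n<m. k n * sin (\<tau> * (x - c)) ^ n) * p x)) \<and>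
    norm (multiplier (\<lambda>x. complex_of_real (\<Sum>n<m. k n * sin (\<tau> * (x - c)) ^ n) * p x) y)
      \<le> (\<Sum>n<m. \<bar>k n\<bar>) * norm (multiplier p y)"
proof (induction m)
  case 0
  have "test_fun a b (norm (0 :: complex) * N) (\<lambda>x. 0 * p x)" by (rule test_fun_cmult[OF p])
  then show ?case using multiplier_0[OF p, of "\<lambda>x. 0" y] by auto
next
  case (Suc m)
  let ?q = "\<lambda>x. complex_of_real (\<Sum>n<m. k n * sin (\<tau> * (x - c)) ^ n) * p x"
  let ?r = "\<lambda>x. complex_of_real (sin (\<tau> * (x - c)) ^ m) * p x"
  from Suc obtain N1 where 1: "test_fun a b N1 ?q" by blast
  obtain N2 where 2: "test_fun a b N2 ?r" using norm_multiplier_sin_power_le[OF p] by blast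
  note 3 = test_fun_cmult[OF 2, of "complex_of_real (k m)"]
  have eq: "(\<lambda>x. complex_of_real (\<Sum>n<Suc m. k n * sin (\<tau> * (x - c)) ^ n) * p x)
      = (\<lambda>x. ?q x + complex_of_real (k m) * ?r x)"
    by (simp add: algebra_simps)
  have "norm (multiplier (\<lambda>x. ?q x + complex_of_real (k m) * ?r x) y)
      \<le> norm (multiplier ?q y) + \<bar>k m\<bar> * norm (multiplier ?r y)"
    unfolding multiplier_add[OF 1 3] multiplier_cmult[OF 2]
    by (rule order_trans[OF norm_triangle_ineq]) (simp add: norm_scaleC)
  also have "\<dots> \<le> (\<Sum>n<m. \<bar>k n\<bar>) * norm (multiplier p y) + \<bar>k m\<bar> * norm (multiplier p y)"
    using Suc norm_multiplier_sin_power_le[OF p] by (intro add_mono mult_left_mono) auto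
  also have "\<dots> = (\<Sum>n<Suc m. \<bar>k n\<bar>) * norm (multiplier p y)" by (simp add: algebra_simps)
  finally show ?case unfolding eq using test_fun_add[OF 1 3] by blast
qed

text \<open>A form of Bernstein's inequality: on spectra with \<open>\<bar>\<tau> * (x - c)\<bar> < pi / 2\<close>, the operator
  \<open>sin (\<theta> * \<tau> * (x - c))\<close> is a power series with nonnegative coefficients in the contraction
  \<open>sin (\<tau> * (x - c))\<close>.\<close>

lemma bernstein_sin:
  assumes p: "test_fun a b N p" and \<theta>: "0 < \<theta>" "\<theta> \<le> 1" and \<rho>: "0 \<le> \<rho>" "\<rho> < pi / 2"
    and supp: "\<And>x. a \<le> x \<Longrightarrow> x \<le> b \<Longrightarrow> \<bar>\<tau> * (x - c)\<bar> \<le> \<rho>"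
  shows "norm (multiplier (\<lambda>x. complex_of_real (sin (\<theta> * (\<tau> * (x - c)))) * p x) y)
    \<le> \<theta> * (pi / 2) * norm (multiplier p y)"
proof -
  interpret S: sin_arcsin_series \<theta> by unfold_locales (use \<theta> in auto)
  note ab = test_fun_less[OF p] and N0 = test_fun_nonneg[OF p]
  let ?s = "\<lambda>x. complex_of_real (sin (\<theta> * (\<tau> * (x - c)))) * p x"
  let ?q = "\<lambda>m x. complex_of_real (\<Sum>n<m. S.c n * sin (\<tau> * (x - c)) ^ n) * p x"
  obtain A where A0: "A \<longlonglongrightarrow> 0" and A: "\<And>m x. \<bar>x\<bar> \<le> \<rho> \<Longrightarrow> \<bar>S.remainder m x\<bar> \<le> A m"
    "\<And>m x. \<bar>x\<bar> \<le> \<rho> \<Longrightarrow> \<bar>S.remainder1 m x\<bar> \<le> A m" "\<And>m x. \<bar>x\<bar> \<le> \<rho> \<Longrightarrow> \<bar>S.remainder2 m x\<bar> \<le> A m"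
    using S.remainder_bounds[OF \<rho>] by metis
  \<comment> \<open>The remainder and its first two derivatives in \<open>x\<close> are at most
    \<open>A m\<close>, |\<tau>| \<open>A m\<close> and \<tau>^2 \<open>A m\<close>;
    \<open>K\<close> is what \<open>test_fun_mult\<close> leaves after \<open>A m\<close> is
    factored out.\<close>
  define K where "K = (1 + 2 * \<bar>\<tau>\<bar> * (b - a) + \<tau>\<^sup>2 * (b - a)\<^sup>2) * N"
  have rem: "test_fun a b (A m * K) (\<lambda>x. complex_of_real (S.remainder m (\<tau> * (x - c))) * p x)" for m
  proof -
    have "test_fun a b ((A m + 2 * (\<bar>\<tau>\<bar> * A m) * (b - a) + (\<bar>\<tau>\<bar> * (\<bar>\<tau>\<bar> * A m)) * (b - a)\<^sup>2) * N)
       (\<lambda>x. complex_of_real (S.remainder m (\<tau> * (x - c))) * p x)"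
      by (rule test_fun_mult[OF p C2_derivs_of_real_affine[OF S.DERIV_remainder S.DERIV_remainder1 S.continuous_remainder2]])
         (use A supp in \<open>auto simp: norm_mult intro!: mult_left_mono\<close>)
    moreover have "(A m + 2 * (\<bar>\<tau>\<bar> * A m) * (b - a) + (\<bar>\<tau>\<bar> * (\<bar>\<tau>\<bar> * A m)) * (b - a)\<^sup>2) * N = A m * K"
      unfolding K_def by (simp add: algebra_simps power2_eq_square)
    ultimately show ?thesis by simp
  qed
  obtain s1 s2 where "C2_derivs (\<lambda>x. complex_of_real (sin ((\<theta> * \<tau>) * (x - c)))) s1 s2" using C2_derivs_sin .
  then obtain Ns where s: "test_fun a b Ns ?s"
    using test_fun_mult_exists[OF p] by (metis (no_types, lifting) mult.assoc ext)
  \<comment> \<open>The polynomial part is bounded relative to \<open>multiplier p y\<close>,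
    uniformly in \<open>m\<close>. The remainder is bounded only relative to \<open>y\<close>, by
    the crude kernel estimate, but tends to 0.\<close>
  have bound: "norm (multiplier ?s y) \<le> \<theta> * (pi / 2) * norm (multiplier p y) + kernel_bound a b * norm y * (A m * K)" for m
  proof -
    obtain Nq where q: "test_fun a b Nq (?q m)" using norm_multiplier_sin_polynomial_le[OF p] by blast
    have split: "?s = (\<lambda>x. ?q m x + complex_of_real (S.remainder m (\<tau> * (x - c))) * p x)"
      unfolding S.remainder_def of_real_diff left_diff_distrib by simp
    have "multiplier ?s y = multiplier (?q m) y + multiplier (\<lambda>x. complex_of_real (S.remainder m (\<tau> * (x - c))) * p x) y"
      unfolding split by (rule multiplier_add[OF q rem])
    also have "norm \<dots> \<le> norm (multiplier (?q m) y) + kernel_bound a b * norm y * (A m * K)"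
      by (rule order_trans[OF norm_triangle_ineq add_left_mono[OF norm_multiplier_le[OF rem]]])
    also have "norm (multiplier (?q m) y) \<le> (\<Sum>n<m. \<bar>S.c n\<bar>) * norm (multiplier p y)"
      using norm_multiplier_sin_polynomial_le[OF p] by blast
    also have "(\<Sum>n<m. \<bar>S.c n\<bar>) = (\<Sum>n<m. S.c n)" using S.c_bounds by simp
    also have "(\<Sum>n<m. S.c n) * norm (multiplier p y) \<le> \<theta> * (pi / 2) * norm (multiplier p y)"
      by (intro mult_right_mono S.sum_c_le) simp
    finally show ?thesis by simp
  qed
  have "(\<lambda>m. \<theta> * (pi / 2) * norm (multiplier p y) + kernel_bound a b * norm y * (A m * K))
      \<longlonglongrightarrow> \<theta> * (pi / 2) * norm (multiplier p y) + kernel_bound a b * norm y * (0 * K)"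
    by (intro tendsto_intros A0)
  then have "norm (multiplier ?s y) \<le> \<theta> * (pi / 2) * norm (multiplier p y) + kernel_bound a b * norm y * (0 * K)"
    by (rule LIMSEQ_le_const) (use bound in blast)
  then show ?thesis by simp
qed

text \<open>With c = \<gamma> / 2, the symbol cis (t x) - cis (t c) equals 2 i cis (t c / 2) cis (t
  x / 2) sin (t (x - c) / 2). The middle character acts as the isometry T (t / 2), so only the sine
  has to be estimated.\<close>

lemma norm_T_diff_multiplier_le:
  assumes \<gamma>: "0 < \<gamma>" and e: "0 < e" "e \<le> \<gamma> / 4" and t: "0 < t" "t \<le> pi / (2 * \<gamma>)"
    and p: "test_fun (- e) (\<gamma> + e) N p"
  shows "norm (blinfun_apply (T t) (multiplier p y) - multiplier p y) \<le> t * (\<gamma> + 2 * e) * norm (multiplier p y)"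
proof -
  \<comment> \<open>\<tau> sends the enlarged half-width \<alpha> to pi / 2, and \<theta> \<tau> = t
    / 2 is the frequency in the half-angle formula. The condition on \<open>e\<close> gives \<alpha>
    \<le> \<gamma>, and then the range of \<open>t\<close> gives \<theta> \<le> 1.\<close>
  define \<alpha> where "\<alpha> = \<gamma> / 2 + 2 * e"
  define \<tau> where "\<tau> = pi / (2 * \<alpha>)"
  define \<theta> where "\<theta> = t * \<alpha> / pi"
  define z where "z = multiplier p y"
  let ?c = "\<gamma> / 2"
  have \<alpha>: "0 < \<alpha>" "\<alpha> \<le> \<gamma>" using \<gamma> e by (auto simp: \<alpha>_def)
  have \<tau>: "0 < \<tau>" using \<alpha> by (simp add: \<tau>_def)
  have \<theta>\<tau>: "\<theta> * \<tau> = t / 2" using \<alpha> by (simp add: \<theta>_def \<tau>_def)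
  have "t * \<alpha> \<le> pi / (2 * \<gamma>) * \<gamma>" using t \<alpha> \<gamma> by (intro mult_mono) auto
  also have "\<dots> \<le> pi" using \<gamma> by simp
  finally have \<theta>: "0 < \<theta>" "\<theta> \<le> 1" using t \<alpha> by (auto simp: \<theta>_def divide_le_eq)
  have "\<tau> * (\<gamma> / 2 + e) < \<tau> * \<alpha>" using \<tau> e by (intro mult_strict_left_mono) (auto simp: \<alpha>_def)
  also have "\<dots> = pi / 2" using \<alpha> by (simp add: \<tau>_def)
  finally have \<rho>: "0 \<le> \<tau> * (\<gamma> / 2 + e)" "\<tau> * (\<gamma> / 2 + e) < pi / 2" using \<tau> \<gamma> e by auto
  have supp: "\<bar>\<tau> * (x - ?c)\<bar> \<le> \<tau> * (\<gamma> / 2 + e)" if "- e \<le> x" "x \<le> \<gamma> + e" for x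
  proof -
    have "\<bar>x - ?c\<bar> \<le> \<gamma> / 2 + e" using that \<gamma> by (simp add: abs_le_iff field_simps)
    then show ?thesis using \<tau> by (simp add: abs_mult)
  qed
  have sin: "norm (multiplier (\<lambda>x. complex_of_real (sin ((t / 2) * (x - ?c))) * p x) y) \<le> \<theta> * (pi / 2) * norm z"
    using bernstein_sin[OF p \<theta> \<rho> supp, of y] unfolding \<theta>\<tau>[symmetric] z_def by (simp only: mult.assoc)
  let ?A = "- \<i> / 2 * cis (- (t / 2 * ?c))" and ?B = "\<i> / 2 * cis (t / 2 * ?c)"
  define w where "w = ?A *\<^sub>C blinfun_apply (T (t / 2)) z + ?B *\<^sub>C blinfun_apply (T (- (t / 2))) z"
  have wn: "norm w \<le> t * \<alpha> / 2 * norm z"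
    using sin unfolding multiplier_sin[OF p] w_def z_def \<theta>_def by (simp add: mult_ac)
  have "(2 * \<i> * cis (t / 2 * ?c)) *\<^sub>C blinfun_apply (T (t / 2)) w
      = ((2 * \<i> * cis (t / 2 * ?c)) * ?A) *\<^sub>C blinfun_apply (T (t / 2 + t / 2)) z
        + ((2 * \<i> * cis (t / 2 * ?c)) * ?B) *\<^sub>C blinfun_apply (T (t / 2 + - (t / 2))) z"
    unfolding w_def T_add blinfun.add_right T_scaleC scaleC_add_right scaleC_scaleC ..
  also have "(2 * \<i> * cis (t / 2 * ?c)) * ?A = - (\<i> * \<i>) * (cis (t / 2 * ?c) * cis (- (t / 2 * ?c)))"
    by (simp only: mult_ac) simp
  also have "\<dots> = 1" unfolding cis_mult by simp
  also have "(2 * \<i> * cis (t / 2 * ?c)) * ?B = (\<i> * \<i>) * (cis (t / 2 * ?c) * cis (t / 2 * ?c))"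
    by (simp only: mult_ac) simp
  also have "\<dots> = - cis (t * ?c)" unfolding cis_mult by (simp add: field_simps)
  finally have eq: "(2 * \<i> * cis (t / 2 * ?c)) *\<^sub>C blinfun_apply (T (t / 2)) w = blinfun_apply (T t) z - cis (t * ?c) *\<^sub>C z"
    by (simp add: scaleC.minus_left)
  have "norm (blinfun_apply (T t) z - cis (t * ?c) *\<^sub>C z) = 2 * norm w"
    unfolding eq[symmetric] by (simp add: norm_scaleC norm_mult)
  then have 1: "norm (blinfun_apply (T t) z - cis (t * ?c) *\<^sub>C z) \<le> t * \<alpha> * norm z" using wn by simp
  have "cis (t * ?c) *\<^sub>C z - z = (cis (t * ?c) - cis 0) *\<^sub>C z" by (simp add: scaleC.diff_left)
  then have "norm (cis (t * ?c) *\<^sub>C z - z) \<le> \<bar>t * ?c - 0\<bar> * norm z"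
    by (simp only: norm_scaleC) (rule mult_right_mono[OF cmod_cis_diff_le norm_ge_zero])
  then have 2: "norm (cis (t * ?c) *\<^sub>C z - z) \<le> t * ?c * norm z" using t \<gamma> by simp
  have "norm (blinfun_apply (T t) z - z) \<le> t * \<alpha> * norm z + t * ?c * norm z"
    using norm_triangle_ineq[of "blinfun_apply (T t) z - cis (t * ?c) *\<^sub>C z" "cis (t * ?c) *\<^sub>C z - z"] 1 2 by simp
  also have "\<dots> = t * (\<gamma> + 2 * e) * norm z" by (simp add: \<alpha>_def algebra_simps)
  finally show ?thesis unfolding z_def .
qed

text \<open>The estimate on approximants is homogeneous, so the factor \<open>c\<close> of their
  limit cancels. For fixed \<open>e\<close> the approximants converge; only afterwards does
  \<open>e\<close> tend to 0.\<close>

lemma norm_T_diff_id_le: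
  assumes sp: "beurling_spectrum T \<subseteq> {0..\<gamma>}" and \<gamma>: "0 < \<gamma>" and t: "0 < t" "t \<le> pi / (2 * \<gamma>)"
  shows "norm (T t - id_blinfun) \<le> \<gamma> * t"
proof (rule norm_blinfun_bound)
  show "0 \<le> \<gamma> * t" using \<gamma> t by simp
  fix y
  have eps: "norm (blinfun_apply (T t) y - y) \<le> t * (\<gamma> + 2 * e) * norm y" if e: "0 < e" "e \<le> \<gamma> / 4" for e
  proof -
    obtain c \<psi> N where c: "c \<noteq> 0" and \<psi>: "\<And>n. test_fun (- e) (\<gamma> + e) (N n) (\<psi> n)"
      and lim: "\<And>y. (\<lambda>n. multiplier (\<psi> n) y) \<longlonglongrightarrow> c *\<^sub>C y"
      using spectral_approximation[OF sp less_imp_le[OF \<gamma>] e(1)] by metis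
    have l: "(\<lambda>n. norm (blinfun_apply (T t) (multiplier (\<psi> n) y) - multiplier (\<psi> n) y))
        \<longlonglongrightarrow> norm (blinfun_apply (T t) (c *\<^sub>C y) - c *\<^sub>C y)"
      by (intro tendsto_norm tendsto_diff lim bounded_linear.tendsto[OF blinfun.bounded_linear_right])
    have r: "(\<lambda>n. t * (\<gamma> + 2 * e) * norm (multiplier (\<psi> n) y)) \<longlonglongrightarrow> t * (\<gamma> + 2 * e) * norm (c *\<^sub>C y)"
      by (intro tendsto_mult_left tendsto_norm lim)
    have "norm (blinfun_apply (T t) (c *\<^sub>C y) - c *\<^sub>C y) \<le> t * (\<gamma> + 2 * e) * norm (c *\<^sub>C y)"
      by (rule LIMSEQ_le[OF l r]) (use norm_T_diff_multiplier_le[OF \<gamma> e t \<psi>] in blast)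
    then have "norm c * norm (blinfun_apply (T t) y - y) \<le> norm c * (t * (\<gamma> + 2 * e) * norm y)"
      unfolding T_scaleC scaleC.diff_right[symmetric] norm_scaleC by (simp only: mult_ac)
    then show ?thesis using c by simp
  qed
  have "(\<lambda>n. t * (\<gamma> + 2 * (\<gamma> / 4 * inverse (real (Suc n)))) * norm y) \<longlonglongrightarrow> t * (\<gamma> + 2 * (\<gamma> / 4 * 0)) * norm y"
    by (intro tendsto_intros LIMSEQ_inverse_real_of_nat)
  then have "norm (blinfun_apply (T t) y - y) \<le> t * (\<gamma> + 2 * (\<gamma> / 4 * 0)) * norm y"
  proof (rule LIMSEQ_le_const)
    have "\<gamma> / 4 * inverse (real (Suc n)) \<le> \<gamma> / 4" for n
      using \<gamma> by (simp add: field_simps)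
    then show "\<exists>N. \<forall>n\<ge>N. norm (blinfun_apply (T t) y - y) \<le> t * (\<gamma> + 2 * (\<gamma> / 4 * inverse (real (Suc n)))) * norm y"
      using eps \<gamma> by (intro exI[of _ 0] allI impI eps) auto
  qed
  then show "norm (blinfun_apply (T t - id_blinfun) y) \<le> \<gamma> * t * norm y"
    by (simp add: blinfun.diff_left mult_ac)
qed

end

text \<open>The difference of the two sides has derivative sin u + cos u - 1, nonnegative on the
  first quadrant because (sin u + cos u)^2 = 1 + 2 sin u cos u.\<close>

lemma le_one_minus_cos_plus_sin:
  assumes "0 \<le> x" "x \<le> pi / 2"
  shows "x \<le> 1 - cos x + sin (x :: real)"
proof -
  have "1 - cos 0 + sin 0 - 0 \<le> 1 - cos x + sin x - x"
  proof (rule DERIV_nonneg_imp_nondecreasing[OF assms(1)])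
    fix u assume u: "0 \<le> u" "u \<le> x"
    have s: "0 \<le> sin u" "0 \<le> cos u"
      using u assms by (auto intro!: sin_ge_zero cos_ge_zero)
    have "1 \<le> (sin u + cos u)\<^sup>2"
      using s by (simp add: power2_sum sin_cos_squared_add)
    then have "1 \<le> sin u + cos u" using s by (metis abs_le_square_iff abs_of_nonneg add_nonneg_nonneg one_power2 abs_one)
    moreover have "((\<lambda>x. 1 - cos x + sin x - x) has_real_derivative sin u + cos u - 1) (at u)"
      by (auto intro!: derivative_eq_intros)
    ultimately show "\<exists>d. ((\<lambda>x. 1 - cos x + sin x - x) has_real_derivative d) (at u) \<and> 0 \<le> d"
      by (intro exI[of _ "sin u + cos u - 1"]) auto
  qed
  then show ?thesis by simp
qed

lemma one_minus_cos_plus_sin_eq: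
  "1 - cos x + sin x = 2 * sqrt 2 * sin (x / 2) * sin (x / 2 + pi / 4)" for x :: real
proof -
  have r: "2 * r * s * (r / 2 * q) = (r * r) * (s * q)" for r s q :: real by simp
  have "sin (x / 2 + pi / 4) = sqrt 2 / 2 * (sin (x / 2) + cos (x / 2))"
    by (simp add: sin_add sin_45 cos_45 algebra_simps)
  then have "2 * sqrt 2 * sin (x / 2) * sin (x / 2 + pi / 4)
      = (sqrt 2 * sqrt 2) * (sin (x / 2) * (sin (x / 2) + cos (x / 2)))"
    by (simp only: r)
  also have "sqrt 2 * sqrt 2 = (2 :: real)" by simp
  also have "2 * (sin (x / 2) * (sin (x / 2) + cos (x / 2)))
      = 2 * (sin (x / 2))\<^sup>2 + 2 * sin (x / 2) * cos (x / 2)"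
    by (simp add: power2_eq_square algebra_simps)
  also have "\<dots> = (1 - cos x) + sin x"
    using cos_double_sin[of "x / 2"] sin_double[of "x / 2"] by simp
  finally show ?thesis by simp
qed

theorem theorem1p3:
  fixes T :: "real \<Rightarrow> 'a::complex_banach \<Rightarrow>\<^sub>L 'a" and \<gamma> :: real
  assumes "representation T" and "isometric T" and "strongly_continuous T"
    and "\<gamma> > 0" and "beurling_spectrum T \<subseteq> {0..\<gamma>}"
  shows "\<forall>t \<in> {0..pi / (2 * \<gamma>)}.
           norm (T t - id_blinfun) \<le> 1 - cos (\<gamma> * t) + sin (\<gamma> * t) \<and>
           1 - cos (\<gamma> * t) + sin (\<gamma> * t)
             = 2 * sqrt 2 * sin (\<gamma> * t / 2) * sin (\<gamma> * t / 2 + pi / 4)"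
proof
  fix t assume t: "t \<in> {0..pi / (2 * \<gamma>)}"
  interpret isometric_representation T by unfold_locales fact+
  have "norm (T t - id_blinfun) \<le> \<gamma> * t"
  \<comment> \<open>The case \<open>t = 0\<close> is separate because the sine series is set up for
    \<theta> > 0, and \<theta> is proportional to \<open>t\<close>.\<close>
  proof (cases "t = 0")
    case True
    then have "T t = id_blinfun" by (auto intro: blinfun_eqI)
    then show ?thesis using True by simp
  next
    case False
    then show ?thesis using norm_T_diff_id_le[OF assms(5,4)] t by simp
  qed
  also have "\<dots> \<le> 1 - cos (\<gamma> * t) + sin (\<gamma> * t)"
    by (rule le_one_minus_cos_plus_sin) (use t assms(4) in \<open>auto simp: field_simps\<close>)
  finally show "norm (T t - id_blinfun) \<le> 1 - cos (\<gamma> * t) + sin (\<gamma> * t) \<and>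
           1 - cos (\<gamma> * t) + sin (\<gamma> * t)
             = 2 * sqrt 2 * sin (\<gamma> * t / 2) * sin (\<gamma> * t / 2 + pi / 4)"
    using one_minus_cos_plus_sin_eq[of "\<gamma> * t"] by simp
qed

end
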